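(* Let $F_1,F_2$ be cumulative distribution functions of nonnegative random variables with densities $f_1,f_2$ that are continuous and positive on $(0,\infty)$. Let $r>0$ and suppose that hypothesis $H_0^*$ (stated in the context) holds with this $r$, i.e. $F_2(t)=F_1(rt)$ for all $t\ge 0$ and, for the redundant system with one main and one stand-by unit, the failure time $T_2$ of the stand-by unit has, conditionally on the failure time of the main unit being $y$, the density $f_2(t)$ for $t\le y$ and $f_1(t+ry-y)$ for $t>y$. Let the three samples $(T_{1i})_{i\le n_1}$, $(T_{2i})_{i\le n_2}$, $(T_i)_{i\le n}$ and the estimators $\hat F_1,\hat F_2,\hat F^{(1)},\hat F^{(2)}$ be as in the context, with $\hat g(y)=\hat r y$. Suppose that $n\to\infty$ and $n_i/n\to l_i\in(0,1)$ for $i=1,2$. Then the statistic $$X=\sqrt n\int_0^\infty\left[\hat F^{(1)}(t)-\hat F^{(2)}(t)\right]dt$$ converges in distribution to the normal law $N(0,\sigma^2)$, where $$\sigma^2=\mathbf{Var}(T_i)+\frac1{l_1}\mathbf{Var}(H(T_{1i}))+\frac{c^2r^2}{l_2}\mathbf{Var}(T_{2i}),$$ $$H(x)=x\left[c+r-1-F_1(x/r)-rF_2(x)\right]+r\,\mathbf{E}\left(\mathbf 1_{\{T_{1i}\le x/r\}}T_{1i}\right)+r\,\mathbf{E}\left(\mathbf 1_{\{T_{2i}\le x\}}T_{2i}\right),$$ $$c=\frac1{\mu_2}\int_0^\infty y\,[1-F_2(y)]\,dF_1(y),\qquad \mu_2=\mathbf{E}(T_{2i}).$$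
   Context: Redundant system with one main unit and one "warm" stand-by unit: the main unit has failure time $T_1$ with c.d.f. $F_1$ and density $f_1$ ("hot" conditions). The stand-by unit has failure time $T_2$; it functions in "warm" conditions, with c.d.f. $F_2$ and density $f_2$, until the failure of the main unit, and is then switched to "hot" conditions. The failure time of the system is $T=T_1\vee T_2=\max(T_1,T_2)$. Hypothesis $H_0^*$: for some $r>0$, $F_2(t)=F_1(rt)$ for all $t\ge0$, and the conditional density of $T_2$ given $T_1=y$ is $$f_{T_2\mid T_1=y}(t)=\begin{cases} f_2(t), & t\le y,\\ f_1(t+ry-y), & t>y.\end{cases}$$ Consequently the c.d.f. of the system failure time is $F(t)=\int_0^t F_1(t+ry-y)\,dF_1(y)$. Data: $T_{11},\dots,T_{1n_1}$ are i.i.d. failure times of $n_1$ units tested in "hot" conditions (c.d.f. $F_1$); $T_{21},\dots,T_{2n_2}$ are i.i.d. failure times of $n_2$ units tested in "warm" conditions (c.d.f. $F_2$); $T_1,\dots,T_n$ are i.i.d. failure times of $n$ redundant systems (c.d.f. $F$). From here on, and in the claim, $T_i$ denotes the failure time of the $i$-th system in this last sample. The three samples are mutually independent. Estimators: for $j=1,2$, $$\hat F_j(t)=\frac1{n_j}\sum_{i=1}^{n_j}\mathbf 1_{\{T_{ji}\le t\}},\qquad \hat\mu_j=\frac1{n_j}\sum_{i=1}^{n_j}T_{ji},\qquad \hat r=\frac{\hat\mu_1}{\hat\mu_2},\qquad \hat g(y)=\hat r y,$$ $$\hat F^{(1)}(t)=\frac1n\sum_{i=1}^n\mathbf 1_{\{T_i\le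 t\}},\qquad \hat F^{(2)}(t)=\int_0^t\hat F_1(t+\hat g(y)-y)\,d\hat F_1(y).$$ *)

theory Defs
  imports "HOL-Probability.Probability"
begin

text \<open>A density is fixed by its c.d.f. only up to null sets; we take a version that vanishes on
  the negative half-line. Its value at 0 is irrelevant.\<close>

definition lifetime_cdf_density :: "(real \<Rightarrow> real) \<Rightarrow> (real \<Rightarrow> real) \<Rightarrow> bool" where
  "lifetime_cdf_density F f \<longleftrightarrow>
     (\<forall>x<0. f x = 0) \<and> (\<forall>x>0. 0 < f x) \<and> continuous_on {0<..} f \<and>
     prob_space (density lborel f) \<and> F = cdf (density lborel f)"

definition standby_cond_density ::
    "(real \<Rightarrow> real) \<Rightarrow> (real \<Rightarrow> real) \<Rightarrow> real \<Rightarrow> real \<Rightarrow> real \<Rightarrow> real" where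
  "standby_cond_density f1 f2 r y t = (if t \<le> y then f2 t else f1 (t + r * y - y))"

text \<open>Failure times \<open>Y\<close> of the main unit and \<open>Z\<close> of the stand-by unit of one system. That \<open>Y\<close> has
  density \<open>f1\<close> and that \<open>Z\<close> has the given conditional density given \<open>Y = y\<close> is expressed by
  the joint density.\<close>

definition H0_star ::
    "'w measure \<Rightarrow> (real \<Rightarrow> real) \<Rightarrow> (real \<Rightarrow> real) \<Rightarrow> (real \<Rightarrow> real) \<Rightarrow> (real \<Rightarrow> real) \<Rightarrow> real \<Rightarrow>
     ('w \<Rightarrow> real) \<Rightarrow> ('w \<Rightarrow> real) \<Rightarrow> bool" where
  "H0_star M F1 F2 f1 f2 r Y Z \<longleftrightarrow>
     (\<forall>t\<ge>0. F2 t = F1 (r * t)) \<and>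
     distributed M (lborel \<Otimes>\<^sub>M lborel) (\<lambda>\<omega>. (Y \<omega>, Z \<omega>))
       (\<lambda>(y, t). ennreal (f1 y * standby_cond_density f1 f2 r y t))"

text \<open>A sample of size \<open>n\<close> consists of the first \<open>n\<close> members \<open>X 0, \<dots>, X (n - 1)\<close> of a sequence.\<close>

definition emp_cdf :: "(nat \<Rightarrow> 'w \<Rightarrow> real) \<Rightarrow> nat \<Rightarrow> 'w \<Rightarrow> real \<Rightarrow> real" where
  "emp_cdf X n \<omega> t = 1 / real n * (\<Sum>i<n. indicator {..t} (X i \<omega>))"

definition emp_mean :: "(nat \<Rightarrow> 'w \<Rightarrow> real) \<Rightarrow> nat \<Rightarrow> 'w \<Rightarrow> real" where
  "emp_mean X n \<omega> = 1 / real n * (\<Sum>i<n. X i \<omega>)"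

definition r_hat ::
    "(nat \<Rightarrow> 'w \<Rightarrow> real) \<Rightarrow> (nat \<Rightarrow> 'w \<Rightarrow> real) \<Rightarrow> nat \<Rightarrow> nat \<Rightarrow> 'w \<Rightarrow> real" where
  "r_hat T1 T2 m1 m2 \<omega> = emp_mean T1 m1 \<omega> / emp_mean T2 m2 \<omega>"

definition g_hat ::
    "(nat \<Rightarrow> 'w \<Rightarrow> real) \<Rightarrow> (nat \<Rightarrow> 'w \<Rightarrow> real) \<Rightarrow> nat \<Rightarrow> nat \<Rightarrow> 'w \<Rightarrow> real \<Rightarrow> real" where
  "g_hat T1 T2 m1 m2 \<omega> y = r_hat T1 T2 m1 m2 \<omega> * y"

text \<open>Integrals \<open>dF\<close> are Lebesgue-Stieltjes integrals, i.e. integrals over \<open>interval_measure F\<close>.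
  Both end points of the range belong to the domain of integration.\<close>

definition system_cdf_hat ::
    "(nat \<Rightarrow> 'w \<Rightarrow> real) \<Rightarrow> (nat \<Rightarrow> 'w \<Rightarrow> real) \<Rightarrow> nat \<Rightarrow> nat \<Rightarrow> 'w \<Rightarrow> real \<Rightarrow> real" where
  "system_cdf_hat T1 T2 m1 m2 \<omega> t =
     (LINT y:{0..t}|interval_measure (emp_cdf T1 m1 \<omega>).
        emp_cdf T1 m1 \<omega> (t + g_hat T1 T2 m1 m2 \<omega> y - y))"

definition test_stat ::
    "(nat \<Rightarrow> 'w \<Rightarrow> real) \<Rightarrow> (nat \<Rightarrow> 'w \<Rightarrow> real) \<Rightarrow> (nat \<Rightarrow> 'w \<Rightarrow> real) \<Rightarrow> nat \<Rightarrow> nat \<Rightarrow> nat \<Rightarrow> 'w \<Rightarrow> real"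
  where
  "test_stat T1 T2 T m1 m2 n \<omega> =
     sqrt (real n) * (LBINT t:{0..}. emp_cdf T n \<omega> t - system_cdf_hat T1 T2 m1 m2 \<omega> t)"

text \<open>Below \<open>X1\<close> and \<open>X2\<close> stand for a member of the first and second sample.\<close>

definition c_const ::
    "'w measure \<Rightarrow> (real \<Rightarrow> real) \<Rightarrow> (real \<Rightarrow> real) \<Rightarrow> ('w \<Rightarrow> real) \<Rightarrow> real" where
  "c_const M F1 F2 X2 =
     1 / prob_space.expectation M X2 * (LINT y:{0..}|interval_measure F1. y * (1 - F2 y))"

definition H_fun ::
    "'w measure \<Rightarrow> (real \<Rightarrow> real) \<Rightarrow> (real \<Rightarrow> real) \<Rightarrow> real \<Rightarrow> ('w \<Rightarrow> real) \<Rightarrow> ('w \<Rightarrow> real) \<Rightarrow> real \<Rightarrow> real"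
  where
  "H_fun M F1 F2 r X1 X2 x =
     x * (c_const M F1 F2 X2 + r - 1 - F1 (x / r) - r * F2 x)
     + r * prob_space.expectation M (\<lambda>\<omega>. indicator {..x / r} (X1 \<omega>) * X1 \<omega>)
     + r * prob_space.expectation M (\<lambda>\<omega>. indicator {..x} (X2 \<omega>) * X2 \<omega>)"

end

theory Submission imports Defs begin

text \<open>Integrated in closed form, the statistic is a function of averages: as soon as all
  observations are nonnegative, it equals \<open>sqrt n\<close> times
  \<open>mean T1 + V (r_hat) - mean T\<close>, where \<open>V \<rho>\<close> is the average of \<open>max 0 (T1 k - \<rho> * T1 j)\<close> over all
  pairs \<open>(k, j)\<close> (\<open>test_stat_eq\<close>). Under the null hypothesis a system fails at a time distributed like
  \<open>y + max 0 (w - r * y)\<close> for independent \<open>y\<close>, \<open>w\<close> with c.d.f. \<open>F1\<close> (\<open>law_of_system\<close>). Hence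
  \<open>E T = E T1 + U r\<close> with \<open>U \<rho> = E (max 0 (w - \<rho> * y))\<close>, and the leading terms of the statistic
  are centred.

  Two nonlinearities have to be removed. The first is that \<open>V r\<close> is an average over pairs. Since
  \<open>max 0 (x - c)\<close> is the integral over \<open>s\<close> of the product of the indicators of \<open>s < x\<close> and of
  \<open>c \<le> s\<close>, the difference between \<open>V r\<close> and its projection onto averages over single observations
  is an integral of products of two empirical tail errors. Each of these has variance of order
  \<open>1/n\<close>, so the difference is of order \<open>1/n\<close> (\<open>excess_residual_eq_integral\<close>,
  \<open>expectation_excess_residual\<close>).

  The second is the random argument \<open>r_hat\<close>. Every \<open>V \<rho>\<close> converges to \<open>U \<rho>\<close> in probability, \<open>V\<close> is
  convex in \<open>\<rho>\<close>, and \<open>U\<close> has a derivative at \<open>r\<close>; for convex random functions this already allows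
  \<open>V (r_hat) - V r\<close> to be replaced by \<open>U' r * (r_hat - r)\<close> (\<open>convex_delta_method\<close>). As
  \<open>U' r = - c * E T2\<close> and \<open>r_hat - r = (mean T1 - r * mean T2) / mean T2\<close>, this contributes
  \<open>- c * (mean T1 - r * mean T2)\<close> (\<open>excess_at_ratio_of_means\<close>).

  What is left is a sum of three independent centred averages: of \<open>- H (T1 k)\<close> up to a constant
  (\<open>H_fun_eq_excess_proj\<close>), of \<open>c * r * T2 k\<close>, and of \<open>- T k\<close>. Their characteristic functions multiply
  and converge by the central limit theorem, terms that vanish in probability do not affect the limit
  of a characteristic function (\<open>char_add_vanishing\<close>), and Levy's continuity theorem concludes.\<close>

section \<open>Convergence in probability\<close>

context prob_space
begin

text \<open>Measurability is part of both notions, so that probabilities of tail events mean what they should.\<close>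

definition vanishes_in_prob :: "(nat \<Rightarrow> 'a \<Rightarrow> real) \<Rightarrow> bool" where
  "vanishes_in_prob R \<longleftrightarrow> (\<forall>n. random_variable borel (R n)) \<and>
     (\<forall>\<epsilon>>0. (\<lambda>n. prob {\<omega>\<in>space M. \<epsilon> < \<bar>R n \<omega>\<bar>}) \<longlonglongrightarrow> 0)"

definition bounded_in_prob :: "(nat \<Rightarrow> 'a \<Rightarrow> real) \<Rightarrow> bool" where
  "bounded_in_prob R \<longleftrightarrow> (\<forall>n. random_variable borel (R n)) \<and>
     (\<forall>\<epsilon>>0. \<exists>K>0. \<forall>\<^sub>F n in sequentially. prob {\<omega>\<in>space M. K < \<bar>R n \<omega>\<bar>} < \<epsilon>)"

lemma vanishes_in_prob_measurable: "vanishes_in_prob R \<Longrightarrow> random_variable borel (R n)"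
  by (simp add: vanishes_in_prob_def)

lemma bounded_in_prob_measurable: "bounded_in_prob R \<Longrightarrow> random_variable borel (R n)"
  by (simp add: bounded_in_prob_def)

lemma vanishes_in_probI:
  assumes "\<And>n. random_variable borel (R n)"
    and "\<And>\<epsilon> \<delta>. \<epsilon> > 0 \<Longrightarrow> \<delta> > 0 \<Longrightarrow> \<forall>\<^sub>F n in sequentially. prob {\<omega>\<in>space M. \<epsilon> < \<bar>R n \<omega>\<bar>} < \<delta>"
  shows "vanishes_in_prob R"
  unfolding vanishes_in_prob_def
proof (intro conjI allI impI assms order_tendstoI)
  fix \<epsilon> a :: real assume "a < 0"
  then show "\<forall>\<^sub>F n in sequentially. a < prob {\<omega>\<in>space M. \<epsilon> < \<bar>R n \<omega>\<bar>}"
    by (intro always_eventually allI) (rule less_le_trans[OF _ measure_nonneg])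
qed

lemma vanishes_in_probD:
  assumes "vanishes_in_prob R" "\<epsilon> > 0" "\<delta> > 0"
  shows "\<forall>\<^sub>F n in sequentially. prob {\<omega>\<in>space M. \<epsilon> < \<bar>R n \<omega>\<bar>} < \<delta>"
  using assms unfolding vanishes_in_prob_def by (auto dest!: spec[of _ \<epsilon>] intro: order_tendstoD)

lemma prob_exceed_le_two:
  fixes R U V :: "'a \<Rightarrow> real"
  assumes "random_variable borel U" "random_variable borel V"
    and "AE \<omega> in M. a < \<bar>R \<omega>\<bar> \<longrightarrow> b < \<bar>U \<omega>\<bar> \<or> c < \<bar>V \<omega>\<bar>"
  shows "prob {\<omega>\<in>space M. a < \<bar>R \<omega>\<bar>}
      \<le> prob {\<omega>\<in>space M. b < \<bar>U \<omega>\<bar>} + prob {\<omega>\<in>space M. c < \<bar>V \<omega>\<bar>}"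
proof -
  note [measurable] = assms(1,2)
  have ev: "{\<omega>\<in>space M. b < \<bar>U \<omega>\<bar>} \<in> events" "{\<omega>\<in>space M. c < \<bar>V \<omega>\<bar>} \<in> events"
    by measurable
  have "prob {\<omega>\<in>space M. a < \<bar>R \<omega>\<bar>}
      \<le> prob ({\<omega>\<in>space M. b < \<bar>U \<omega>\<bar>} \<union> {\<omega>\<in>space M. c < \<bar>V \<omega>\<bar>})"
    by (rule finite_measure_mono_AE) (use assms(3) ev in auto)
  also have "\<dots> \<le> prob {\<omega>\<in>space M. b < \<bar>U \<omega>\<bar>} + prob {\<omega>\<in>space M. c < \<bar>V \<omega>\<bar>}"
    by (rule measure_Un_le) (use ev in auto)
  finally show ?thesis .
qed

text \<open>The closure properties of \<open>vanishes_in_prob\<close> come from one comparison of tail events: a large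
  value of \<open>R\<close> forces a large value of \<open>U\<close> or of \<open>V\<close>.\<close>

lemma vanishes_in_prob_cover:
  fixes R U V :: "nat \<Rightarrow> 'a \<Rightarrow> real"
  assumes "\<And>n. random_variable borel (R n)"
    and rv: "\<And>n. random_variable borel (U n)" "\<And>n. random_variable borel (V n)"
    and cover: "\<And>\<epsilon> \<delta>. \<epsilon> > 0 \<Longrightarrow> \<delta> > 0 \<Longrightarrow> \<exists>b c.
        (\<forall>\<^sub>F n in sequentially. prob {\<omega>\<in>space M. b < \<bar>U n \<omega>\<bar>} < \<delta>) \<and>
        (\<forall>\<^sub>F n in sequentially. prob {\<omega>\<in>space M. c < \<bar>V n \<omega>\<bar>} < \<delta>) \<and>
        (\<forall>\<^sub>F n in sequentially. AE \<omega> in M. \<epsilon> < \<bar>R n \<omega>\<bar> \<longrightarrow> b < \<bar>U n \<omega>\<bar> \<or> c < \<bar>V n \<omega>\<bar>)"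
  shows "vanishes_in_prob R"
proof (rule vanishes_in_probI)
  fix \<epsilon> \<delta> :: real assume "\<epsilon> > 0" "\<delta> > 0"
  then obtain b c where
      "\<forall>\<^sub>F n in sequentially. prob {\<omega>\<in>space M. b < \<bar>U n \<omega>\<bar>} < \<delta> / 2"
      "\<forall>\<^sub>F n in sequentially. prob {\<omega>\<in>space M. c < \<bar>V n \<omega>\<bar>} < \<delta> / 2"
      "\<forall>\<^sub>F n in sequentially. AE \<omega> in M. \<epsilon> < \<bar>R n \<omega>\<bar> \<longrightarrow> b < \<bar>U n \<omega>\<bar> \<or> c < \<bar>V n \<omega>\<bar>"
    using cover[of \<epsilon> "\<delta> / 2"] by (meson half_gt_zero)
  then show "\<forall>\<^sub>F n in sequentially. prob {\<omega>\<in>space M. \<epsilon> < \<bar>R n \<omega>\<bar>} < \<delta>"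
  proof eventually_elim
    case (elim n)
    with prob_exceed_le_two[OF rv elim(3)] show ?case by simp
  qed
qed (rule assms)

lemma vanishes_in_prob_add:
  assumes "vanishes_in_prob U" "vanishes_in_prob V"
  shows "vanishes_in_prob (\<lambda>n \<omega>. U n \<omega> + V n \<omega>)"
proof -
  note [measurable] = assms[THEN vanishes_in_prob_measurable]
  show ?thesis
  proof (rule vanishes_in_prob_cover[where U = U and V = V])
    fix \<epsilon> \<delta> :: real assume "\<epsilon> > 0" "\<delta> > 0"
    moreover have "AE \<omega> in M. \<epsilon> < \<bar>U n \<omega> + V n \<omega>\<bar> \<longrightarrow> \<epsilon>/2 < \<bar>U n \<omega>\<bar> \<or> \<epsilon>/2 < \<bar>V n \<omega>\<bar>" for n
      by (rule AE_I2) linarith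
    ultimately show "\<exists>b c.
        (\<forall>\<^sub>F n in sequentially. prob {\<omega>\<in>space M. b < \<bar>U n \<omega>\<bar>} < \<delta>) \<and>
        (\<forall>\<^sub>F n in sequentially. prob {\<omega>\<in>space M. c < \<bar>V n \<omega>\<bar>} < \<delta>) \<and>
        (\<forall>\<^sub>F n in sequentially. AE \<omega> in M. \<epsilon> < \<bar>U n \<omega> + V n \<omega>\<bar> \<longrightarrow> b < \<bar>U n \<omega>\<bar> \<or> c < \<bar>V n \<omega>\<bar>)"
      using vanishes_in_probD[OF assms(1), of "\<epsilon>/2" \<delta>] vanishes_in_probD[OF assms(2), of "\<epsilon>/2" \<delta>]
      by (intro exI[of _ "\<epsilon>/2"] conjI) (simp_all add: always_eventually)
  qed measurable
qed

lemma vanishes_in_prob_le: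
  assumes "vanishes_in_prob S" "\<And>n. random_variable borel (R n)"
    and "\<forall>\<^sub>F n in sequentially. AE \<omega> in M. \<bar>R n \<omega>\<bar> \<le> \<bar>S n \<omega>\<bar>"
  shows "vanishes_in_prob R"
proof (rule vanishes_in_prob_cover[where U = S and V = S])
  fix \<epsilon> \<delta> :: real assume "\<epsilon> > 0" "\<delta> > 0"
  moreover have "\<forall>\<^sub>F n in sequentially. AE \<omega> in M. \<epsilon> < \<bar>R n \<omega>\<bar> \<longrightarrow> \<epsilon> < \<bar>S n \<omega>\<bar> \<or> \<epsilon> < \<bar>S n \<omega>\<bar>"
    using assms(3) by (rule eventually_mono) (auto elim: AE_mp)
  ultimately show "\<exists>b c.
        (\<forall>\<^sub>F n in sequentially. prob {\<omega>\<in>space M. b < \<bar>S n \<omega>\<bar>} < \<delta>) \<and>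
        (\<forall>\<^sub>F n in sequentially. prob {\<omega>\<in>space M. c < \<bar>S n \<omega>\<bar>} < \<delta>) \<and>
        (\<forall>\<^sub>F n in sequentially. AE \<omega> in M. \<epsilon> < \<bar>R n \<omega>\<bar> \<longrightarrow> b < \<bar>S n \<omega>\<bar> \<or> c < \<bar>S n \<omega>\<bar>)"
    using vanishes_in_probD[OF assms(1), of "\<epsilon>" \<delta>] by (intro exI[of _ "\<epsilon>"] conjI) auto
qed (use assms vanishes_in_prob_measurable in auto)

lemma vanishes_in_prob_abs: "vanishes_in_prob R \<Longrightarrow> vanishes_in_prob (\<lambda>n \<omega>. \<bar>R n \<omega>\<bar>)"
  by (auto simp: vanishes_in_prob_def intro: borel_measurable_abs)

lemma vanishes_in_prob_mult_bounded:
  assumes "vanishes_in_prob U" "bounded_in_prob V"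
  shows "vanishes_in_prob (\<lambda>n \<omega>. U n \<omega> * V n \<omega>)"
proof -
  note [measurable] = vanishes_in_prob_measurable[OF assms(1)] bounded_in_prob_measurable[OF assms(2)]
  show ?thesis
  proof (rule vanishes_in_prob_cover[where U = U and V = V])
    fix \<epsilon> \<delta> :: real assume \<epsilon>: "\<epsilon> > 0" "\<delta> > 0"
    then obtain K where K: "K > 0" "\<forall>\<^sub>F n in sequentially. prob {\<omega>\<in>space M. K < \<bar>V n \<omega>\<bar>} < \<delta>"
      using assms(2) unfolding bounded_in_prob_def by blast
    have "AE \<omega> in M. \<epsilon> < \<bar>U n \<omega> * V n \<omega>\<bar> \<longrightarrow> \<epsilon>/K < \<bar>U n \<omega>\<bar> \<or> K < \<bar>V n \<omega>\<bar>" for n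
    proof (rule AE_I2, rule impI, rule ccontr)
      fix \<omega> assume "\<epsilon> < \<bar>U n \<omega> * V n \<omega>\<bar>" "\<not> (\<epsilon>/K < \<bar>U n \<omega>\<bar> \<or> K < \<bar>V n \<omega>\<bar>)"
      moreover from this have "\<bar>U n \<omega>\<bar> * \<bar>V n \<omega>\<bar> \<le> \<epsilon>/K * K"
        using K(1) \<epsilon> by (intro mult_mono) auto
      ultimately show False using K(1) by (simp add: abs_mult)
    qed
    then show "\<exists>b c.
        (\<forall>\<^sub>F n in sequentially. prob {\<omega>\<in>space M. b < \<bar>U n \<omega>\<bar>} < \<delta>) \<and>
        (\<forall>\<^sub>F n in sequentially. prob {\<omega>\<in>space M. c < \<bar>V n \<omega>\<bar>} < \<delta>) \<and>
        (\<forall>\<^sub>F n in sequentially. AE \<omega> in M. \<epsilon> < \<bar>U n \<omega> * V n \<omega>\<bar> \<longrightarrow> b < \<bar>U n \<omega>\<bar> \<or> c < \<bar>V n \<omega>\<bar>)"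
      using K \<epsilon> vanishes_in_probD[OF assms(1), of "\<epsilon>/K" \<delta>]
      by (intro exI[of _ "\<epsilon>/K"] exI[of _ K] conjI) (simp_all add: always_eventually)
  qed measurable
qed

lemma vanishes_in_prob_null_seq:
  assumes "a \<longlonglongrightarrow> (0::real)"
  shows "vanishes_in_prob (\<lambda>n \<omega>. a n)"
proof (rule vanishes_in_probI)
  fix \<epsilon> \<delta> :: real assume "\<epsilon> > 0" "\<delta> > 0"
  have "\<forall>\<^sub>F n in sequentially. \<bar>a n\<bar> < \<epsilon>"
    using tendsto_rabs[OF assms] \<open>\<epsilon> > 0\<close> by (auto intro: order_tendstoD)
  then show "\<forall>\<^sub>F n in sequentially. prob {\<omega>\<in>space M. \<epsilon> < \<bar>a n\<bar>} < \<delta>"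
    by eventually_elim (use \<open>\<delta> > 0\<close> in auto)
qed auto

lemma bounded_in_prob_const: "bounded_in_prob (\<lambda>n \<omega>. c)"
  unfolding bounded_in_prob_def
proof (safe, simp)
  fix \<epsilon> :: real assume "\<epsilon> > 0"
  moreover have "{\<omega> \<in> space M. \<bar>c\<bar> + 1 < \<bar>c\<bar>} = {}" by auto
  ultimately show "\<exists>K>0. \<forall>\<^sub>F n in sequentially. prob {\<omega> \<in> space M. K < \<bar>c\<bar>} < \<epsilon>"
    by (intro exI[of _ "\<bar>c\<bar> + 1"]) simp
qed

lemma vanishes_in_prob_cmult:
  "vanishes_in_prob R \<Longrightarrow> vanishes_in_prob (\<lambda>n \<omega>. c * R n \<omega>)"
  using vanishes_in_prob_mult_bounded[OF _ bounded_in_prob_const, of R c] by (simp add: mult.commute)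

lemma bounded_in_prob_null_seq_mult:
  "a \<longlonglongrightarrow> 0 \<Longrightarrow> bounded_in_prob R \<Longrightarrow> vanishes_in_prob (\<lambda>n \<omega>. a n * R n \<omega>)"
  by (rule vanishes_in_prob_mult_bounded[OF vanishes_in_prob_null_seq])

lemma prob_exceed_le_expectation:
  assumes "integrable M R" "0 < K"
  shows "prob {\<omega>\<in>space M. K < \<bar>R \<omega>\<bar>} \<le> expectation (\<lambda>\<omega>. \<bar>R \<omega>\<bar>) / K"
proof -
  note [measurable] = borel_measurable_integrable[OF assms(1)]
  have "prob {\<omega>\<in>space M. K < \<bar>R \<omega>\<bar>} \<le> prob {\<omega>\<in>space M. K \<le> \<bar>R \<omega>\<bar>}"
    by (rule finite_measure_mono) auto
  also have "\<dots> \<le> expectation (\<lambda>\<omega>. \<bar>R \<omega>\<bar>) / K"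
    by (rule integral_Markov_inequality_measure[where A = "space M"]) (use assms in auto)
  finally show ?thesis .
qed

lemma bounded_in_prob_expectation:
  assumes "\<And>n. integrable M (R n)" "\<And>n. expectation (\<lambda>\<omega>. \<bar>R n \<omega>\<bar>) \<le> C"
  shows "bounded_in_prob R"
  unfolding bounded_in_prob_def
proof safe
  fix n show "random_variable borel (R n)" using assms(1) by auto
next
  fix \<epsilon> :: real assume "\<epsilon> > 0"
  define K where "K = (\<bar>C\<bar> + 1) / \<epsilon>"
  have "K > 0" using \<open>\<epsilon> > 0\<close> by (simp add: K_def)
  have "prob {\<omega> \<in> space M. K < \<bar>R n \<omega>\<bar>} < \<epsilon>" for n
  proof -
    have "prob {\<omega>\<in>space M. K < \<bar>R n \<omega>\<bar>} \<le> C / K"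
      by (rule order_trans[OF prob_exceed_le_expectation])
         (use assms \<open>K > 0\<close> in \<open>auto intro: divide_right_mono\<close>)
    also have "C / K < \<epsilon>"
      using \<open>\<epsilon> > 0\<close> \<open>K > 0\<close> by (simp add: divide_less_eq) (simp add: K_def)
    finally show ?thesis .
  qed
  with \<open>K > 0\<close> show "\<exists>K>0. \<forall>\<^sub>F n in sequentially. prob {\<omega> \<in> space M. K < \<bar>R n \<omega>\<bar>} < \<epsilon>"
    by (intro exI[of _ K]) auto
qed

lemma bounded_in_prob_add:
  assumes U: "bounded_in_prob U" and V: "bounded_in_prob V"
  shows "bounded_in_prob (\<lambda>n \<omega>. U n \<omega> + V n \<omega>)"
proof -
  note [measurable] = U[THEN bounded_in_prob_measurable] V[THEN bounded_in_prob_measurable]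
  show ?thesis
    unfolding bounded_in_prob_def
  proof safe
    fix \<epsilon> :: real assume "\<epsilon> > 0"
    then obtain K L where K: "K > 0" "\<forall>\<^sub>F n in sequentially. prob {\<omega>\<in>space M. K < \<bar>U n \<omega>\<bar>} < \<epsilon> / 2"
      and L: "L > 0" "\<forall>\<^sub>F n in sequentially. prob {\<omega>\<in>space M. L < \<bar>V n \<omega>\<bar>} < \<epsilon> / 2"
      using U V unfolding bounded_in_prob_def by (meson half_gt_zero)
    have "\<forall>\<^sub>F n in sequentially. prob {\<omega>\<in>space M. K + L < \<bar>U n \<omega> + V n \<omega>\<bar>} < \<epsilon>"
      using K(2) L(2)
    proof eventually_elim
      case (elim n)
      have "prob {\<omega>\<in>space M. K + L < \<bar>U n \<omega> + V n \<omega>\<bar>}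
          \<le> prob {\<omega>\<in>space M. K < \<bar>U n \<omega>\<bar>} + prob {\<omega>\<in>space M. L < \<bar>V n \<omega>\<bar>}"
        by (rule prob_exceed_le_two, measurable, rule AE_I2) linarith
      with elim show ?case by simp
    qed
    then show "\<exists>K>0. \<forall>\<^sub>F n in sequentially. prob {\<omega>\<in>space M. K < \<bar>U n \<omega> + V n \<omega>\<bar>} < \<epsilon>"
      using K(1) L(1) by (intro exI[of _ "K + L"]) auto
  qed measurable
qed

lemma bounded_in_prob_cmult:
  assumes U: "bounded_in_prob U"
  shows "bounded_in_prob (\<lambda>n \<omega>. c * U n \<omega>)"
proof -
  note [measurable] = U[THEN bounded_in_prob_measurable]
  show ?thesis
    unfolding bounded_in_prob_def
  proof safe
    fix \<epsilon> :: real assume "\<epsilon> > 0"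
    then obtain K where K: "K > 0" "\<forall>\<^sub>F n in sequentially. prob {\<omega>\<in>space M. K < \<bar>U n \<omega>\<bar>} < \<epsilon>"
      using U unfolding bounded_in_prob_def by blast
    have "\<forall>\<^sub>F n in sequentially. prob {\<omega>\<in>space M. (\<bar>c\<bar> + 1) * K < \<bar>c * U n \<omega>\<bar>} < \<epsilon>"
      using K(2)
    proof eventually_elim
      case (elim n)
      have "prob {\<omega>\<in>space M. (\<bar>c\<bar> + 1) * K < \<bar>c * U n \<omega>\<bar>} \<le> prob {\<omega>\<in>space M. K < \<bar>U n \<omega>\<bar>}"
      proof (rule finite_measure_mono; safe?)
        fix \<omega> assume *: "(\<bar>c\<bar> + 1) * K < \<bar>c * U n \<omega>\<bar>"
        show "K < \<bar>U n \<omega>\<bar>"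
        proof (rule ccontr)
          assume "\<not> K < \<bar>U n \<omega>\<bar>"
          then have "\<bar>c * U n \<omega>\<bar> \<le> (\<bar>c\<bar> + 1) * K"
            unfolding abs_mult by (intro mult_mono) auto
          with * show False by simp
        qed
      qed measurable
      with elim show ?case by simp
    qed
    then show "\<exists>K>0. \<forall>\<^sub>F n in sequentially. prob {\<omega>\<in>space M. K < \<bar>c * U n \<omega>\<bar>} < \<epsilon>"
      using K(1) by (intro exI[of _ "(\<bar>c\<bar> + 1) * K"]) auto
  qed measurable
qed

lemma vanishes_in_prob_imp_bounded:
  "vanishes_in_prob R \<Longrightarrow> bounded_in_prob R"
  unfolding bounded_in_prob_def
  by (auto intro!: exI[of _ 1] dest: vanishes_in_prob_measurable vanishes_in_probD[of _ 1])

lemma bounded_in_prob_convergent_mult: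
  assumes "a \<longlonglongrightarrow> (l::real)" "bounded_in_prob R"
  shows "bounded_in_prob (\<lambda>n \<omega>. a n * R n \<omega>)"
proof -
  have "vanishes_in_prob (\<lambda>n \<omega>. (a n - l) * R n \<omega>)"
    using assms by (intro bounded_in_prob_null_seq_mult) (auto simp: LIM_zero)
  then have "bounded_in_prob (\<lambda>n \<omega>. (a n - l) * R n \<omega> + l * R n \<omega>)"
    by (rule bounded_in_prob_add[OF vanishes_in_prob_imp_bounded bounded_in_prob_cmult[OF assms(2)]])
  then show ?thesis by (simp add: algebra_simps)
qed

text \<open>Off an event of small probability the denominator is at least \<open>\<mu> / 2\<close>.\<close>

lemma bounded_in_prob_divide:
  assumes D: "bounded_in_prob D" and m: "vanishes_in_prob (\<lambda>n \<omega>. m n \<omega> - \<mu>)" and "\<mu> > 0"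
  shows "bounded_in_prob (\<lambda>n \<omega>. D n \<omega> / m n \<omega>)"
proof -
  have [measurable]: "random_variable borel (D n)" for n
    using D by (rule bounded_in_prob_measurable)
  have mm: "random_variable borel (\<lambda>\<omega>. m n \<omega> - \<mu>)" for n
    using m by (rule vanishes_in_prob_measurable)
  have [measurable]: "random_variable borel (m n)" for n
    using borel_measurable_add[OF mm[of n] borel_measurable_const[of \<mu>]] by simp
  show ?thesis
    unfolding bounded_in_prob_def
  proof safe
    fix \<epsilon> :: real assume "\<epsilon> > 0"
    then obtain K where K: "K > 0" "\<forall>\<^sub>F n in sequentially. prob {\<omega>\<in>space M. K < \<bar>D n \<omega>\<bar>} < \<epsilon> / 2"
      using D unfolding bounded_in_prob_def by (meson half_gt_zero)
    have m': "\<forall>\<^sub>F n in sequentially. prob {\<omega>\<in>space M. \<mu>/2 < \<bar>m n \<omega> - \<mu>\<bar>} < \<epsilon> / 2"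
      using vanishes_in_probD[OF m, of "\<mu>/2" "\<epsilon>/2"] \<open>\<mu> > 0\<close> \<open>\<epsilon> > 0\<close> by simp
    have "\<forall>\<^sub>F n in sequentially. prob {\<omega>\<in>space M. 2 * K / \<mu> < \<bar>D n \<omega> / m n \<omega>\<bar>} < \<epsilon>"
      using K(2) m'
    proof eventually_elim
      case (elim n)
      have "prob {\<omega>\<in>space M. 2 * K / \<mu> < \<bar>D n \<omega> / m n \<omega>\<bar>}
        \<le> prob {\<omega>\<in>space M. K < \<bar>D n \<omega>\<bar>} + prob {\<omega>\<in>space M. \<mu>/2 < \<bar>m n \<omega> - \<mu>\<bar>}"
      proof (rule prob_exceed_le_two, simp, simp, rule AE_I2, rule impI, rule ccontr)
        fix \<omega> assume *: "2 * K / \<mu> < \<bar>D n \<omega> / m n \<omega>\<bar>" "\<not> (K < \<bar>D n \<omega>\<bar> \<or> \<mu>/2 < \<bar>m n \<omega> - \<mu>\<bar>)"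
        then have "\<mu> / 2 \<le> m n \<omega>" by linarith
        then have "\<bar>D n \<omega> / m n \<omega>\<bar> \<le> K / (\<mu> / 2)"
          unfolding abs_divide using * \<open>\<mu> > 0\<close> by (intro frac_le) auto
        with * show False by (simp add: mult.commute)
      qed
      with elim show ?case by simp
    qed
    then show "\<exists>K>0. \<forall>\<^sub>F n in sequentially. prob {\<omega>\<in>space M. K < \<bar>D n \<omega> / m n \<omega>\<bar>} < \<epsilon>"
      using K(1) \<open>\<mu> > 0\<close> by (intro exI[of _ "2 * K / \<mu>"]) auto
  qed simp
qed

end

section \<open>Convex random functions at random arguments\<close>

text \<open>Every difference quotient of a convex function at \<open>r\<close> over a step of length at most \<open>\<eta>\<close> lies
  between the quotients over the steps \<open>- \<eta>\<close> and \<open>\<eta>\<close>.\<close>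

lemma convex_on_slope_between:
  fixes f :: "real \<Rightarrow> real"
  assumes "convex_on UNIV f" "\<bar>d\<bar> \<le> \<eta>" "d \<noteq> 0"
  shows "(f r - f (r - \<eta>)) / \<eta> \<le> (f (r + d) - f r) / d" "(f (r + d) - f r) / d \<le> (f (r + \<eta>) - f r) / \<eta>"
proof -
  have slope: "(f b - f a) / (b - a) \<le> (f c - f a) / (c - a)"
      "(f c - f a) / (c - a) \<le> (f c - f b) / (c - b)" if "a < b" "b < c" for a b c
  proof -
    have sym: "(f u - f v) / (u - v) = (f v - f u) / (v - u)" for u v
      by (metis minus_diff_eq minus_divide_divide)
    show "(f b - f a) / (b - a) \<le> (f c - f a) / (c - a)" "(f c - f a) / (c - a) \<le> (f c - f b) / (c - b)"
      using convex_on_slope_le[OF assms(1), of a c b] that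
      unfolding sym[of a b] sym[of a c] sym[of b c] by auto
  qed
  have \<eta>: "\<eta> > 0" using assms by linarith
  have mid: "(f r - f (r - \<eta>)) / \<eta> \<le> (f (r + \<eta>) - f r) / \<eta>"
    using slope[of "r - \<eta>" r "r + \<eta>"] \<eta> by simp
  consider "d = \<eta>" | "d = - \<eta>" | "0 < d" "d < \<eta>" | "- \<eta> < d" "d < 0"
    using assms by linarith
  then have "(f r - f (r - \<eta>)) / \<eta> \<le> (f (r + d) - f r) / d
     \<and> (f (r + d) - f r) / d \<le> (f (r + \<eta>) - f r) / \<eta>"
  proof cases
    case 1
    then show ?thesis using mid by simp
  next
    case 2
    then have "(f (r + d) - f r) / d = (f r - f (r - \<eta>)) / \<eta>"
      using \<eta> by (simp add: field_simps)
    then show ?thesis using mid by simp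
  next
    case 3
    then show ?thesis using slope[of r "r + d" "r + \<eta>"] slope[of "r - \<eta>" r "r + d"] \<eta>
      by auto
  next
    case 4
    have "(f (r + d) - f r) / d = (f r - f (r + d)) / (- d)"
      using 4 by (simp add: field_simps)
    then show ?thesis using 4 slope[of "r + d" r "r + \<eta>"] slope[of "r - \<eta>" "r + d" r] \<eta>
      by auto
  qed
  then show "(f r - f (r - \<eta>)) / \<eta> \<le> (f (r + d) - f r) / d" "(f (r + d) - f r) / d \<le> (f (r + \<eta>) - f r) / \<eta>"
    by auto
qed

text \<open>A convex random function may be evaluated at a random point near \<open>r\<close> as if it were its
  deterministic limit. The difference quotient over the random step lies between two quotients over
  fixed steps, these converge in probability to quotients of the limit, and for a short step the
  latter are close to the derivative. Convexity thus replaces uniform convergence near \<open>r\<close>.\<close>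

lemma (in prob_space) convex_delta_method:
  fixes V :: "nat \<Rightarrow> 'a \<Rightarrow> real \<Rightarrow> real"
  assumes convex: "\<And>n \<omega>. convex_on UNIV (V n \<omega>)"
    and pointwise: "\<And>\<rho>. vanishes_in_prob (\<lambda>n \<omega>. V n \<omega> \<rho> - U \<rho>)"
    and deriv: "(U has_real_derivative U') (at r)"
    and \<delta>: "vanishes_in_prob \<delta>"
    and scale: "bounded_in_prob (\<lambda>n \<omega>. a n * \<delta> n \<omega>)"
    and meas: "\<And>n. random_variable borel (\<lambda>\<omega>. V n \<omega> (r + \<delta> n \<omega>))"
  shows "vanishes_in_prob (\<lambda>n \<omega>. a n * (V n \<omega> (r + \<delta> n \<omega>) - V n \<omega> r) - U' * (a n * \<delta> n \<omega>))"
proof -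
  note [measurable] = meas vanishes_in_prob_measurable[OF \<delta>]
  have [measurable]: "random_variable borel (\<lambda>\<omega>. V n \<omega> \<rho>)" for n \<rho>
    using borel_measurable_add[OF vanishes_in_prob_measurable[OF pointwise[of \<rho>], of n]
        borel_measurable_const[of "U \<rho>"]] by simp
  \<comment> \<open>the error of the difference quotient over the random step\<close>
  define J where "J n \<omega> = (if \<delta> n \<omega> = 0 then 0 else (V n \<omega> (r + \<delta> n \<omega>) - V n \<omega> r) / \<delta> n \<omega> - U')" for n \<omega>
  have [measurable]: "random_variable borel (J n)" for n
    unfolding J_def by measurable
  have "vanishes_in_prob J"
  proof (rule vanishes_in_probI)
    fix \<epsilon> \<theta> :: real assume \<epsilon>: "\<epsilon> > 0" "\<theta> > 0"
    have "((\<lambda>h. (U (r + h) - U r) / h) \<longlongrightarrow> U') (at 0)"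
      using deriv by (simp add: DERIV_def)
    then have "\<forall>\<^sub>F h in at 0. \<bar>(U (r + h) - U r) / h - U'\<bar> < \<epsilon> / 2"
      using \<epsilon>(1) by (auto simp: dist_real_def dest!: tendstoD[where e = "\<epsilon>/2"])
    then obtain d where d: "d > 0" "\<And>h. h \<noteq> 0 \<Longrightarrow> \<bar>h\<bar> < d \<Longrightarrow> \<bar>(U (r + h) - U r) / h - U'\<bar> < \<epsilon> / 2"
      unfolding eventually_at by (auto simp: dist_real_def)
    define \<eta> where "\<eta> = d / 2"
    have \<eta>: "\<eta> > 0" "\<bar>(U (r + \<eta>) - U r) / \<eta> - U'\<bar> < \<epsilon> / 2" "\<bar>(U r - U (r - \<eta>)) / \<eta> - U'\<bar> < \<epsilon> / 2"
      using d(1) d(2)[of \<eta>] d(2)[of "-\<eta>"]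
      by (auto simp: \<eta>_def minus_divide_left[symmetric] minus_divide_right[symmetric] diff_divide_distrib)
    \<comment> \<open>\<open>E n\<close> bounds, up to the factor \<open>1 / \<eta>\<close>, the error of both outer quotients\<close>
    define E where "E n \<omega> = \<bar>V n \<omega> r - U r\<bar> + (\<bar>V n \<omega> (r + \<eta>) - U (r + \<eta>)\<bar> + \<bar>V n \<omega> (r - \<eta>) - U (r - \<eta>)\<bar>)" for n \<omega>
    have "vanishes_in_prob E"
      unfolding E_def
      by (intro vanishes_in_prob_add vanishes_in_prob_abs pointwise)
    then have "\<forall>\<^sub>F n in sequentially. prob {\<omega>\<in>space M. \<eta> * (\<epsilon> / 2) < \<bar>E n \<omega>\<bar>} < \<theta> / 2"
      using \<eta>(1) \<epsilon> by (intro vanishes_in_probD) auto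
    moreover have "\<forall>\<^sub>F n in sequentially. prob {\<omega>\<in>space M. \<eta> < \<bar>\<delta> n \<omega>\<bar>} < \<theta> / 2"
      using \<eta>(1) \<epsilon> by (intro vanishes_in_probD[OF \<delta>]) auto
    ultimately show "\<forall>\<^sub>F n in sequentially. prob {\<omega>\<in>space M. \<epsilon> < \<bar>J n \<omega>\<bar>} < \<theta>"
    proof eventually_elim
      case (elim n)
      have "prob {\<omega>\<in>space M. \<epsilon> < \<bar>J n \<omega>\<bar>}
          \<le> prob {\<omega>\<in>space M. \<eta> * (\<epsilon> / 2) < \<bar>E n \<omega>\<bar>} + prob {\<omega>\<in>space M. \<eta> < \<bar>\<delta> n \<omega>\<bar>}"
      proof (rule prob_exceed_le_two)
        show "AE \<omega> in M. \<epsilon> < \<bar>J n \<omega>\<bar> \<longrightarrow> \<eta> * (\<epsilon> / 2) < \<bar>E n \<omega>\<bar> \<or> \<eta> < \<bar>\<delta> n \<omega>\<bar>"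
        proof (rule AE_I2, rule impI, rule ccontr)
          fix \<omega> assume J: "\<epsilon> < \<bar>J n \<omega>\<bar>" and "\<not> (\<eta> * (\<epsilon> / 2) < \<bar>E n \<omega>\<bar> \<or> \<eta> < \<bar>\<delta> n \<omega>\<bar>)"
          then have E: "E n \<omega> \<le> \<eta> * (\<epsilon> / 2)" and step: "\<bar>\<delta> n \<omega>\<bar> \<le> \<eta>" by auto
          have nz: "\<delta> n \<omega> \<noteq> 0" using J \<epsilon> by (auto simp: J_def)
          let ?f = "V n \<omega>"
          have "\<bar>(?f (r + \<eta>) - ?f r) / \<eta> - (U (r + \<eta>) - U r) / \<eta>\<bar> \<le> E n \<omega> / \<eta>"
            using \<eta>(1) unfolding diff_divide_distrib[symmetric] abs_divide E_def by (simp add: divide_right_mono)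
          moreover have "\<bar>(?f r - ?f (r - \<eta>)) / \<eta> - (U r - U (r - \<eta>)) / \<eta>\<bar> \<le> E n \<omega> / \<eta>"
            using \<eta>(1) unfolding diff_divide_distrib[symmetric] abs_divide E_def by (simp add: divide_right_mono)
          moreover have "E n \<omega> / \<eta> \<le> \<epsilon> / 2"
            using E \<eta>(1) by (simp add: divide_le_eq mult.commute)
          moreover note convex_on_slope_between[OF convex step nz, of n \<omega> r]
          ultimately have "\<bar>(?f (r + \<delta> n \<omega>) - ?f r) / \<delta> n \<omega> - U'\<bar> \<le> \<epsilon>"
            using \<eta>(2,3) unfolding abs_le_iff abs_less_iff by linarith
          with J nz show False by (simp add: J_def)
        qed
      qed (auto simp: E_def)
      with elim show ?case by simp
    qed
  qed measurable
  from vanishes_in_prob_mult_bounded[OF this scale]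
  show ?thesis
    by (rule back_subst[of vanishes_in_prob]) (auto simp: J_def fun_eq_iff field_simps)
qed

section \<open>Independence and characteristic functions\<close>

context prob_space
begin

lemma indep_vars_reindex_inj:
  assumes "inj_on f I" and ind: "indep_vars M' X (f ` I)"
  shows "indep_vars (\<lambda>i. M' (f i)) (\<lambda>i. X (f i)) I"
  unfolding indep_vars_def2
proof (intro conjI ballI)
  show "random_variable (M' (f i)) (X (f i))" if "i \<in> I" for i
    using ind that unfolding indep_vars_def2 by blast
  let ?F = "\<lambda>s. {X s -` A \<inter> space M |A. A \<in> sets (M' s)}"
  have sets: "indep_sets ?F (f ` I)"
    using ind unfolding indep_vars_def2 by blast
  show "indep_sets (\<lambda>i. ?F (f i)) I"
  proof (rule indep_setsI)
    show "?F (f i) \<subseteq> events" if "i \<in> I" for i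
      using sets that unfolding indep_sets_def by blast
    fix A J assume J: "J \<noteq> {}" "J \<subseteq> I" "finite J" and A: "\<forall>j\<in>J. A j \<in> ?F (f j)"
    have inj: "inj_on f J" using assms(1) J(2) by (rule inj_on_subset)
    let ?B = "\<lambda>s. A (the_inv_into J f s)"
    have B: "?B (f j) = A j" if "j \<in> J" for j
      using that by (simp add: the_inv_into_f_f[OF inj])
    have "prob (\<Inter>s\<in>f ` J. ?B s) = (\<Prod>s\<in>f ` J. prob (?B s))"
      using J A B by (intro indep_setsD[OF sets]) auto
    moreover have "(\<Inter>s\<in>f ` J. ?B s) = (\<Inter>j\<in>J. A j)"
      using B by auto
    moreover have "(\<Prod>s\<in>f ` J. prob (?B s)) = (\<Prod>j\<in>J. prob (A j))"
      using B by (simp add: prod.reindex[OF inj])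
    ultimately show "prob (\<Inter>j\<in>J. A j) = (\<Prod>j\<in>J. prob (A j))" by simp
  qed
qed

lemma char_scale:
  assumes [measurable]: "random_variable borel V"
  shows "char (distr M borel (\<lambda>\<omega>. a * V \<omega>)) t = char (distr M borel V) (a * t)"
  unfolding char_def by (simp add: integral_distr mult.commute mult.left_commute)

text \<open>Slutsky's lemma for characteristic functions: \<open>iexp (t * R)\<close> is within \<open>\<bar>t\<bar> * \<epsilon>\<close> of \<open>1\<close> when
  \<open>\<bar>R\<bar> \<le> \<epsilon>\<close>, and within \<open>2\<close> otherwise.\<close>

lemma char_add_vanishing:
  assumes V: "\<And>n. random_variable borel (V n)" and R: "vanishes_in_prob R"
    and lim: "(\<lambda>n. char (distr M borel (V n)) t) \<longlonglongrightarrow> \<phi>"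
  shows "(\<lambda>n. char (distr M borel (\<lambda>\<omega>. V n \<omega> + R n \<omega>)) t) \<longlonglongrightarrow> \<phi>"
proof -
  note [measurable] = V vanishes_in_prob_measurable[OF R]
  have diff: "cmod (char (distr M borel (\<lambda>\<omega>. V n \<omega> + R n \<omega>)) t - char (distr M borel (V n)) t)
      \<le> \<epsilon> * \<bar>t\<bar> + 2 * prob {\<omega>\<in>space M. \<epsilon> < \<bar>R n \<omega>\<bar>}" if "\<epsilon> > 0" for n \<epsilon>
  proof -
    have "char (distr M borel (\<lambda>\<omega>. V n \<omega> + R n \<omega>)) t - char (distr M borel (V n)) t
       = expectation (\<lambda>\<omega>. iexp (t * (V n \<omega> + R n \<omega>)) - iexp (t * V n \<omega>))"
      unfolding char_def
      by (subst (1 2) integral_distr) (auto intro!: Bochner_Integration.integral_diff[symmetric] integrable_iexp)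
    also have "cmod \<dots> \<le> expectation (\<lambda>\<omega>. \<epsilon> * \<bar>t\<bar> + 2 * indicator {\<omega>\<in>space M. \<epsilon> < \<bar>R n \<omega>\<bar>} \<omega>)"
    proof (rule order_trans[OF integral_norm_bound integral_mono])
      show "integrable M (\<lambda>\<omega>. cmod (iexp (t * (V n \<omega> + R n \<omega>)) - iexp (t * V n \<omega>)))"
        by (rule integrable_norm) (auto intro!: Bochner_Integration.integrable_diff integrable_iexp)
      show "integrable M (\<lambda>\<omega>. \<epsilon> * \<bar>t\<bar> + 2 * indicator {\<omega>\<in>space M. \<epsilon> < \<bar>R n \<omega>\<bar>} \<omega> :: real)"
        by (auto simp: less_top[symmetric])
      fix \<omega> assume \<omega>: "\<omega> \<in> space M"
      have eq: "iexp (t * (V n \<omega> + R n \<omega>)) - iexp (t * V n \<omega>) = iexp (t * V n \<omega>) * (iexp (t * R n \<omega>) - 1)"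
        by (simp add: algebra_simps exp_add[symmetric])
      have n1: "cmod (iexp (t * R n \<omega>) - 1) \<le> 2"
        using iexp_approx2[of "t * R n \<omega>" 0] by simp
      have n2: "cmod (iexp (t * R n \<omega>) - 1) \<le> \<bar>t * R n \<omega>\<bar>"
        using iexp_approx1[of "t * R n \<omega>" 0] by simp
      show "cmod (iexp (t * (V n \<omega> + R n \<omega>)) - iexp (t * V n \<omega>))
          \<le> \<epsilon> * \<bar>t\<bar> + 2 * indicator {\<omega>\<in>space M. \<epsilon> < \<bar>R n \<omega>\<bar>} \<omega>"
      proof (cases "\<epsilon> < \<bar>R n \<omega>\<bar>")
        case True
        with \<omega> n1 show ?thesis unfolding eq norm_mult
          using \<open>\<epsilon> > 0\<close> by (simp add: add_increasing)
      next
        case False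
        then have "\<bar>t * R n \<omega>\<bar> \<le> \<epsilon> * \<bar>t\<bar>"
          by (simp add: abs_mult mult.commute[of \<epsilon>] mult_left_mono)
        with False n2 show ?thesis unfolding eq norm_mult by simp
      qed
    qed
    also have "\<dots> = \<epsilon> * \<bar>t\<bar> + 2 * prob {\<omega>\<in>space M. \<epsilon> < \<bar>R n \<omega>\<bar>}"
      by (subst Bochner_Integration.integral_add) (auto simp: less_top[symmetric] prob_space)
    finally show ?thesis .
  qed
  have "(\<lambda>n. char (distr M borel (\<lambda>\<omega>. V n \<omega> + R n \<omega>)) t - char (distr M borel (V n)) t) \<longlonglongrightarrow> 0"
  proof (rule LIMSEQ_I)
    fix e :: real assume "e > 0"
    define \<epsilon> where "\<epsilon> = e / (2 * (\<bar>t\<bar> + 1))"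
    have \<epsilon>: "\<epsilon> > 0" "\<epsilon> * \<bar>t\<bar> \<le> e / 2" using \<open>e > 0\<close>
      by (auto simp: \<epsilon>_def field_simps)
    have "\<forall>\<^sub>F n in sequentially. prob {\<omega>\<in>space M. \<epsilon> < \<bar>R n \<omega>\<bar>} < e / 4"
      using vanishes_in_probD[OF R \<epsilon>(1), of "e / 4"] \<open>e > 0\<close> by simp
    then have "\<forall>\<^sub>F n in sequentially.
        cmod (char (distr M borel (\<lambda>\<omega>. V n \<omega> + R n \<omega>)) t - char (distr M borel (V n)) t - 0) < e"
    proof eventually_elim
      case (elim n)
      with diff[OF \<epsilon>(1), of n] \<epsilon>(2) show ?case by (simp only: diff_zero)
    qed
    then show "\<exists>N. \<forall>n\<ge>N. cmod (char (distr M borel (\<lambda>\<omega>. V n \<omega> + R n \<omega>)) t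
          - char (distr M borel (V n)) t - 0) < e"
      by (simp add: eventually_sequentially)
  qed
  from tendsto_add[OF this lim] show ?thesis by simp
qed

end

lemma
  assumes "\<sigma> > 0"
  shows real_distribution_normal: "real_distribution (density lborel (normal_density 0 \<sigma>))"
    and char_normal: "char (density lborel (normal_density 0 \<sigma>)) t = exp (- (\<sigma>\<^sup>2 * t\<^sup>2) / 2)"
proof -
  show "real_distribution (density lborel (normal_density 0 \<sigma>))"
    using prob_space_normal_density[OF assms, of 0]
    by (auto simp: real_distribution_def real_distribution_axioms_def)
  interpret S: real_distribution std_normal_distribution by (rule real_dist_normal_dist)
  have "distributed std_normal_distribution lborel (\<lambda>x. x) std_normal_density"
    unfolding distributed_def by (auto intro!: distr_id2 simp: distr_id2)
  then have "distributed std_normal_distribution lborel (\<lambda>x. 0 + \<sigma> * x) (normal_density (0 + \<sigma> * 0) (\<bar>\<sigma>\<bar> * 1))"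
    by (rule S.normal_density_affine) (use assms in auto)
  then have "density lborel (normal_density 0 \<sigma>) = distr std_normal_distribution lborel (\<lambda>x. \<sigma> * x)"
    using assms by (simp add: distributed_def)
  also have "\<dots> = distr std_normal_distribution borel (\<lambda>x. \<sigma> * x)"
    by (rule distr_cong) auto
  finally have "char (density lborel (normal_density 0 \<sigma>)) t = char std_normal_distribution (\<sigma> * t)"
    using S.char_scale[of "\<lambda>x. x" \<sigma> t] by (simp add: distr_id2)
  then show "char (density lborel (normal_density 0 \<sigma>)) t = exp (- (\<sigma>\<^sup>2 * t\<^sup>2) / 2)"
    by (simp add: char_std_normal_distribution power_mult_distrib)
qed

section \<open>Independent and identically distributed samples\<close>

locale iid_sample = prob_space M for M :: "'a measure" +
  fixes X :: "nat \<Rightarrow> 'a \<Rightarrow> real" and N :: "real measure"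
  assumes indep: "indep_vars (\<lambda>_. borel) X UNIV"
    and law: "\<And>k. distr M borel (X k) = N"
begin

lemma X_measurable [measurable]: "random_variable borel (X k)"
  using indep unfolding indep_vars_def2 by simp

lemma real_distribution_N: "real_distribution N"
  using real_distribution_distr[OF X_measurable] law by metis

sublocale N: real_distribution N
  by (rule real_distribution_N)

lemma measure_N_UNIV [simp]: "measure N UNIV = 1"
  using N.prob_space by simp

lemma integrable_sample:
  "g \<in> borel_measurable borel \<Longrightarrow> integrable M (\<lambda>\<omega>. g (X k \<omega>)) \<longleftrightarrow> integrable N g"
  for g :: "real \<Rightarrow> real"
  by (subst law[of k, symmetric]) (simp add: integrable_distr_eq)

lemma expectation_sample:
  "g \<in> borel_measurable borel \<Longrightarrow> expectation (\<lambda>\<omega>. g (X k \<omega>)) = N.expectation g"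
  for g :: "real \<Rightarrow> real"
  by (subst law[of k, symmetric]) (simp add: integral_distr)

lemma AE_sample: "Measurable.pred borel P \<Longrightarrow> (AE \<omega> in M. P (X k \<omega>)) \<longleftrightarrow> (AE x in N. P x)"
  by (subst law[of k, symmetric]) (simp add: AE_distr_iff)

definition fluctuation :: "(real \<Rightarrow> real) \<Rightarrow> nat \<Rightarrow> 'a \<Rightarrow> real" where
  "fluctuation g m \<omega> = (\<Sum>k<m. g (X k \<omega>) - N.expectation g) / sqrt (real m)"

lemma fluctuation_measurable [measurable]:
  assumes [measurable]: "g \<in> borel_measurable borel"
  shows "random_variable borel (fluctuation g m)"
  unfolding fluctuation_def by measurable

lemma indep_centred:
  assumes [measurable]: "g \<in> borel_measurable borel"
  shows "indep_vars (\<lambda>_. borel) (\<lambda>k \<omega>. g (X k \<omega>) - N.expectation g) UNIV"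
  by (rule indep_vars_compose2[OF indep, of "\<lambda>_ x. g x - N.expectation g"]) measurable

lemma
  fixes g :: "real \<Rightarrow> real"
  assumes [measurable]: "g \<in> borel_measurable borel" and sq: "integrable N (\<lambda>x. (g x)\<^sup>2)"
  shows integrable_centred_sum_square: "integrable M (\<lambda>\<omega>. (\<Sum>k<m. g (X k \<omega>) - N.expectation g)\<^sup>2)" (is "?I m")
    and expectation_centred_sum_square:
      "expectation (\<lambda>\<omega>. (\<Sum>k<m. g (X k \<omega>) - N.expectation g)\<^sup>2) = real m * N.variance g" (is "?E m")
proof -
  define Z where "Z k \<omega> = g (X k \<omega>) - N.expectation g" for k \<omega>
  have int: "integrable N g"
    by (rule N.square_integrable_imp_integrable[OF _ sq]) auto
  have Z: "integrable M (Z k)" "expectation (Z k) = 0" for k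
    using int integrable_sample[of "\<lambda>x. g x - N.expectation g" k]
      expectation_sample[of "\<lambda>x. g x - N.expectation g" k] by (auto simp: Z_def[abs_def])
  have N2: "integrable N (\<lambda>x. (g x - N.expectation g)\<^sup>2)"
    unfolding power2_diff using int sq by auto
  have Z2: "integrable M (\<lambda>\<omega>. (Z k \<omega>)\<^sup>2)" "expectation (\<lambda>\<omega>. (Z k \<omega>)\<^sup>2) = N.variance g" for k
    using N2 integrable_sample[of "\<lambda>x. (g x - N.expectation g)\<^sup>2" k]
      expectation_sample[of "\<lambda>x. (g x - N.expectation g)\<^sup>2" k] by (auto simp: Z_def)
  have "integrable M (\<lambda>\<omega>. (\<Sum>k<m. Z k \<omega>)\<^sup>2) \<and>
      expectation (\<lambda>\<omega>. (\<Sum>k<m. Z k \<omega>)\<^sup>2) = real m * N.variance g"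
  proof (induction m)
    case (Suc m)
    let ?S = "\<lambda>\<omega>. \<Sum>k<m. Z k \<omega>"
    have ind: "indep_var borel (Z m) borel ?S"
      by (rule indep_vars_sum[where X = Z]) (auto intro: indep_vars_subset[OF indep_centred[OF assms(1), folded Z_def]])
    have S: "integrable M ?S" "expectation ?S = 0"
      using Z by auto
    have eq: "(\<Sum>k<Suc m. Z k \<omega>)\<^sup>2 = (?S \<omega>)\<^sup>2 + 2 * (Z m \<omega> * ?S \<omega>) + (Z m \<omega>)\<^sup>2" for \<omega>
      by (simp add: power2_eq_square algebra_simps)
    note ZS = indep_var_lebesgue_integral[OF ind Z(1) S(1)] indep_var_integrable[OF ind Z(1) S(1)]
    show ?case
      unfolding eq using Suc Z2[of m] ZS Z(2)[of m] S(2) by (simp add: ring_distribs)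
  qed simp
  then show "?I m" "?E m" by (auto simp: Z_def)
qed

lemma
  fixes g :: "real \<Rightarrow> real"
  assumes [measurable]: "g \<in> borel_measurable borel" and sq: "integrable N (\<lambda>x. (g x)\<^sup>2)"
  shows integrable_fluctuation_square: "integrable M (\<lambda>\<omega>. (fluctuation g m \<omega>)\<^sup>2)"
    and expectation_fluctuation_square:
      "m > 0 \<Longrightarrow> expectation (\<lambda>\<omega>. (fluctuation g m \<omega>)\<^sup>2) = N.variance g"
  using integrable_centred_sum_square[OF assms, of m] expectation_centred_sum_square[OF assms, of m]
  unfolding fluctuation_def power_divide by auto

lemma bounded_fluctuation:
  fixes g :: "real \<Rightarrow> real"
  assumes [measurable]: "g \<in> borel_measurable borel" and sq: "integrable N (\<lambda>x. (g x)\<^sup>2)"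
  shows "bounded_in_prob (\<lambda>n. fluctuation g (m n))"
proof (rule bounded_in_prob_expectation)
  show int: "integrable M (fluctuation g (m n))" for n
    by (rule square_integrable_imp_integrable[OF _ integrable_fluctuation_square[OF assms]]) measurable
  show "expectation (\<lambda>\<omega>. \<bar>fluctuation g (m n) \<omega>\<bar>) \<le> 1 + N.variance g" for n
  proof -
    have "expectation (\<lambda>\<omega>. \<bar>fluctuation g (m n) \<omega>\<bar>) \<le> expectation (\<lambda>\<omega>. 1 + (fluctuation g (m n) \<omega>)\<^sup>2)"
    proof (rule integral_mono)
      fix \<omega>
      have "0 \<le> (\<bar>fluctuation g (m n) \<omega>\<bar> - 1)\<^sup>2 + \<bar>fluctuation g (m n) \<omega>\<bar>" by simp
      then show "\<bar>fluctuation g (m n) \<omega>\<bar> \<le> 1 + (fluctuation g (m n) \<omega>)\<^sup>2"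
        unfolding power2_diff by simp
    qed (use int integrable_fluctuation_square[OF assms] in auto)
    also have "\<dots> = 1 + expectation (\<lambda>\<omega>. (fluctuation g (m n) \<omega>)\<^sup>2)"
      using integrable_fluctuation_square[OF assms] by (simp add: prob_space)
    also have "\<dots> \<le> 1 + N.variance g"
      using expectation_fluctuation_square[OF assms, of "m n"]
      by (cases "m n = 0") (auto simp: fluctuation_def)
    finally show ?thesis .
  qed
qed

lemma mean_minus_expectation:
  "m > 0 \<Longrightarrow> (\<Sum>k<m. g (X k \<omega>)) / real m - N.expectation g = 1 / sqrt (real m) * fluctuation g m \<omega>"
  unfolding fluctuation_def
  by (simp add: sum_subtractf diff_divide_distrib)

lemma weak_law_of_large_numbers:
  fixes g :: "real \<Rightarrow> real"
  assumes [measurable]: "g \<in> borel_measurable borel" and sq: "integrable N (\<lambda>x. (g x)\<^sup>2)"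
    and m: "filterlim m at_top sequentially"
  shows "vanishes_in_prob (\<lambda>n \<omega>. (\<Sum>k<m n. g (X k \<omega>)) / real (m n) - N.expectation g)"
proof (rule vanishes_in_prob_le)
  have "filterlim (\<lambda>n. sqrt (real (m n))) at_top sequentially"
    by (rule filterlim_compose[OF sqrt_at_top filterlim_compose[OF filterlim_real_sequentially m]])
  then have "(\<lambda>n. 1 / sqrt (real (m n))) \<longlonglongrightarrow> 0"
    by (intro tendsto_divide_0[OF tendsto_const]) (rule filterlim_at_top_imp_at_infinity)
  then show "vanishes_in_prob (\<lambda>n \<omega>. 1 / sqrt (real (m n)) * fluctuation g (m n) \<omega>)"
    by (rule bounded_in_prob_null_seq_mult[OF _ bounded_fluctuation[OF assms(1,2)]])
  have "\<forall>\<^sub>F n in sequentially. m n > 0"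
    using m[unfolded filterlim_at_top, rule_format, of 1] by (simp add: Suc_le_eq)
  then show "\<forall>\<^sub>F n in sequentially. AE \<omega> in M. \<bar>(\<Sum>k<m n. g (X k \<omega>)) / real (m n) - N.expectation g\<bar>
      \<le> \<bar>1 / sqrt (real (m n)) * fluctuation g (m n) \<omega>\<bar>"
    by eventually_elim (simp only: mean_minus_expectation, simp)
qed measurable

text \<open>The central limit theorem, stated with characteristic functions so that a degenerate limit, the
  point mass at \<open>0\<close>, has the same form as a normal one.\<close>

lemma char_fluctuation:
  fixes g :: "real \<Rightarrow> real"
  assumes [measurable]: "g \<in> borel_measurable borel" and sq: "integrable N (\<lambda>x. (g x)\<^sup>2)"
  shows "(\<lambda>m. char (distr M borel (fluctuation g m)) t) \<longlonglongrightarrow> complex_of_real (exp (- (N.variance g * t\<^sup>2) / 2))"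
proof (cases "N.variance g = 0")
  case True
  have "AE \<omega> in M. fluctuation g m \<omega> = 0" if "m > 0" for m
  proof -
    have "expectation (\<lambda>\<omega>. (fluctuation g m \<omega>)\<^sup>2) = 0"
      using expectation_fluctuation_square[OF assms that] True by (rule trans)
    then show ?thesis
      using integral_nonneg_eq_0_iff_AE[OF integrable_fluctuation_square[OF assms, of m]] by simp
  qed
  then have "distr M borel (fluctuation g m) = distr M borel (\<lambda>_. 0)" if "m > 0" for m
    using that by (intro distr_cong_AE) auto
  then have "char (distr M borel (fluctuation g m)) t = 1" if "m > 0" for m
    using that by (simp add: char_def integral_distr prob_space del: distr_const)
  then have "\<forall>\<^sub>F m in sequentially. char (distr M borel (fluctuation g m)) t = 1"
    by (intro eventually_mono[OF eventually_gt_at_top[of 0]])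
  with True show ?thesis by (simp add: tendsto_eventually)
next
  case False
  define \<sigma> where "\<sigma> = sqrt (N.variance g)"
  have \<sigma>: "\<sigma> > 0" "\<sigma>\<^sup>2 = N.variance g"
    using False N.variance_positive[of g] by (auto simp: \<sigma>_def less_le)
  have N2: "integrable N (\<lambda>x. (g x - N.expectation g)\<^sup>2)"
    unfolding power2_diff using sq N.square_integrable_imp_integrable[OF _ sq] by auto
  have ind: "indep_vars (\<lambda>_. borel) (\<lambda>k \<omega>. g (X k \<omega>)) UNIV"
    by (rule indep_vars_compose2[OF indep, of "\<lambda>_. g"]) measurable
  have "weak_conv_m (\<lambda>m. distr M borel (\<lambda>\<omega>. (\<Sum>k<m. g (X k \<omega>) - N.expectation g) / sqrt (real m * \<sigma>\<^sup>2)))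
      std_normal_distribution"
  proof (rule central_limit_theorem[where \<mu> = "distr N borel g"])
    fix n
    show "integrable M (\<lambda>\<omega>. (g (X n \<omega>))\<^sup>2)"
      using sq by (simp add: integrable_sample[of "\<lambda>x. (g x)\<^sup>2"])
    show "expectation (\<lambda>\<omega>. g (X n \<omega>)) = N.expectation g"
      by (rule expectation_sample) measurable
    show "variance (\<lambda>\<omega>. g (X n \<omega>)) = \<sigma>\<^sup>2"
      unfolding \<sigma> using expectation_sample[of g n] expectation_sample[of "\<lambda>x. (g x - N.expectation g)\<^sup>2" n]
      by simp
    show "distr M borel (\<lambda>\<omega>. g (X n \<omega>)) = distr N borel g"
      by (subst law[of n, symmetric], subst distr_distr) (auto simp: comp_def)
  qed (use ind \<sigma> in auto)
  then have "(\<lambda>m. char (distr M borel (\<lambda>\<omega>. (\<Sum>k<m. g (X k \<omega>) - N.expectation g) / sqrt (real m * \<sigma>\<^sup>2))) (\<sigma> * t))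
      \<longlonglongrightarrow> char std_normal_distribution (\<sigma> * t)"
    by (intro levy_continuity1) (auto intro!: real_dist_normal_dist)
  moreover have "char (distr M borel (\<lambda>\<omega>. (\<Sum>k<m. g (X k \<omega>) - N.expectation g) / sqrt (real m * \<sigma>\<^sup>2))) (\<sigma> * t)
      = char (distr M borel (fluctuation g m)) t" for m
    using \<sigma>(1) by (simp add: char_def integral_distr fluctuation_def real_sqrt_mult)
  ultimately show ?thesis
    by (simp add: char_std_normal_distribution power_mult_distrib \<sigma>(2))
qed

lemma char_scaled_fluctuation:
  assumes [measurable]: "g \<in> borel_measurable borel"
  shows "char (distr M borel (\<lambda>\<omega>. a * fluctuation g m \<omega>)) t =
    (\<Prod>k<m. char (distr M borel (\<lambda>\<omega>. a * (g (X k \<omega>) - N.expectation g) / sqrt (real m))) t)"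
proof -
  have "indep_vars (\<lambda>_. borel) (\<lambda>k \<omega>. a * (g (X k \<omega>) - N.expectation g) / sqrt (real m)) {..<m}"
    by (rule indep_vars_subset[OF indep_vars_compose2[OF indep, of "\<lambda>_ x. a * (g x - N.expectation g) / sqrt (real m)"]])
       auto
  from char_distr_sum[OF this, of t] show ?thesis
    by (simp add: fluctuation_def sum_distrib_left sum_divide_distrib)
qed

lemma pair_law:
  assumes "j \<noteq> k"
  shows "distr M (borel \<Otimes>\<^sub>M borel) (\<lambda>\<omega>. (X j \<omega>, X k \<omega>)) = N \<Otimes>\<^sub>M N"
proof -
  have "indep_var borel (X j) borel (\<lambda>\<omega>. \<Sum>i\<in>{k}. X i \<omega>)"
    using assms by (intro indep_vars_sum indep_vars_subset[OF indep]) auto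
  then show ?thesis
    unfolding indep_var_distribution_eq by (simp add: law)
qed

end

context prob_space
begin

text \<open>All variables of all samples are jointly independent, so the characteristic function of the
  combination is a product over the disjoint union of the three index sets.\<close>

lemma char_three_fluctuations:
  fixes X1 X2 X3 :: "nat \<Rightarrow> 'a \<Rightarrow> real"
  assumes S1: "iid_sample M X1 N1" and S2: "iid_sample M X2 N2" and S3: "iid_sample M X3 N3"
    and indep: "indep_vars (\<lambda>_. borel)
       (\<lambda>s. case s of Inl k \<Rightarrow> X1 k | Inr (Inl k) \<Rightarrow> X2 k | Inr (Inr k) \<Rightarrow> X3 k) (UNIV :: (nat + nat + nat) set)"
    and [measurable]: "g1 \<in> borel_measurable borel" "g2 \<in> borel_measurable borel" "g3 \<in> borel_measurable borel"
  shows "char (distr M borel (\<lambda>\<omega>. a1 * iid_sample.fluctuation X1 N1 g1 m1 \<omega>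
      + (a2 * iid_sample.fluctuation X2 N2 g2 m2 \<omega> + a3 * iid_sample.fluctuation X3 N3 g3 m3 \<omega>))) t
    = char (distr M borel (iid_sample.fluctuation X1 N1 g1 m1)) (a1 * t)
      * (char (distr M borel (iid_sample.fluctuation X2 N2 g2 m2)) (a2 * t)
      * char (distr M borel (iid_sample.fluctuation X3 N3 g3 m3)) (a3 * t))"
proof -
  interpret A: iid_sample M X1 N1 by fact
  interpret B: iid_sample M X2 N2 by fact
  interpret C: iid_sample M X3 N3 by fact
  define h where "h s x = (case s of
      Inl k \<Rightarrow> a1 * (g1 x - A.N.expectation g1) / sqrt (real m1)
    | Inr (Inl k) \<Rightarrow> a2 * (g2 x - B.N.expectation g2) / sqrt (real m2)
    | Inr (Inr k) \<Rightarrow> a3 * (g3 x - C.N.expectation g3) / sqrt (real m3))" for s :: "nat + nat + nat" and x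
  define W where "W s = (case s of Inl k \<Rightarrow> X1 k | Inr (Inl k) \<Rightarrow> X2 k | Inr (Inr k) \<Rightarrow> X3 k)" for s :: "nat + nat + nat"
  let ?I = "{..<m1} <+> ({..<m2} <+> {..<m3})"
  have h_meas: "h s \<in> borel_measurable borel" for s
  proof (cases s)
    case (Inr u)
    then show ?thesis by (cases u) (simp_all add: h_def[abs_def])
  qed (simp add: h_def[abs_def])
  have "indep_vars (\<lambda>_. borel) (\<lambda>s \<omega>. h s (W s \<omega>)) ?I"
    by (rule indep_vars_compose2[OF indep_vars_subset[OF indep[folded W_def]]]) (auto intro: h_meas)
  from char_distr_sum[OF this, of t]
  have "char (distr M borel (\<lambda>\<omega>. \<Sum>s\<in>?I. h s (W s \<omega>))) t
    = (\<Prod>k<m1. char (distr M borel (\<lambda>\<omega>. a1 * (g1 (X1 k \<omega>) - A.N.expectation g1) / sqrt (real m1))) t)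
    * ((\<Prod>k<m2. char (distr M borel (\<lambda>\<omega>. a2 * (g2 (X2 k \<omega>) - B.N.expectation g2) / sqrt (real m2))) t)
    * (\<Prod>k<m3. char (distr M borel (\<lambda>\<omega>. a3 * (g3 (X3 k \<omega>) - C.N.expectation g3) / sqrt (real m3))) t))"
    by (simp add: prod.Plus W_def h_def)
  also have "(\<lambda>\<omega>. \<Sum>s\<in>?I. h s (W s \<omega>))
    = (\<lambda>\<omega>. a1 * A.fluctuation g1 m1 \<omega> + (a2 * B.fluctuation g2 m2 \<omega> + a3 * C.fluctuation g3 m3 \<omega>))"
    by (simp add: fun_eq_iff sum.Plus W_def h_def A.fluctuation_def B.fluctuation_def C.fluctuation_def
        sum_distrib_left sum_divide_distrib)
  finally show ?thesis
    by (simp add: A.char_scaled_fluctuation[symmetric] B.char_scaled_fluctuation[symmetric]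
        C.char_scaled_fluctuation[symmetric] char_scale)
qed

lemma char_three_fluctuations_tendsto:
  fixes X1 X2 X3 :: "nat \<Rightarrow> 'a \<Rightarrow> real"
  assumes S1: "iid_sample M X1 N1" and S2: "iid_sample M X2 N2" and S3: "iid_sample M X3 N3"
    and indep: "indep_vars (\<lambda>_. borel)
       (\<lambda>s. case s of Inl k \<Rightarrow> X1 k | Inr (Inl k) \<Rightarrow> X2 k | Inr (Inr k) \<Rightarrow> X3 k) (UNIV :: (nat + nat + nat) set)"
    and meas [measurable]: "g1 \<in> borel_measurable borel" "g2 \<in> borel_measurable borel" "g3 \<in> borel_measurable borel"
    and sq: "integrable N1 (\<lambda>x. (g1 x)\<^sup>2)" "integrable N2 (\<lambda>x. (g2 x)\<^sup>2)" "integrable N3 (\<lambda>x. (g3 x)\<^sup>2)"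
    and lim: "filterlim m1 at_top sequentially" "filterlim m2 at_top sequentially" "filterlim m3 at_top sequentially"
    and var: "v = a1\<^sup>2 * prob_space.variance N1 g1 + a2\<^sup>2 * prob_space.variance N2 g2 + a3\<^sup>2 * prob_space.variance N3 g3"
  shows "(\<lambda>n. char (distr M borel (\<lambda>\<omega>. a1 * iid_sample.fluctuation X1 N1 g1 (m1 n) \<omega>
      + (a2 * iid_sample.fluctuation X2 N2 g2 (m2 n) \<omega> + a3 * iid_sample.fluctuation X3 N3 g3 (m3 n) \<omega>))) t)
    \<longlonglongrightarrow> complex_of_real (exp (- (v * t\<^sup>2) / 2))"
proof -
  interpret A: iid_sample M X1 N1 by fact
  interpret B: iid_sample M X2 N2 by fact
  interpret C: iid_sample M X3 N3 by fact
  have "(\<lambda>n. char (distr M borel (A.fluctuation g1 (m1 n))) (a1 * t)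
      * (char (distr M borel (B.fluctuation g2 (m2 n))) (a2 * t)
      * char (distr M borel (C.fluctuation g3 (m3 n))) (a3 * t)))
    \<longlonglongrightarrow> complex_of_real (exp (- (A.N.variance g1 * (a1 * t)\<^sup>2) / 2))
      * (complex_of_real (exp (- (B.N.variance g2 * (a2 * t)\<^sup>2) / 2))
      * complex_of_real (exp (- (C.N.variance g3 * (a3 * t)\<^sup>2) / 2)))"
    by (intro tendsto_mult filterlim_compose[OF A.char_fluctuation[OF meas(1) sq(1)] lim(1)]
        filterlim_compose[OF B.char_fluctuation[OF meas(2) sq(2)] lim(2)]
        filterlim_compose[OF C.char_fluctuation[OF meas(3) sq(3)] lim(3)])
  moreover have "exp (- (A.N.variance g1 * (a1 * t)\<^sup>2) / 2) * (exp (- (B.N.variance g2 * (a2 * t)\<^sup>2) / 2)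
      * exp (- (C.N.variance g3 * (a3 * t)\<^sup>2) / 2)) = exp (- (v * t\<^sup>2) / 2)"
    unfolding var exp_add[symmetric] by (simp add: power_mult_distrib field_simps)
  ultimately show ?thesis
    by (simp only: char_three_fluctuations[OF S1 S2 S3 indep meas] of_real_mult[symmetric])
qed

end

section \<open>The expected excess of \<open>p x\<close> over \<open>q y\<close>\<close>

text \<open>This product form separates \<open>x\<close> from \<open>c\<close>, which is what makes expectations and empirical averages
  of the excess tractable.\<close>

lemma max_0_diff_eq_integral:
  fixes x c :: real
  shows "integrable lborel (\<lambda>s. indicator {s<..} x * (1 - indicator {s<..} c) :: real)"
    and "max 0 (x - c) = (LBINT s. indicator {s<..} x * (1 - indicator {s<..} c))"
proof -
  have eq: "(\<lambda>s. indicator {s<..} x * (1 - indicator {s<..} c) :: real) = indicator {c..<x}"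
    by (auto simp: fun_eq_iff split: split_indicator)
  have "integrable lborel (indicator {c..<x} :: real \<Rightarrow> real)"
    by (cases "c \<le> x") auto
  then show "integrable lborel (\<lambda>s. indicator {s<..} x * (1 - indicator {s<..} c) :: real)"
    unfolding eq .
  show "max 0 (x - c) = (LBINT s. indicator {s<..} x * (1 - indicator {s<..} c))"
    unfolding eq by (cases "c \<le> x") auto
qed

lemma square_sum_three_le: "(a + b + c)\<^sup>2 \<le> 3 * (a\<^sup>2 + b\<^sup>2 + c\<^sup>2)" for a b c :: real
  using zero_le_power2[of "a - b"] zero_le_power2[of "b - c"] zero_le_power2[of "a - c"]
  by (simp add: power2_eq_square algebra_simps)

context real_distribution
begin

definition tail_prob :: "(real \<Rightarrow> real) \<Rightarrow> real \<Rightarrow> real" where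
  "tail_prob p s = expectation (\<lambda>x. indicator {s<..} (p x))"

lemma tail_prob_measurable [measurable]:
  assumes [measurable]: "p \<in> borel_measurable borel"
  shows "tail_prob p \<in> borel_measurable borel"
  unfolding tail_prob_def greaterThan_def indicator_def by measurable

lemma integrable_indicator_tail:
  fixes p :: "real \<Rightarrow> real"
  assumes [measurable]: "p \<in> borel_measurable borel"
  shows "integrable M (\<lambda>x. indicator {s<..} (p x) :: real)"
proof (rule integrable_const_bound[of _ 1])
  show "random_variable borel (\<lambda>x. indicator {s<..} (p x) :: real)"
    by measurable
qed auto

lemma tail_prob_bounds: "p \<in> borel_measurable borel \<Longrightarrow> 0 \<le> tail_prob p s \<and> tail_prob p s \<le> 1"
  unfolding tail_prob_def
  by (auto intro!: integral_le_const simp: indicator_le_1 integrable_indicator_tail)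

lemma integral_swap_lborel:
  fixes f :: "real \<Rightarrow> real \<Rightarrow> real"
  assumes [measurable]: "case_prod f \<in> borel_measurable (borel \<Otimes>\<^sub>M borel)"
    and nonneg: "\<And>y s. 0 \<le> f y s"
    and inner: "\<And>y. integrable lborel (f y)"
    and outer: "integrable M (\<lambda>y. LBINT s. f y s)"
  shows "integrable lborel (\<lambda>s. expectation (\<lambda>y. f y s))"
    and "(LBINT s. expectation (\<lambda>y. f y s)) = expectation (\<lambda>y. LBINT s. f y s)"
proof -
  interpret P: pair_sigma_finite M lborel ..
  have "integrable (M \<Otimes>\<^sub>M lborel) (case_prod f)"
    by (rule P.Fubini_integrable) (use inner outer nonneg in auto)
  then show "integrable lborel (\<lambda>s. expectation (\<lambda>y. f y s))"
    and "(LBINT s. expectation (\<lambda>y. f y s)) = expectation (\<lambda>y. LBINT s. f y s)"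
    by (auto intro: P.integrable_snd P.Fubini_integral)
qed

context
  fixes p q :: "real \<Rightarrow> real"
  assumes p_meas [measurable]: "p \<in> borel_measurable borel" and q_meas [measurable]: "q \<in> borel_measurable borel"
    and p_int: "integrable M p" and q_int: "integrable M q"
begin

lemma integrable_excess_fst: "integrable M (\<lambda>x. max 0 (p x - c))"
  using p_int by (intro integrable_max) auto

lemma integrable_excess_snd: "integrable M (\<lambda>y. max 0 (c - q y))"
  using q_int by (intro integrable_max) auto

lemma expectation_excess_fst:
  "integrable lborel (\<lambda>s. tail_prob p s * (1 - indicator {s<..} c))"
  "expectation (\<lambda>x. max 0 (p x - c)) = (LBINT s. tail_prob p s * (1 - indicator {s<..} c))"
proof -
  have m: "(\<lambda>(x, s). indicator {s<..} (p x) * (1 - indicator {s<..} c) :: real) \<in> borel_measurable (borel \<Otimes>\<^sub>M borel)"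
    unfolding greaterThan_def indicator_def by measurable
  note * = integral_swap_lborel[of "\<lambda>x s. indicator {s<..} (p x) * (1 - indicator {s<..} c)", OF m,
      unfolded max_0_diff_eq_integral(2)[symmetric]]
  show "integrable lborel (\<lambda>s. tail_prob p s * (1 - indicator {s<..} c))"
    using *(1) max_0_diff_eq_integral(1) integrable_excess_fst by (simp add: tail_prob_def)
  show "expectation (\<lambda>x. max 0 (p x - c)) = (LBINT s. tail_prob p s * (1 - indicator {s<..} c))"
    using *(2) max_0_diff_eq_integral(1) integrable_excess_fst by (simp add: tail_prob_def)
qed

lemma expectation_excess_snd:
  "integrable lborel (\<lambda>s. indicator {s<..} c * (1 - tail_prob q s))"
  "expectation (\<lambda>y. max 0 (c - q y)) = (LBINT s. indicator {s<..} c * (1 - tail_prob q s))"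
proof -
  have m: "(\<lambda>(y, s). indicator {s<..} c * (1 - indicator {s<..} (q y)) :: real) \<in> borel_measurable (borel \<Otimes>\<^sub>M borel)"
    unfolding greaterThan_def indicator_def by measurable
  note * = integral_swap_lborel[of "\<lambda>y s. indicator {s<..} c * (1 - indicator {s<..} (q y))", OF m,
      unfolded max_0_diff_eq_integral(2)[symmetric]]
  have t: "expectation (\<lambda>y. 1 - indicator {s<..} (q y)) = 1 - tail_prob q s" for s
    using prob_space by (simp add: tail_prob_def integrable_indicator_tail)
  show "integrable lborel (\<lambda>s. indicator {s<..} c * (1 - tail_prob q s))"
    using *(1) max_0_diff_eq_integral(1) integrable_excess_snd by (simp add: t)
  show "expectation (\<lambda>y. max 0 (c - q y)) = (LBINT s. indicator {s<..} c * (1 - tail_prob q s))"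
    using *(2) max_0_diff_eq_integral(1) integrable_excess_snd by (simp add: t)
qed

lemma expectation_excess_fst_bound:
  "\<bar>expectation (\<lambda>x. max 0 (p x - c))\<bar> \<le> \<bar>c\<bar> + expectation (\<lambda>x. \<bar>p x\<bar>)"
proof -
  have "\<bar>expectation (\<lambda>x. max 0 (p x - c))\<bar> \<le> expectation (\<lambda>x. \<bar>max 0 (p x - c)\<bar>)"
    by (rule integral_abs_bound)
  also have "\<dots> \<le> expectation (\<lambda>x. \<bar>c\<bar> + \<bar>p x\<bar>)"
    using integrable_excess_fst p_int by (intro integral_mono) auto
  also have "\<dots> = \<bar>c\<bar> + expectation (\<lambda>x. \<bar>p x\<bar>)"
    using p_int prob_space by simp
  finally show ?thesis .
qed

lemma expectation_excess_snd_bound: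
  "\<bar>expectation (\<lambda>y. max 0 (c - q y))\<bar> \<le> \<bar>c\<bar> + expectation (\<lambda>y. \<bar>q y\<bar>)"
proof -
  have "\<bar>expectation (\<lambda>y. max 0 (c - q y))\<bar> \<le> expectation (\<lambda>y. \<bar>max 0 (c - q y)\<bar>)"
    by (rule integral_abs_bound)
  also have "\<dots> \<le> expectation (\<lambda>y. \<bar>c\<bar> + \<bar>q y\<bar>)"
    using integrable_excess_snd q_int by (intro integral_mono) auto
  also have "\<dots> = \<bar>c\<bar> + expectation (\<lambda>y. \<bar>q y\<bar>)"
    using q_int prob_space by simp
  finally show ?thesis .
qed

lemma integrable_expectation_excess:
  "integrable M (\<lambda>y. expectation (\<lambda>x. max 0 (p x - q y)))"
  "integrable M (\<lambda>x. expectation (\<lambda>y. max 0 (p x - q y)))"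
proof -
  show "integrable M (\<lambda>y. expectation (\<lambda>x. max 0 (p x - q y)))"
  proof (rule Bochner_Integration.integrable_bound)
    show "integrable M (\<lambda>y. \<bar>q y\<bar> + expectation (\<lambda>x. \<bar>p x\<bar>))" using q_int by auto
    show "AE y in M. norm (expectation (\<lambda>x. max 0 (p x - q y))) \<le> norm (\<bar>q y\<bar> + expectation (\<lambda>x. \<bar>p x\<bar>))"
      using expectation_excess_fst_bound by (auto intro: order_trans)
  qed measurable
  show "integrable M (\<lambda>x. expectation (\<lambda>y. max 0 (p x - q y)))"
  proof (rule Bochner_Integration.integrable_bound)
    show "integrable M (\<lambda>x. \<bar>p x\<bar> + expectation (\<lambda>x. \<bar>q x\<bar>))" using p_int by auto
    show "AE x in M. norm (expectation (\<lambda>y. max 0 (p x - q y))) \<le> norm (\<bar>p x\<bar> + expectation (\<lambda>x. \<bar>q x\<bar>))"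
      using expectation_excess_snd_bound by (auto intro: order_trans)
  qed measurable
qed

lemma expectation_excess:
  "integrable lborel (\<lambda>s. tail_prob p s * (1 - tail_prob q s))"
  "expectation (\<lambda>y. expectation (\<lambda>x. max 0 (p x - q y))) = (LBINT s. tail_prob p s * (1 - tail_prob q s))"
  "expectation (\<lambda>x. expectation (\<lambda>y. max 0 (p x - q y))) = (LBINT s. tail_prob p s * (1 - tail_prob q s))"
proof -
  have t: "expectation (\<lambda>y. 1 - indicator {s<..} (q y)) = 1 - tail_prob q s" for s
    using prob_space by (simp add: tail_prob_def integrable_indicator_tail)
  have m: "(\<lambda>(y, s). tail_prob p s * (1 - indicator {s<..} (q y)) :: real) \<in> borel_measurable (borel \<Otimes>\<^sub>M borel)"
    unfolding greaterThan_def indicator_def by measurable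
  note * = integral_swap_lborel[of "\<lambda>y s. tail_prob p s * (1 - indicator {s<..} (q y))", OF m,
      unfolded expectation_excess_fst(2)[symmetric]]
  show "integrable lborel (\<lambda>s. tail_prob p s * (1 - tail_prob q s))"
    using *(1) expectation_excess_fst(1) integrable_expectation_excess(1) tail_prob_bounds[of p]
    by (simp add: t indicator_le_1)
  show "expectation (\<lambda>y. expectation (\<lambda>x. max 0 (p x - q y))) = (LBINT s. tail_prob p s * (1 - tail_prob q s))"
    using *(2) expectation_excess_fst(1) integrable_expectation_excess(1) tail_prob_bounds[of p]
    by (simp add: t indicator_le_1)
  have m: "(\<lambda>(x, s). indicator {s<..} (p x) * (1 - tail_prob q s) :: real) \<in> borel_measurable (borel \<Otimes>\<^sub>M borel)"
    unfolding greaterThan_def indicator_def by measurable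
  show "expectation (\<lambda>x. expectation (\<lambda>y. max 0 (p x - q y))) = (LBINT s. tail_prob p s * (1 - tail_prob q s))"
    using integral_swap_lborel(2)[of "\<lambda>x s. indicator {s<..} (p x) * (1 - tail_prob q s)", OF m,
      unfolded expectation_excess_snd(2)[symmetric]]
      expectation_excess_snd(1) integrable_expectation_excess(2) tail_prob_bounds[of q]
    by (simp add: tail_prob_def[of p])
qed

end

definition mean_excess :: "(real \<Rightarrow> real) \<Rightarrow> (real \<Rightarrow> real) \<Rightarrow> real" where
  "mean_excess p q = expectation (\<lambda>y. expectation (\<lambda>x. max 0 (p x - q y)))"

text \<open>The sum of the two conditional expectations of the excess, given that its first or its second
  argument is \<open>x\<close>: the Hajek projection of the average over pairs.\<close>

definition excess_proj :: "(real \<Rightarrow> real) \<Rightarrow> (real \<Rightarrow> real) \<Rightarrow> real \<Rightarrow> real" where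
  "excess_proj p q x = expectation (\<lambda>y. max 0 (p x - q y)) + expectation (\<lambda>y. max 0 (p y - q x))"

lemma excess_proj_measurable [measurable]:
  assumes [measurable]: "p \<in> borel_measurable borel" "q \<in> borel_measurable borel"
  shows "excess_proj p q \<in> borel_measurable borel"
  unfolding excess_proj_def by measurable

lemma expectation_excess_proj:
  assumes "p \<in> borel_measurable borel" "q \<in> borel_measurable borel" "integrable M p" "integrable M q"
  shows "expectation (excess_proj p q) = 2 * mean_excess p q"
  unfolding excess_proj_def mean_excess_def
  using integrable_expectation_excess[OF assms] expectation_excess(2,3)[OF assms] by simp

lemma excess_proj_square_integrable:
  assumes [measurable]: "p \<in> borel_measurable borel" "q \<in> borel_measurable borel"
    and sq: "integrable M (\<lambda>x. (p x)\<^sup>2)" "integrable M (\<lambda>x. (q x)\<^sup>2)"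
  shows "integrable M (\<lambda>x. (excess_proj p q x)\<^sup>2)"
proof -
  have int: "integrable M p" "integrable M q"
    using sq by (auto intro!: square_integrable_imp_integrable)
  define C where "C = expectation (\<lambda>x. \<bar>p x\<bar>) + expectation (\<lambda>x. \<bar>q x\<bar>)"
  show ?thesis
  proof (rule Bochner_Integration.integrable_bound)
    show "integrable M (\<lambda>x. 3 * ((p x)\<^sup>2 + (q x)\<^sup>2 + C\<^sup>2))" using sq by auto
    show "AE x in M. norm ((excess_proj p q x)\<^sup>2) \<le> norm (3 * ((p x)\<^sup>2 + (q x)\<^sup>2 + C\<^sup>2))"
    proof (rule AE_I2)
      fix x
      have "\<bar>excess_proj p q x\<bar> \<le> \<bar>\<bar>p x\<bar> + \<bar>q x\<bar> + C\<bar>"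
        using expectation_excess_snd_bound[OF assms(1,2) int, of "p x"]
          expectation_excess_fst_bound[OF assms(1,2) int, of "q x"]
        unfolding excess_proj_def C_def by linarith
      then have "(excess_proj p q x)\<^sup>2 \<le> (\<bar>p x\<bar> + \<bar>q x\<bar> + C)\<^sup>2"
        by (simp only: abs_le_square_iff)
      also have "\<dots> \<le> 3 * (\<bar>p x\<bar>\<^sup>2 + \<bar>q x\<bar>\<^sup>2 + C\<^sup>2)"
        by (rule square_sum_three_le)
      finally show "norm ((excess_proj p q x)\<^sup>2) \<le> norm (3 * ((p x)\<^sup>2 + (q x)\<^sup>2 + C\<^sup>2))"
        by simp
    qed
  qed measurable
qed

lemma
  assumes [measurable]: "p \<in> borel_measurable borel" "q \<in> borel_measurable borel"
    and int: "integrable M p" and sq: "integrable M (\<lambda>x. (p x)\<^sup>2)" "integrable M (\<lambda>x. (q x)\<^sup>2)"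
  shows affine_excess_proj_square_integrable: "integrable M (\<lambda>x. (a * p x + excess_proj p q x)\<^sup>2)"
    and expectation_affine_excess_proj:
      "expectation (\<lambda>x. a * p x + excess_proj p q x) = a * expectation p + 2 * mean_excess p q"
proof -
  note proj_sq = excess_proj_square_integrable[OF assms(1,2) sq]
  have proj_int: "integrable M (excess_proj p q)"
    by (rule square_integrable_imp_integrable[OF _ proj_sq]) measurable
  have q_int: "integrable M q"
    by (rule square_integrable_imp_integrable[OF _ sq(2)]) measurable
  show "integrable M (\<lambda>x. (a * p x + excess_proj p q x)\<^sup>2)"
  proof (rule Bochner_Integration.integrable_bound)
    have "integrable M (\<lambda>x. (a * p x)\<^sup>2)"
      unfolding power_mult_distrib by (intro integrable_mult_right sq)
    then show "integrable M (\<lambda>x. 3 * ((a * p x)\<^sup>2 + (excess_proj p q x)\<^sup>2 + 0\<^sup>2))"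
      by (intro integrable_mult_right Bochner_Integration.integrable_add proj_sq integrable_const)
    show "AE x in M. norm ((a * p x + excess_proj p q x)\<^sup>2)
        \<le> norm (3 * ((a * p x)\<^sup>2 + (excess_proj p q x)\<^sup>2 + 0\<^sup>2))"
    proof (rule AE_I2)
      fix x
      show "norm ((a * p x + excess_proj p q x)\<^sup>2) \<le> norm (3 * ((a * p x)\<^sup>2 + (excess_proj p q x)\<^sup>2 + 0\<^sup>2))"
        using square_sum_three_le[of "a * p x" "excess_proj p q x" 0] by simp
    qed
  qed measurable
  have "expectation (\<lambda>x. a * p x + excess_proj p q x) = expectation (\<lambda>x. a * p x) + expectation (excess_proj p q)"
    by (rule Bochner_Integration.integral_add[OF integrable_mult_right[OF int] proj_int])
  also have "expectation (excess_proj p q) = 2 * mean_excess p q"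
    by (rule expectation_excess_proj[OF assms(1,2) int q_int])
  finally show "expectation (\<lambda>x. a * p x + excess_proj p q x) = a * expectation p + 2 * mean_excess p q"
    by simp
qed

lemma tail_prob_id: "tail_prob (\<lambda>x. x) s = 1 - cdf M s"
proof -
  have "tail_prob (\<lambda>x. x) s = prob {s<..}"
    by (simp add: tail_prob_def)
  also have "{s<..} = space M - {..s}" by auto
  also have "prob \<dots> = 1 - cdf M s"
    unfolding cdf_def by (rule prob_compl) simp
  finally show ?thesis .
qed

text \<open>The difference quotients of \<open>max 0 (x - \<rho> * y)\<close> in \<open>\<rho>\<close> are bounded by \<open>\<bar>y\<bar>\<close> and converge unless
  \<open>x = r * y\<close>, which has probability \<open>0\<close> for every \<open>y\<close> when there are no atoms. Dominated convergence,
  first in \<open>x\<close> and then in \<open>y\<close>, gives the derivative.\<close>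

lemma mean_excess_has_derivative:
  assumes int: "integrable M (\<lambda>x. x)" and no_atoms: "\<And>x. prob {x} = 0"
  shows "((\<lambda>\<rho>. mean_excess (\<lambda>x. x) (\<lambda>y. \<rho> * y)) has_real_derivative
      - expectation (\<lambda>y. y * tail_prob (\<lambda>x. x) (r * y))) (at r)"
proof -
  let ?k = "\<lambda>\<rho> x y. max 0 (x - \<rho> * y) :: real"
  have int_x: "integrable M (\<lambda>x. ?k \<rho> x y)" for \<rho> y
    by (intro integrable_max integrable_zero Bochner_Integration.integrable_diff int integrable_const)
  have int_y: "integrable M (\<lambda>y. expectation (\<lambda>x. ?k \<rho> x y))" for \<rho>
    by (rule integrable_expectation_excess(1)[of "\<lambda>x. x" "\<lambda>y. \<rho> * y"])
      (simp_all add: int integrable_mult_right)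
  have "(\<lambda>h. (mean_excess (\<lambda>x. x) (\<lambda>y. (r + h) * y) - mean_excess (\<lambda>x. x) (\<lambda>y. r * y)) / h)
      \<midarrow>0\<rightarrow> expectation (\<lambda>y. - y * tail_prob (\<lambda>x. x) (r * y))"
    unfolding tendsto_at_iff_sequentially comp_def
  proof (intro allI impI)
    fix h :: "nat \<Rightarrow> real" assume h: "\<forall>i. h i \<in> UNIV - {0}" "h \<longlonglongrightarrow> 0"
    then have nz: "h i \<noteq> 0" for i by auto
    let ?d = "\<lambda>i x y. (?k (r + h i) x y - ?k r x y) / h i"
    have bound: "\<bar>?d i x y\<bar> \<le> \<bar>y\<bar>" for i x y
    proof -
      have "\<bar>max 0 (a - b) - max 0 a\<bar> \<le> \<bar>b\<bar>" for a b :: real by linarith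
      from this[of "x - r * y" "h i * y"] have "\<bar>?k (r + h i) x y - ?k r x y\<bar> \<le> \<bar>h i * y\<bar>"
        by (simp only: distrib_right diff_diff_eq)
      then show ?thesis using nz[of i] by (simp add: abs_mult divide_le_eq mult.commute)
    qed
    have lim: "(\<lambda>i. ?d i x y) \<longlonglongrightarrow> - y * indicator {r * y<..} x" if ne: "x \<noteq> r * y" for x y
    proof -
      have s: "(\<lambda>i. x - (r + h i) * y) \<longlonglongrightarrow> x - r * y"
        using tendsto_diff[OF tendsto_const tendsto_mult_right[OF tendsto_add[OF tendsto_const h(2)]], of x r y]
        by (simp only: add_0_right)
      consider "x - r * y > 0" | "x - r * y < 0" using ne by linarith
      then show ?thesis
      proof cases
        case 1
        then have "\<forall>\<^sub>F i in sequentially. x - (r + h i) * y > 0"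
          by (rule order_tendstoD(1)[OF s])
        then have "\<forall>\<^sub>F i in sequentially. ?d i x y = - y"
        proof eventually_elim
          case (elim i)
          then have "?k (r + h i) x y = x - (r + h i) * y" "?k r x y = x - r * y"
            using 1 by (auto simp: max_def)
          then have "?k (r + h i) x y - ?k r x y = - y * h i" by (simp only: distrib_right) simp
          moreover have "- y * h i / h i = - y" using nz[of i] by simp
          ultimately show ?case by (simp only:)
        qed
        then have "(\<lambda>i. ?d i x y) \<longlonglongrightarrow> - y" by (rule tendsto_eventually)
        moreover have "indicator {r * y<..} x = (1 :: real)" using 1 by simp
        ultimately show ?thesis by (simp only: mult_1_right)
      next
        case 2
        then have "\<forall>\<^sub>F i in sequentially. x - (r + h i) * y < 0"
          by (rule order_tendstoD(2)[OF s])
        then have "\<forall>\<^sub>F i in sequentially. ?d i x y = 0"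
        proof eventually_elim
          case (elim i)
          then have "?k (r + h i) x y = 0" "?k r x y = 0" using 2 by (auto simp: max_def)
          then show ?case by (simp only: diff_self div_0)
        qed
        then have "(\<lambda>i. ?d i x y) \<longlonglongrightarrow> 0" by (rule tendsto_eventually)
        moreover have "indicator {r * y<..} x = (0 :: real)" using 2 by simp
        ultimately show ?thesis by (simp only: mult_zero_right)
      qed
    qed
    have inner: "(\<lambda>i. expectation (\<lambda>x. ?d i x y)) \<longlonglongrightarrow> - y * tail_prob (\<lambda>x. x) (r * y)" for y
    proof -
      have ae: "AE x in M. x \<noteq> r * y"
        using no_atoms[of "r * y"] by (intro AE_I[of _ _ "{r * y}"]) (auto simp: emeasure_eq_measure)
      have "(\<lambda>i. expectation (\<lambda>x. ?d i x y)) \<longlonglongrightarrow> expectation (\<lambda>x. - y * indicator {r * y<..} x)"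
      proof (rule integral_dominated_convergence[where w = "\<lambda>_. \<bar>y\<bar>"])
        show "AE x in M. (\<lambda>i. ?d i x y) \<longlonglongrightarrow> - y * indicator {r * y<..} x"
          using ae by eventually_elim (rule lim)
        show "AE x in M. norm (?d i x y) \<le> \<bar>y\<bar>" for i
          by (rule AE_I2) (simp only: real_norm_def bound)
        show "(\<lambda>x. ?d i x y) \<in> borel_measurable M" for i by measurable
        show "(\<lambda>x. - y * indicator {r * y<..} x) \<in> borel_measurable M" by measurable
        show "integrable M (\<lambda>_. \<bar>y\<bar>)" by (rule integrable_const)
      qed
      then show ?thesis by (simp only: tail_prob_def integral_mult_right_zero)
    qed
    have "(\<lambda>i. expectation (\<lambda>y. expectation (\<lambda>x. ?d i x y))) \<longlonglongrightarrow> expectation (\<lambda>y. - y * tail_prob (\<lambda>x. x) (r * y))"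
    proof (rule integral_dominated_convergence[where w = "\<lambda>y. \<bar>y\<bar>"])
      fix i
      show "AE y in M. norm (expectation (\<lambda>x. ?d i x y)) \<le> \<bar>y\<bar>"
      proof (rule AE_I2)
        fix y
        have "norm (expectation (\<lambda>x. ?d i x y)) \<le> expectation (\<lambda>x. norm (?d i x y))"
          by (rule integral_norm_bound)
        also have "\<dots> \<le> expectation (\<lambda>x. \<bar>y\<bar>)"
        proof (rule integral_mono)
          show "integrable M (\<lambda>x. norm (?d i x y))"
            by (intro integrable_norm integrable_divide_zero Bochner_Integration.integrable_diff int_x)
          show "norm (?d i x y) \<le> \<bar>y\<bar>" for x by (simp only: real_norm_def bound)
        qed (rule integrable_const)
        also have "\<dots> = \<bar>y\<bar>" using prob_space by simp
        finally show "norm (expectation (\<lambda>x. ?d i x y)) \<le> \<bar>y\<bar>" .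
      qed
    next
      show "AE y in M. (\<lambda>i. expectation (\<lambda>x. ?d i x y)) \<longlonglongrightarrow> - y * tail_prob (\<lambda>x. x) (r * y)"
        by (rule AE_I2) (rule inner)
      show "integrable M (\<lambda>y. \<bar>y\<bar>)" using int by (rule integrable_abs)
      show "(\<lambda>y. expectation (\<lambda>x. ?d i x y)) \<in> borel_measurable M" for i by measurable
      show "(\<lambda>y. - y * tail_prob (\<lambda>x. x) (r * y)) \<in> borel_measurable M" by measurable
    qed
    moreover have "expectation (\<lambda>y. expectation (\<lambda>x. ?d i x y)) =
        (mean_excess (\<lambda>x. x) (\<lambda>y. (r + h i) * y) - mean_excess (\<lambda>x. x) (\<lambda>y. r * y)) / h i" for i
      unfolding mean_excess_def
      by (simp only: integral_divide_zero Bochner_Integration.integral_diff int_x int_y)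
    ultimately show "(\<lambda>i. (mean_excess (\<lambda>x. x) (\<lambda>y. (r + h i) * y) - mean_excess (\<lambda>x. x) (\<lambda>y. r * y)) / h i)
        \<longlonglongrightarrow> expectation (\<lambda>y. - y * tail_prob (\<lambda>x. x) (r * y))" by (simp only:)
  qed
  then show ?thesis unfolding DERIV_def by simp
qed

end

section \<open>The average excess over all pairs of a sample\<close>

context iid_sample
begin

definition excess_avg :: "(real \<Rightarrow> real) \<Rightarrow> (real \<Rightarrow> real) \<Rightarrow> nat \<Rightarrow> 'a \<Rightarrow> real" where
  "excess_avg p q m \<omega> = (\<Sum>k<m. \<Sum>j<m. max 0 (p (X k \<omega>) - q (X j \<omega>))) / (real m)\<^sup>2"

text \<open>Both conditional expectations in the projection have the mean \<open>mean_excess p q\<close>, which is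
  therefore subtracted twice and has to be added once.\<close>

definition excess_residual :: "(real \<Rightarrow> real) \<Rightarrow> (real \<Rightarrow> real) \<Rightarrow> nat \<Rightarrow> 'a \<Rightarrow> real" where
  "excess_residual p q m \<omega> =
     excess_avg p q m \<omega> - (\<Sum>k<m. N.excess_proj p q (X k \<omega>)) / real m + N.mean_excess p q"

definition tail_error :: "(real \<Rightarrow> real) \<Rightarrow> nat \<Rightarrow> 'a \<Rightarrow> real \<Rightarrow> real" where
  "tail_error p m \<omega> s = (\<Sum>k<m. indicator {s<..} (p (X k \<omega>))) / real m - N.tail_prob p s"

lemma excess_avg_measurable [measurable]:
  assumes [measurable]: "p \<in> borel_measurable borel" "q \<in> borel_measurable borel"
  shows "random_variable borel (excess_avg p q m)"
  unfolding excess_avg_def by measurable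

lemma excess_residual_measurable [measurable]:
  assumes [measurable]: "p \<in> borel_measurable borel" "q \<in> borel_measurable borel"
  shows "random_variable borel (excess_residual p q m)"
  unfolding excess_residual_def by measurable

lemma tail_error_measurable [measurable]:
  assumes [measurable]: "p \<in> borel_measurable borel"
  shows "(\<lambda>(\<omega>, s). tail_error p m \<omega> s) \<in> borel_measurable (M \<Otimes>\<^sub>M borel)"
  unfolding tail_error_def greaterThan_def indicator_def by measurable

text \<open>In the product form of the excess, subtracting the two conditional expectations and adding the mean
  makes the integrand factorise; this holds for the pairs with \<open>k = j\<close> as well.\<close>

lemma excess_residual_eq_integral:
  assumes [measurable]: "p \<in> borel_measurable borel" "q \<in> borel_measurable borel"
    and int: "integrable N p" "integrable N q" and "m > 0"
  shows "integrable lborel (\<lambda>s. tail_error p m \<omega> s * tail_error q m \<omega> s)"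
    and "excess_residual p q m \<omega> = - (LBINT s. tail_error p m \<omega> s * tail_error q m \<omega> s)"
proof -
  let ?ip = "\<lambda>k s. indicator {s<..} (p (X k \<omega>)) :: real" and ?iq = "\<lambda>j s. indicator {s<..} (q (X j \<omega>)) :: real"
  let ?A = "\<lambda>s. (\<Sum>k<m. ?ip k s) / real m" and ?B = "\<lambda>s. 1 - (\<Sum>j<m. ?iq j s) / real m"
  have B: "?B s = (\<Sum>j<m. 1 - ?iq j s) / real m" for s
    using \<open>m > 0\<close> by (simp add: sum_subtractf diff_divide_distrib)
  have AB: "?A s * ?B s = (\<Sum>k<m. \<Sum>j<m. ?ip k s * (1 - ?iq j s)) / (real m)\<^sup>2" for s
    unfolding B by (simp add: sum_product power2_eq_square)
  have At: "?A s * (1 - N.tail_prob q s) = (\<Sum>k<m. ?ip k s * (1 - N.tail_prob q s)) / real m" for s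
    by (simp add: sum_distrib_right)
  have tB: "N.tail_prob p s * ?B s = (\<Sum>j<m. N.tail_prob p s * (1 - ?iq j s)) / real m" for s
    unfolding B by (simp add: sum_distrib_left)
  have avg: "excess_avg p q m \<omega> = (LBINT s. ?A s * ?B s)" "integrable lborel (\<lambda>s. ?A s * ?B s)"
    unfolding AB excess_avg_def
    by (simp_all only: max_0_diff_eq_integral(1) max_0_diff_eq_integral(2) integral_divide_zero
        Bochner_Integration.integral_sum Bochner_Integration.integrable_sum integrable_divide_zero)
  have snd: "(\<Sum>k<m. N.expectation (\<lambda>y. max 0 (p (X k \<omega>) - q y))) / real m
      = (LBINT s. ?A s * (1 - N.tail_prob q s))" "integrable lborel (\<lambda>s. ?A s * (1 - N.tail_prob q s))"
    unfolding At
    by (simp_all only: N.expectation_excess_snd[OF assms(1,2) int] integral_divide_zero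
        Bochner_Integration.integral_sum Bochner_Integration.integrable_sum integrable_divide_zero)
  have fst: "(\<Sum>k<m. N.expectation (\<lambda>y. max 0 (p y - q (X k \<omega>)))) / real m
      = (LBINT s. N.tail_prob p s * ?B s)" "integrable lborel (\<lambda>s. N.tail_prob p s * ?B s)"
    unfolding tB
    by (simp_all only: N.expectation_excess_fst[OF assms(1,2) int] integral_divide_zero
        Bochner_Integration.integral_sum Bochner_Integration.integrable_sum integrable_divide_zero)
  note mean = N.expectation_excess(1,2)[OF assms(1,2) int]
  have eq: "tail_error p m \<omega> s * tail_error q m \<omega> s
      = - (?A s * ?B s - ?A s * (1 - N.tail_prob q s) - N.tail_prob p s * ?B s
        + N.tail_prob p s * (1 - N.tail_prob q s))" for s
  proof -
    have "(a - t) * (1 - b - u) = - (a * b - a * (1 - u) - t * b + t * (1 - u))" for a b t u :: real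
      by (simp add: algebra_simps)
    from this[of "?A s" "N.tail_prob p s" "?B s" "N.tail_prob q s"] show ?thesis
      unfolding tail_error_def by (simp only: diff_diff_eq2 add_diff_cancel_left')
  qed
  show "integrable lborel (\<lambda>s. tail_error p m \<omega> s * tail_error q m \<omega> s)"
    unfolding eq using avg(2) snd(2) fst(2) mean(1)
    by (intro integrable_minus Bochner_Integration.integrable_add Bochner_Integration.integrable_diff)
  have "- (LBINT s. tail_error p m \<omega> s * tail_error q m \<omega> s)
      = (LBINT s. ?A s * ?B s) - (LBINT s. ?A s * (1 - N.tail_prob q s)) - (LBINT s. N.tail_prob p s * ?B s)
        + (LBINT s. N.tail_prob p s * (1 - N.tail_prob q s))"
    unfolding eq using avg(2) snd(2) fst(2) mean(1)
    by (simp only: integral_minus Bochner_Integration.integral_add Bochner_Integration.integral_diff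
        Bochner_Integration.integrable_diff minus_minus)
  also have "\<dots> = excess_residual p q m \<omega>"
    unfolding excess_residual_def N.excess_proj_def N.mean_excess_def avg(1) sum.distrib add_divide_distrib
      snd(1) fst(1) mean(2) by simp
  finally show "excess_residual p q m \<omega> = - (LBINT s. tail_error p m \<omega> s * tail_error q m \<omega> s)" ..
qed

lemma tail_error_second_moment:
  assumes [measurable]: "p \<in> borel_measurable borel" and "m > 0"
  shows "integrable M (\<lambda>\<omega>. (tail_error p m \<omega> s)\<^sup>2)"
    and "expectation (\<lambda>\<omega>. (tail_error p m \<omega> s)\<^sup>2) = N.tail_prob p s * (1 - N.tail_prob p s) / real m"
proof -
  let ?g = "\<lambda>x. indicator {s<..} (p x) :: real"
  have sq: "(\<lambda>x. (?g x)\<^sup>2) = ?g" by (auto split: split_indicator)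
  have int: "integrable N (\<lambda>x. (?g x)\<^sup>2)" unfolding sq by (rule N.integrable_indicator_tail) measurable
  have g: "?g \<in> borel_measurable borel" by measurable
  have var: "N.variance ?g = N.tail_prob p s * (1 - N.tail_prob p s)"
    using int by (subst N.variance_eq) (simp_all only: sq N.tail_prob_def, simp add: power2_eq_square algebra_simps)
  have eq: "(tail_error p m \<omega> s)\<^sup>2 = (\<Sum>k<m. ?g (X k \<omega>) - N.expectation ?g)\<^sup>2 / (real m)\<^sup>2" for \<omega>
    using \<open>m > 0\<close> unfolding tail_error_def N.tail_prob_def
    by (simp add: sum_subtractf power_divide[symmetric] diff_divide_distrib)
  show "integrable M (\<lambda>\<omega>. (tail_error p m \<omega> s)\<^sup>2)"
    unfolding eq by (intro integrable_divide_zero) (rule integrable_centred_sum_square[OF g int])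
  show "expectation (\<lambda>\<omega>. (tail_error p m \<omega> s)\<^sup>2) = N.tail_prob p s * (1 - N.tail_prob p s) / real m"
    unfolding eq integral_divide_zero expectation_centred_sum_square[OF g int] var
    using \<open>m > 0\<close> by (simp add: power2_eq_square)
qed

text \<open>The product of the two tail errors is at most half the sum of their squares, whose expectations are
  variances of a sample mean of indicators. The factor \<open>tail_prob * (1 - tail_prob)\<close> in these
  variances is integrable over the real line because \<open>p\<close> and \<open>q\<close> have a first moment.\<close>

lemma
  assumes [measurable]: "p \<in> borel_measurable borel" "q \<in> borel_measurable borel"
    and int: "integrable N p" "integrable N q" and "m > 0"
  defines "C \<equiv> ((LBINT s. N.tail_prob p s * (1 - N.tail_prob p s)) + (LBINT s. N.tail_prob q s * (1 - N.tail_prob q s))) / 2"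
  shows integrable_excess_residual: "integrable M (excess_residual p q m)"
    and expectation_excess_residual: "expectation (\<lambda>\<omega>. \<bar>excess_residual p q m \<omega>\<bar>) \<le> C / real m"
proof -
  interpret P: pair_sigma_finite M lborel ..
  let ?v = "\<lambda>p s. N.tail_prob p s * (1 - N.tail_prob p s)"
  have v: "integrable lborel (?v p)" "integrable lborel (?v q)"
    by (rule N.expectation_excess(1)[OF assms(1,1) int(1,1)])
       (rule N.expectation_excess(1)[OF assms(2,2) int(2,2)])
  have v0: "0 \<le> ?v p s" "0 \<le> ?v q s" for s
    using N.tail_prob_bounds[of p s] N.tail_prob_bounds[of q s] by auto
  have "(\<integral>\<^sup>+\<omega>. ennreal \<bar>excess_residual p q m \<omega>\<bar> \<partial>M)
      \<le> (\<integral>\<^sup>+\<omega>. (\<integral>\<^sup>+s. ennreal (((tail_error p m \<omega> s)\<^sup>2 + (tail_error q m \<omega> s)\<^sup>2) / 2) \<partial>lborel) \<partial>M)"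
  proof (rule nn_integral_mono)
    fix \<omega>
    have "ennreal \<bar>excess_residual p q m \<omega>\<bar> = ennreal (norm (LBINT s. tail_error p m \<omega> s * tail_error q m \<omega> s))"
      unfolding excess_residual_eq_integral(2)[OF assms(1-5)] by simp
    also have "\<dots> \<le> (\<integral>\<^sup>+s. ennreal (norm (tail_error p m \<omega> s * tail_error q m \<omega> s)) \<partial>lborel)"
      by (rule integral_norm_bound_ennreal[OF excess_residual_eq_integral(1)[OF assms(1-5)]])
    also have "\<dots> \<le> (\<integral>\<^sup>+s. ennreal (((tail_error p m \<omega> s)\<^sup>2 + (tail_error q m \<omega> s)\<^sup>2) / 2) \<partial>lborel)"
    proof (rule nn_integral_mono, rule ennreal_leI)
      fix s
      have "\<bar>a * b\<bar> \<le> (a\<^sup>2 + b\<^sup>2) / 2" for a b :: real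
        using zero_le_power2[of "a - b"] zero_le_power2[of "a + b"]
        by (simp add: power2_diff power2_sum abs_le_iff)
      then show "norm (tail_error p m \<omega> s * tail_error q m \<omega> s) \<le> ((tail_error p m \<omega> s)\<^sup>2 + (tail_error q m \<omega> s)\<^sup>2) / 2"
        by simp
    qed
    finally show "ennreal \<bar>excess_residual p q m \<omega>\<bar>
        \<le> (\<integral>\<^sup>+s. ennreal (((tail_error p m \<omega> s)\<^sup>2 + (tail_error q m \<omega> s)\<^sup>2) / 2) \<partial>lborel)" .
  qed
  also have "\<dots> = (\<integral>\<^sup>+s. (\<integral>\<^sup>+\<omega>. ennreal (((tail_error p m \<omega> s)\<^sup>2 + (tail_error q m \<omega> s)\<^sup>2) / 2) \<partial>M) \<partial>lborel)"
    by (rule P.Fubini'[symmetric]) measurable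
  also have "\<dots> = (\<integral>\<^sup>+s. ennreal ((?v p s + ?v q s) / (2 * real m)) \<partial>lborel)"
  proof (rule nn_integral_cong)
    fix s
    note mom = tail_error_second_moment[OF assms(1) \<open>m > 0\<close>, of s]
      tail_error_second_moment[OF assms(2) \<open>m > 0\<close>, of s]
    have "(\<integral>\<^sup>+\<omega>. ennreal (((tail_error p m \<omega> s)\<^sup>2 + (tail_error q m \<omega> s)\<^sup>2) / 2) \<partial>M)
      = ennreal (expectation (\<lambda>\<omega>. ((tail_error p m \<omega> s)\<^sup>2 + (tail_error q m \<omega> s)\<^sup>2) / 2))"
      by (rule nn_integral_eq_integral) (use mom in auto)
    also have "expectation (\<lambda>\<omega>. ((tail_error p m \<omega> s)\<^sup>2 + (tail_error q m \<omega> s)\<^sup>2) / 2)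
      = (?v p s + ?v q s) / (2 * real m)"
      using mom by (simp add: add_divide_distrib mult.commute)
    finally show "(\<integral>\<^sup>+\<omega>. ennreal (((tail_error p m \<omega> s)\<^sup>2 + (tail_error q m \<omega> s)\<^sup>2) / 2) \<partial>M)
      = ennreal ((?v p s + ?v q s) / (2 * real m))" .
  qed
  also have "\<dots> = ennreal (LBINT s. (?v p s + ?v q s) / (2 * real m))"
    by (rule nn_integral_eq_integral) (use v v0 in auto)
  also have "(LBINT s. (?v p s + ?v q s) / (2 * real m)) = C / real m"
    using v by (simp add: C_def)
  finally have le: "(\<integral>\<^sup>+\<omega>. ennreal \<bar>excess_residual p q m \<omega>\<bar> \<partial>M) \<le> ennreal (C / real m)" .
  have "0 \<le> C"
    unfolding C_def using v0 by (auto intro!: add_nonneg_nonneg integral_nonneg_AE)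
  show "integrable M (excess_residual p q m)"
    by (rule integrableI_bounded) (use le in \<open>auto intro: le_less_trans\<close>)
  show "expectation (\<lambda>\<omega>. \<bar>excess_residual p q m \<omega>\<bar>) \<le> C / real m"
    by (rule integral_real_bounded) (use le \<open>0 \<le> C\<close> in auto)
qed

lemma excess_residual_vanishes:
  assumes [measurable]: "p \<in> borel_measurable borel" "q \<in> borel_measurable borel"
    and int: "integrable N p" "integrable N q"
    and m: "filterlim m at_top sequentially" and a: "(\<lambda>n. a n / real (m n)) \<longlonglongrightarrow> 0"
  shows "vanishes_in_prob (\<lambda>n \<omega>. a n * excess_residual p q (m n) \<omega>)"
proof -
  obtain C where C: "\<And>m. m > 0 \<Longrightarrow> integrable M (excess_residual p q m)"
    "\<And>m. m > 0 \<Longrightarrow> expectation (\<lambda>\<omega>. \<bar>excess_residual p q m \<omega>\<bar>) \<le> C / real m"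
    using integrable_excess_residual[OF assms(1-4)] expectation_excess_residual[OF assms(1-4)] by blast
  have int: "integrable M (\<lambda>\<omega>. real m * excess_residual p q m \<omega>)" for m
    using C(1)[of m] by (cases "m = 0") auto
  have "bounded_in_prob (\<lambda>n \<omega>. real (m n) * excess_residual p q (m n) \<omega>)"
  proof (rule bounded_in_prob_expectation[OF int])
    show "expectation (\<lambda>\<omega>. \<bar>real (m n) * excess_residual p q (m n) \<omega>\<bar>) \<le> \<bar>C\<bar>" for n
      using C(2)[of "m n"] by (cases "m n = 0") (auto simp: abs_mult field_simps)
  qed
  from bounded_in_prob_null_seq_mult[OF a this] show ?thesis
  proof (rule vanishes_in_prob_le)
    have "\<forall>\<^sub>F n in sequentially. m n > 0"
      using m[unfolded filterlim_at_top, rule_format, of 1] by (simp add: Suc_le_eq)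
    then show "\<forall>\<^sub>F n in sequentially. AE \<omega> in M. \<bar>a n * excess_residual p q (m n) \<omega>\<bar>
        \<le> \<bar>a n / real (m n) * (real (m n) * excess_residual p q (m n) \<omega>)\<bar>"
      by eventually_elim simp
  qed measurable
qed

lemma excess_avg_consistent:
  assumes [measurable]: "p \<in> borel_measurable borel" "q \<in> borel_measurable borel"
    and sq: "integrable N (\<lambda>x. (p x)\<^sup>2)" "integrable N (\<lambda>x. (q x)\<^sup>2)"
    and m: "filterlim m at_top sequentially"
  shows "vanishes_in_prob (\<lambda>n \<omega>. excess_avg p q (m n) \<omega> - N.mean_excess p q)"
proof -
  have int: "integrable N p" "integrable N q"
    using sq by (auto intro!: N.square_integrable_imp_integrable)
  have "(\<lambda>n. 1 / real (m n)) \<longlonglongrightarrow> 0"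
    by (intro tendsto_divide_0[OF tendsto_const] filterlim_at_top_imp_at_infinity)
       (rule filterlim_compose[OF filterlim_real_sequentially m])
  from vanishes_in_prob_add[OF excess_residual_vanishes[OF assms(1,2) int m this]
      weak_law_of_large_numbers[OF _ N.excess_proj_square_integrable[OF assms(1-4)] m]]
  show ?thesis
    by (simp add: excess_residual_def N.expectation_excess_proj[OF assms(1,2) int])
qed

lemma expectation_excess_pair:
  assumes [measurable]: "p \<in> borel_measurable borel" "q \<in> borel_measurable borel"
    and int: "integrable N p" "integrable N q" and "j \<noteq> k"
  shows "expectation (\<lambda>\<omega>. max 0 (p (X k \<omega>) - q (X j \<omega>))) = N.mean_excess p q"
proof -
  interpret NN: pair_sigma_finite N N ..
  let ?f = "\<lambda>(y, x). max 0 (p x - q y)"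
  have "integrable M (\<lambda>\<omega>. max 0 (p (X k \<omega>) - q (X j \<omega>)))"
    using int by (intro integrable_max Bochner_Integration.integrable_diff) (auto simp: integrable_sample)
  then have "integrable (N \<Otimes>\<^sub>M N) ?f"
    unfolding pair_law[OF \<open>j \<noteq> k\<close>, symmetric] by (subst integrable_distr_eq) auto
  from NN.integral_fst'[OF this] have "N.mean_excess p q = integral\<^sup>L (N \<Otimes>\<^sub>M N) ?f"
    by (simp add: N.mean_excess_def)
  also have "\<dots> = expectation (\<lambda>\<omega>. max 0 (p (X k \<omega>) - q (X j \<omega>)))"
    unfolding pair_law[OF \<open>j \<noteq> k\<close>, symmetric] by (subst integral_distr) auto
  finally show ?thesis ..
qed

lemma convex_excess_avg: "convex_on UNIV (\<lambda>\<rho>. excess_avg p (\<lambda>y. \<rho> * y) m \<omega>)"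
proof -
  have max: "convex_on UNIV (\<lambda>\<rho>. max 0 (a - \<rho> * b))" for a b :: real
  proof (rule convex_on_linorderI)
    fix t x y :: real assume t: "t > 0" "t < 1"
    have "a - ((1 - t) *\<^sub>R x + t *\<^sub>R y) * b = (1 - t) * (a - x * b) + t * (a - y * b)"
      by (simp add: algebra_simps)
    also have "max 0 \<dots> \<le> (1 - t) * max 0 (a - x * b) + t * max 0 (a - y * b)"
      using t by (intro max.boundedI add_nonneg_nonneg mult_nonneg_nonneg add_mono mult_left_mono) auto
    finally show "max 0 (a - ((1 - t) *\<^sub>R x + t *\<^sub>R y) * b)
        \<le> (1 - t) * max 0 (a - x * b) + t * max 0 (a - y * b)" .
  qed auto
  have sum: "convex_on UNIV (\<lambda>\<rho>. \<Sum>i\<in>I. f i \<rho>)"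
    if "finite I" "\<And>i. i \<in> I \<Longrightarrow> convex_on UNIV (f i)" for I :: "nat set" and f :: "nat \<Rightarrow> real \<Rightarrow> real"
    using that by (induction I rule: finite_induct) (auto simp: convex_on_const)
  have "convex_on UNIV (\<lambda>\<rho>. \<Sum>k<m. \<Sum>j<m. max 0 (p (X k \<omega>) - \<rho> * X j \<omega>))"
    by (intro sum max) auto
  then show ?thesis
    unfolding excess_avg_def by (intro convex_on_cdiv) auto
qed

end

section \<open>Plugging in the ratio of two sample means\<close>

lemma sample_size_limits:
  assumes "(\<lambda>n. real (m n) / real n) \<longlonglongrightarrow> l" "l > 0"
  shows "filterlim m at_top sequentially" "(\<lambda>n. sqrt (real n) / sqrt (real (m n))) \<longlonglongrightarrow> 1 / sqrt l"
    "(\<lambda>n. sqrt (real n) / real (m n)) \<longlonglongrightarrow> 0" "\<forall>\<^sub>F n in sequentially. 0 < m n"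
proof -
  have "filterlim (\<lambda>n. real (m n) / real n * real n) at_top sequentially"
    by (rule filterlim_tendsto_pos_mult_at_top[OF assms filterlim_real_sequentially])
  then have real_m: "filterlim (\<lambda>n. real (m n)) at_top sequentially"
    by (rule filterlim_at_top_mono) simp
  then show m: "filterlim m at_top sequentially"
    unfolding filterlim_at_top by (metis (mono_tags, lifting) eventually_mono of_nat_le_iff)
  show "\<forall>\<^sub>F n in sequentially. 0 < m n"
    using m[unfolded filterlim_at_top, rule_format, of 1] by (simp add: Suc_le_eq)
  have "(\<lambda>n. sqrt (1 / (real (m n) / real n))) \<longlonglongrightarrow> sqrt (1 / l)"
    using assms by (intro tendsto_intros) auto
  then show lim: "(\<lambda>n. sqrt (real n) / sqrt (real (m n))) \<longlonglongrightarrow> 1 / sqrt l"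
    by (simp add: real_sqrt_divide)
  have "(\<lambda>n. sqrt (real n) / sqrt (real (m n)) * (1 / sqrt (real (m n)))) \<longlonglongrightarrow> 1 / sqrt l * 0"
    by (intro tendsto_mult lim tendsto_divide_0[OF tendsto_const] filterlim_at_top_imp_at_infinity
        filterlim_compose[OF sqrt_at_top real_m])
  then show "(\<lambda>n. sqrt (real n) / real (m n)) \<longlonglongrightarrow> 0"
    by simp
qed

text \<open>The derivative of the mean excess at \<open>r\<close> is \<open>- \<kappa>\<close>, so the delta method turns the difference into
  \<open>- \<kappa>\<close> times the scaled error of the ratio. In that error, \<open>(mean X - r * mean X') / mean X'\<close>, the
  random denominator may be replaced by its limit.\<close>

lemma (in prob_space) excess_at_ratio_of_means:
  fixes X X' :: "nat \<Rightarrow> 'a \<Rightarrow> real"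
  assumes S: "iid_sample M X N" and S': "iid_sample M X' N'"
    and sq: "integrable N (\<lambda>x. x\<^sup>2)" and sq': "integrable N' (\<lambda>x. x\<^sup>2)"
    and no_atoms: "\<And>x. measure N {x} = 0" and pos: "AE x in N'. 0 < x"
    and mean: "(LINT x|N. x) = r * (LINT x|N'. x)"
    and n1: "(\<lambda>n. real (n1 n) / real n) \<longlonglongrightarrow> l1" "l1 > 0"
    and n2: "(\<lambda>n. real (n2 n) / real n) \<longlonglongrightarrow> l2" "l2 > 0"
  defines "\<kappa> \<equiv> LINT y|N. y * real_distribution.tail_prob N (\<lambda>x. x) (r * y)"
  shows "vanishes_in_prob (\<lambda>n \<omega>. sqrt (real n) *
      (iid_sample.excess_avg X (\<lambda>x. x) (\<lambda>y. r_hat X X' (n1 n) (n2 n) \<omega> * y) (n1 n) \<omega>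
       - iid_sample.excess_avg X (\<lambda>x. x) (\<lambda>y. r * y) (n1 n) \<omega>)
      + \<kappa> / (LINT x|N'. x) * (sqrt (real n) * (emp_mean X (n1 n) \<omega> - r * emp_mean X' (n2 n) \<omega>)))"
proof -
  interpret A: iid_sample M X N by fact
  interpret B: iid_sample M X' N' by fact
  define \<mu> where "\<mu> = (LINT x|N'. x)"
  have int: "integrable N (\<lambda>x. x)" "integrable N' (\<lambda>x. x)"
    using sq sq' by (auto intro!: A.N.square_integrable_imp_integrable B.N.square_integrable_imp_integrable)
  have "\<mu> \<noteq> 0"
  proof
    assume "\<mu> = 0"
    moreover have "AE x in N'. 0 \<le> x" using pos by eventually_elim simp
    ultimately have "AE x in N'. x = 0"
      unfolding \<mu>_def using integral_nonneg_eq_0_iff_AE[OF int(2)] by blast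
    then have "AE x in N'. False" using pos by eventually_elim simp
    then show False by simp
  qed
  moreover have "\<mu> \<ge> 0"
    unfolding \<mu>_def using pos by (intro integral_nonneg_AE) (auto elim: eventually_mono)
  ultimately have "\<mu> > 0" by simp
  note lim1 = sample_size_limits[OF n1] and lim2 = sample_size_limits[OF n2]
  let ?f1 = "\<lambda>n. A.fluctuation (\<lambda>x. x) (n1 n)" and ?f2 = "\<lambda>n. B.fluctuation (\<lambda>x. x) (n2 n)"
  define D where "D n \<omega> = sqrt (real n) / sqrt (real (n1 n)) * ?f1 n \<omega>
      + (- r) * (sqrt (real n) / sqrt (real (n2 n)) * ?f2 n \<omega>)" for n \<omega>
  define m where "m n \<omega> = (\<Sum>k<n2 n. X' k \<omega>) / real (n2 n)" for n \<omega>
  \<comment> \<open>for positive sample sizes and a positive second mean, the error of the ratio\<close>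
  define \<delta> where "\<delta> n \<omega> = 1 / sqrt (real n) * (D n \<omega> / m n \<omega>)" for n \<omega>
  define V where "V n \<omega> \<rho> = A.excess_avg (\<lambda>x. x) (\<lambda>y. \<rho> * y) (n1 n) \<omega>" for n \<omega> \<rho>
  have D_bounded: "bounded_in_prob D"
    unfolding D_def[abs_def]
    by (intro bounded_in_prob_add bounded_in_prob_cmult bounded_in_prob_convergent_mult[OF lim1(2)]
        bounded_in_prob_convergent_mult[OF lim2(2)] A.bounded_fluctuation B.bounded_fluctuation sq sq') auto
  have m_lim: "vanishes_in_prob (\<lambda>n \<omega>. m n \<omega> - \<mu>)"
    using B.weak_law_of_large_numbers[OF _ sq' lim2(1)] by (simp add: m_def \<mu>_def)
  have ratio_bounded: "bounded_in_prob (\<lambda>n \<omega>. D n \<omega> / m n \<omega>)"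
    by (rule bounded_in_prob_divide[OF D_bounded m_lim \<open>\<mu> > 0\<close>])
  have inv_sqrt: "(\<lambda>n. 1 / sqrt (real n)) \<longlonglongrightarrow> 0"
    by (intro tendsto_divide_0[OF tendsto_const] filterlim_at_top_imp_at_infinity
        filterlim_compose[OF sqrt_at_top filterlim_real_sequentially])
  have "(\<lambda>n. sqrt (real n) * (1 / sqrt (real n))) \<longlonglongrightarrow> 1"
    by (rule tendsto_eventually) (auto intro: eventually_mono[OF eventually_gt_at_top[of 0]])
  from bounded_in_prob_convergent_mult[OF this ratio_bounded]
  have \<delta>_scale: "bounded_in_prob (\<lambda>n \<omega>. sqrt (real n) * \<delta> n \<omega>)"
    by (simp only: \<delta>_def mult.assoc)
  have \<delta>_lim: "vanishes_in_prob \<delta>"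
    unfolding \<delta>_def[abs_def] by (rule bounded_in_prob_null_seq_mult[OF inv_sqrt ratio_bounded])
  note [measurable] = vanishes_in_prob_measurable[OF \<delta>_lim]
  have delta: "vanishes_in_prob (\<lambda>n \<omega>. sqrt (real n) * (V n \<omega> (r + \<delta> n \<omega>) - V n \<omega> r)
      - (- \<kappa>) * (sqrt (real n) * \<delta> n \<omega>))"
  proof (rule convex_delta_method[OF _ _ _ \<delta>_lim \<delta>_scale])
    show "convex_on UNIV (V n \<omega>)" for n \<omega>
      unfolding V_def[abs_def] by (rule A.convex_excess_avg)
    show "vanishes_in_prob (\<lambda>n \<omega>. V n \<omega> \<rho> - A.N.mean_excess (\<lambda>x. x) (\<lambda>y. \<rho> * y))" for \<rho>
      unfolding V_def using sq by (intro A.excess_avg_consistent lim1) (auto simp: power_mult_distrib)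
    show "((\<lambda>\<rho>. A.N.mean_excess (\<lambda>x. x) (\<lambda>y. \<rho> * y)) has_real_derivative - \<kappa>) (at r)"
      unfolding \<kappa>_def by (rule A.N.mean_excess_has_derivative[OF int(1) no_atoms])
    show "random_variable borel (\<lambda>\<omega>. V n \<omega> (r + \<delta> n \<omega>))" for n
      unfolding V_def A.excess_avg_def by measurable
  qed
  let ?S = "\<lambda>n \<omega>. (sqrt (real n) * (V n \<omega> (r + \<delta> n \<omega>) - V n \<omega> r) - (- \<kappa>) * (sqrt (real n) * \<delta> n \<omega>))
      + \<kappa> / \<mu> * ((m n \<omega> - \<mu>) * (D n \<omega> / m n \<omega>))"
  have "vanishes_in_prob ?S"
    by (intro vanishes_in_prob_add delta vanishes_in_prob_cmult vanishes_in_prob_mult_bounded m_lim ratio_bounded)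
  then show ?thesis
    unfolding \<mu>_def[symmetric]
  proof (rule vanishes_in_prob_le)
    show "random_variable borel (\<lambda>\<omega>. sqrt (real n) *
      (A.excess_avg (\<lambda>x. x) (\<lambda>y. r_hat X X' (n1 n) (n2 n) \<omega> * y) (n1 n) \<omega> - A.excess_avg (\<lambda>x. x) (\<lambda>y. r * y) (n1 n) \<omega>)
      + \<kappa> / \<mu> * (sqrt (real n) * (emp_mean X (n1 n) \<omega> - r * emp_mean X' (n2 n) \<omega>)))" for n
      unfolding A.excess_avg_def r_hat_def emp_mean_def by measurable
    have all_pos: "AE \<omega> in M. \<forall>k. 0 < X' k \<omega>"
      unfolding AE_all_countable using pos B.AE_sample[of "\<lambda>x. 0 < x"] by simp
    show "\<forall>\<^sub>F n in sequentially. AE \<omega> in M. \<bar>sqrt (real n) *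
      (A.excess_avg (\<lambda>x. x) (\<lambda>y. r_hat X X' (n1 n) (n2 n) \<omega> * y) (n1 n) \<omega> - A.excess_avg (\<lambda>x. x) (\<lambda>y. r * y) (n1 n) \<omega>)
      + \<kappa> / \<mu> * (sqrt (real n) * (emp_mean X (n1 n) \<omega> - r * emp_mean X' (n2 n) \<omega>))\<bar> \<le> \<bar>?S n \<omega>\<bar>"
      using lim1(4) lim2(4) eventually_gt_at_top[of 0]
    proof eventually_elim
      case (elim n)
      show ?case
        using all_pos
      proof eventually_elim
        fix \<omega> assume "\<forall>k. 0 < X' k \<omega>"
        then have "m n \<omega> > 0" using elim(2) by (auto simp: m_def intro!: divide_pos_pos sum_pos)
        have D_eq: "D n \<omega> = sqrt (real n) * (emp_mean X (n1 n) \<omega> - r * emp_mean X' (n2 n) \<omega>)"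
        proof -
          have "emp_mean X (n1 n) \<omega> = r * \<mu> + 1 / sqrt (real (n1 n)) * ?f1 n \<omega>"
            using A.mean_minus_expectation[OF elim(1), of "\<lambda>x. x" \<omega>] mean by (simp add: emp_mean_def \<mu>_def)
          moreover have "emp_mean X' (n2 n) \<omega> = \<mu> + 1 / sqrt (real (n2 n)) * ?f2 n \<omega>"
            using B.mean_minus_expectation[OF elim(2), of "\<lambda>x. x" \<omega>] by (simp add: emp_mean_def \<mu>_def)
          ultimately show ?thesis by (simp add: D_def algebra_simps)
        qed
        have m_eq: "emp_mean X' (n2 n) \<omega> = m n \<omega>" by (simp add: emp_mean_def m_def)
        have "\<delta> n \<omega> = r_hat X X' (n1 n) (n2 n) \<omega> - r"
          using elim(3) \<open>m n \<omega> > 0\<close> by (simp add: \<delta>_def D_eq r_hat_def m_eq field_simps)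
        then have r_eq: "r + \<delta> n \<omega> = r_hat X X' (n1 n) (n2 n) \<omega>" by simp
        have step: "sqrt (real n) * \<delta> n \<omega> = D n \<omega> / m n \<omega>"
          using elim(3) by (simp add: \<delta>_def)
        have split: "\<kappa> * (D n \<omega> / m n \<omega>) + \<kappa> / \<mu> * ((m n \<omega> - \<mu>) * (D n \<omega> / m n \<omega>)) = \<kappa> / \<mu> * D n \<omega>"
          using \<open>m n \<omega> > 0\<close> \<open>\<mu> > 0\<close> by (simp add: field_simps)
        have "?S n \<omega> = sqrt (real n) * (V n \<omega> (r + \<delta> n \<omega>) - V n \<omega> r) + \<kappa> / \<mu> * D n \<omega>"
          by (simp only: step split[symmetric] mult_minus_left diff_minus_eq_add add.assoc)
        then show "\<bar>sqrt (real n) *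
          (A.excess_avg (\<lambda>x. x) (\<lambda>y. r_hat X X' (n1 n) (n2 n) \<omega> * y) (n1 n) \<omega> - A.excess_avg (\<lambda>x. x) (\<lambda>y. r * y) (n1 n) \<omega>)
          + \<kappa> / \<mu> * (sqrt (real n) * (emp_mean X (n1 n) \<omega> - r * emp_mean X' (n2 n) \<omega>))\<bar> \<le> \<bar>?S n \<omega>\<bar>"
          unfolding r_eq D_eq V_def by simp
      qed
    qed
  qed
qed

section \<open>Closed form of the test statistic\<close>

lemma interval_measure_cdf:
  assumes "real_distribution D"
  shows "interval_measure (cdf D) = D"
proof -
  interpret real_distribution D by fact
  have "real_distribution (interval_measure (cdf D))"
    by (rule real_distribution_interval_measure)
       (rule cdf_nondecreasing cdf_is_right_cont cdf_lim_at_bot cdf_lim_at_top_prob | assumption)+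
  moreover have "cdf (interval_measure (cdf D)) = cdf D"
    by (rule cdf_interval_measure) (rule cdf_nondecreasing cdf_is_right_cont cdf_lim_at_bot | assumption)+
  ultimately show ?thesis
    using assms by (intro cdf_unique)
qed

lemma indicator_eq_if:
  "indicator {..b} x = (if x \<le> b then 1 else 0 :: real)"
  "indicator {a..b} x = (if a \<le> x \<and> x \<le> b then 1 else 0 :: real)"
  by (auto split: split_indicator)

lemma emp_cdf_measurable [measurable]: "emp_cdf X m \<omega> \<in> borel_measurable borel"
proof -
  have "emp_cdf X m \<omega> = (\<lambda>t. 1 / real m * (\<Sum>i<m. if X i \<omega> \<le> t then 1 else 0))"
    by (simp only: emp_cdf_def[abs_def] indicator_eq_if)
  also have "\<dots> \<in> borel_measurable borel" by measurable
  finally show ?thesis .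
qed

text \<open>For \<open>m = 0\<close> the empirical c.d.f. is constantly \<open>0\<close>, which is not the c.d.f. of a probability measure.\<close>

lemma interval_measure_emp_cdf:
  assumes "m > 0"
  shows "interval_measure (emp_cdf X m \<omega>) = distr (uniform_count_measure {..<m}) borel (\<lambda>i. X i \<omega>)"
proof -
  interpret U: prob_space "uniform_count_measure {..<m}"
    using assms by (intro prob_space_uniform_count_measure) auto
  let ?D = "distr (uniform_count_measure {..<m}) borel (\<lambda>i. X i \<omega>)"
  have m: "(\<lambda>i. X i \<omega>) \<in> borel_measurable (uniform_count_measure {..<m})"
    by (simp cong: measurable_cong_sets)
  have "cdf ?D t = emp_cdf X m \<omega> t" for t
  proof -
    have "cdf ?D t = measure (uniform_count_measure {..<m}) {i \<in> {..<m}. X i \<omega> \<le> t}"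
      unfolding cdf_def by (subst measure_distr[OF m]) (auto simp: space_uniform_count_measure intro!: arg_cong[where f = "measure _"])
    also have "\<dots> = real (card {i \<in> {..<m}. X i \<omega> \<le> t}) / real m"
      by (subst measure_uniform_count_measure) auto
    also have "\<dots> = emp_cdf X m \<omega> t"
      by (simp add: emp_cdf_def indicator_def sum.If_cases Int_def)
    finally show ?thesis .
  qed
  then have "cdf ?D = emp_cdf X m \<omega>" by (rule ext)
  with interval_measure_cdf[OF U.real_distribution_distr[OF m]] show ?thesis by simp
qed

lemma system_cdf_hat_eq_sum:
  "system_cdf_hat T1 T2 m1 m2 \<omega> t = (\<Sum>j<m1. indicator {0..t} (T1 j \<omega>) *
     emp_cdf T1 m1 \<omega> (t + g_hat T1 T2 m1 m2 \<omega> (T1 j \<omega>) - T1 j \<omega>)) / real m1"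
proof (cases "m1 = 0")
  case True
  then show ?thesis by (simp add: system_cdf_hat_def emp_cdf_def set_lebesgue_integral_def)
next
  case False
  then show ?thesis
    unfolding system_cdf_hat_def set_lebesgue_integral_def
    by (subst interval_measure_emp_cdf, simp, subst integral_distr)
       (auto simp: integral_uniform_count_measure g_hat_def cong: measurable_cong_sets)
qed

lemma test_stat_measurable:
  assumes [measurable]: "\<And>k. T1 k \<in> borel_measurable M" "\<And>k. T2 k \<in> borel_measurable M" "\<And>k. T k \<in> borel_measurable M"
  shows "test_stat T1 T2 T m1 m2 n \<in> borel_measurable M"
proof -
  have eq: "test_stat T1 T2 T m1 m2 n = (\<lambda>\<omega>. sqrt (real n) * (LBINT t. indicator {0..} t *\<^sub>R
      (1 / real n * (\<Sum>i<n. if T i \<omega> \<le> t then 1 else 0)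
       - (\<Sum>j<m1. (if 0 \<le> T1 j \<omega> \<and> T1 j \<omega> \<le> t then 1 else 0) *
           (1 / real m1 * (\<Sum>k<m1. if T1 k \<omega> \<le> t + emp_mean T1 m1 \<omega> / emp_mean T2 m2 \<omega> * T1 j \<omega> - T1 j \<omega>
              then 1 else 0))) / real m1)))"
    unfolding test_stat_def[abs_def] set_lebesgue_integral_def system_cdf_hat_eq_sum
      emp_cdf_def g_hat_def r_hat_def indicator_eq_if ..
  show ?thesis
    unfolding eq emp_mean_def by measurable
qed

text \<open>With \<open>z j k = T1 j + max 0 (T1 k - r_hat * T1 j)\<close>, the estimated c.d.f. of the system is the
  empirical c.d.f. of the numbers \<open>z j k\<close>. The integral of the difference of two empirical c.d.f.s
  of nonnegative numbers is the difference of the means in reverse order.\<close>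

lemma test_stat_eq:
  assumes T1: "\<And>k. k < m1 \<Longrightarrow> 0 \<le> T1 k \<omega>" and T: "\<And>k. k < n \<Longrightarrow> 0 \<le> T k \<omega>" and pos: "m1 > 0" "n > 0"
  shows "test_stat T1 T2 T m1 m2 n \<omega> = sqrt (real n) * ((\<Sum>k<m1. T1 k \<omega>) / real m1
    + (\<Sum>k<m1. \<Sum>j<m1. max 0 (T1 k \<omega> - r_hat T1 T2 m1 m2 \<omega> * T1 j \<omega>)) / (real m1)\<^sup>2
    - (\<Sum>k<n. T k \<omega>) / real n)"
proof -
  let ?r = "r_hat T1 T2 m1 m2 \<omega>"
  define z where "z j k = T1 j \<omega> + max 0 (T1 k \<omega> - ?r * T1 j \<omega>)" for j k
  have z0: "0 \<le> z j k" if "j < m1" for j k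
    using T1[OF that] by (simp add: z_def)
  define a where "a t = (\<Sum>j<m1. \<Sum>k<m1. indicator {0..<z j k} t) / (real m1)\<^sup>2" for t :: real
  define b where "b t = (\<Sum>k<n. indicator {0..<T k \<omega>} t) / real n" for t :: real
  have eq: "indicator {0..} t *\<^sub>R (emp_cdf T n \<omega> t - system_cdf_hat T1 T2 m1 m2 \<omega> t) = a t - b t" for t
  proof (cases "0 \<le> t")
    case True
    have "emp_cdf T n \<omega> t = 1 / real n * (\<Sum>k<n. 1 - indicator {0..<T k \<omega>} t)"
      using True unfolding emp_cdf_def by (intro arg_cong2[where f = "(*)"] sum.cong) (auto split: split_indicator)
    also have "\<dots> = 1 - b t"
      using pos by (simp add: b_def sum_subtractf right_diff_distrib)
    finally have 1: "emp_cdf T n \<omega> t = 1 - b t" .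
    have "indicator {0..t} (T1 j \<omega>) * emp_cdf T1 m1 \<omega> (t + g_hat T1 T2 m1 m2 \<omega> (T1 j \<omega>) - T1 j \<omega>)
        = 1 / real m1 * (\<Sum>k<m1. 1 - indicator {0..<z j k} t)" if "j < m1" for j
      unfolding emp_cdf_def g_hat_def mult.left_commute[of "indicator {0..t} (T1 j \<omega>)"] sum_distrib_left
      using True T1[OF that]
      by (intro sum.cong refl arg_cong2[where f = "(*)"]) (auto simp: z_def split: split_indicator)
    then have "system_cdf_hat T1 T2 m1 m2 \<omega> t = (\<Sum>j<m1. 1 / real m1 * (\<Sum>k<m1. 1 - indicator {0..<z j k} t)) / real m1"
      unfolding system_cdf_hat_eq_sum by simp
    also have "\<dots> = (\<Sum>j<m1. \<Sum>k<m1. 1 - indicator {0..<z j k} t) / (real m1)\<^sup>2"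
      by (simp add: sum_divide_distrib power2_eq_square)
    also have "\<dots> = 1 - a t"
      using pos by (simp add: a_def sum_subtractf diff_divide_distrib power2_eq_square)
    finally show ?thesis using True 1 by simp
  qed (simp add: a_def b_def)
  have ind: "integrable lborel (indicator {0..<c} :: real \<Rightarrow> real)"
    "0 \<le> c \<Longrightarrow> (LBINT t. indicator {0..<c} t) = c" for c :: real
    by (cases "0 \<le> c") auto
  have a: "integrable lborel a" "(LBINT t. a t) = (\<Sum>j<m1. \<Sum>k<m1. z j k) / (real m1)\<^sup>2"
  proof -
    show "integrable lborel a"
      unfolding a_def[abs_def] by (intro integrable_divide_zero Bochner_Integration.integrable_sum ind)
    have "(LBINT t. a t) = (\<Sum>j<m1. \<Sum>k<m1. LBINT t. indicator {0..<z j k} t) / (real m1)\<^sup>2"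
      unfolding a_def[abs_def]
      by (simp only: ind(1) integral_divide_zero Bochner_Integration.integral_sum Bochner_Integration.integrable_sum)
    also have "(\<Sum>j<m1. \<Sum>k<m1. LBINT t. indicator {0..<z j k} t) = (\<Sum>j<m1. \<Sum>k<m1. z j k)"
      by (intro sum.cong refl ind(2) z0) simp
    finally show "(LBINT t. a t) = (\<Sum>j<m1. \<Sum>k<m1. z j k) / (real m1)\<^sup>2" .
  qed
  have b: "integrable lborel b" "(LBINT t. b t) = (\<Sum>k<n. T k \<omega>) / real n"
  proof -
    show "integrable lborel b"
      unfolding b_def[abs_def] by (intro integrable_divide_zero Bochner_Integration.integrable_sum ind)
    have "(LBINT t. b t) = (\<Sum>k<n. LBINT t. indicator {0..<T k \<omega>} t) / real n"
      unfolding b_def[abs_def]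
      by (simp only: ind(1) integral_divide_zero Bochner_Integration.integral_sum)
    also have "(\<Sum>k<n. LBINT t. indicator {0..<T k \<omega>} t) = (\<Sum>k<n. T k \<omega>)"
      by (intro sum.cong refl ind(2) T) simp
    finally show "(LBINT t. b t) = (\<Sum>k<n. T k \<omega>) / real n" .
  qed
  have "(\<Sum>j<m1. \<Sum>k<m1. z j k) / (real m1)\<^sup>2 = (\<Sum>k<m1. T1 k \<omega>) / real m1
    + (\<Sum>k<m1. \<Sum>j<m1. max 0 (T1 k \<omega> - ?r * T1 j \<omega>)) / (real m1)\<^sup>2"
    unfolding z_def sum.distrib
    by (subst (3) sum.swap) (use pos in \<open>simp add: add_divide_distrib sum_distrib_left[symmetric] power2_eq_square\<close>)
  with a b show ?thesis
    unfolding test_stat_def set_lebesgue_integral_def eq by simp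
qed

section \<open>Lifetime distributions and the law of a system\<close>

lemma lifetime_density_measurable:
  assumes "lifetime_cdf_density F f"
  shows "f \<in> borel_measurable borel"
proof -
  have "(\<lambda>x. indicator {0<..} x *\<^sub>R f x) \<in> borel_measurable borel"
    using assms by (intro borel_measurable_continuous_on_indicator) (auto simp: lifetime_cdf_density_def)
  then have "(\<lambda>x. indicator {0<..} x *\<^sub>R f x + f 0 * indicator {0} x) \<in> borel_measurable borel"
    by measurable
  moreover have "(\<lambda>x. indicator {0<..} x *\<^sub>R f x + f 0 * indicator {0} x) = f"
    using assms by (auto simp: lifetime_cdf_density_def fun_eq_iff not_less split: split_indicator)
  ultimately show ?thesis by simp
qed

lemma lifetime_real_distribution:
  assumes "lifetime_cdf_density F f"
  shows "real_distribution (density lborel f)"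
  using assms by (auto simp: lifetime_cdf_density_def real_distribution_def real_distribution_axioms_def)

lemma lifetime_pos:
  assumes "lifetime_cdf_density F f"
  shows "AE x in density lborel f. 0 < x"
proof -
  have [measurable]: "f \<in> borel_measurable borel" by (rule lifetime_density_measurable[OF assms])
  have "AE x in lborel. 0 < ennreal (f x) \<longrightarrow> 0 < x"
    using AE_lborel_singleton[of "0 :: real"]
  proof eventually_elim
    case (elim x)
    show ?case
    proof (rule impI, rule ccontr)
      assume *: "0 < ennreal (f x)" "\<not> 0 < x"
      then have "f x = 0" using elim assms by (auto simp: lifetime_cdf_density_def)
      with * show False by simp
    qed
  qed
  then show ?thesis by (simp add: AE_density)
qed

lemma lifetime_no_atoms:
  assumes "lifetime_cdf_density F f"
  shows "measure (density lborel f) {x} = 0"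
proof -
  have [measurable]: "f \<in> borel_measurable borel" by (rule lifetime_density_measurable[OF assms])
  have "AE y in lborel. ennreal (f y) * indicator {x} y = 0"
    using AE_lborel_singleton[of x] by eventually_elim simp
  then have "emeasure (density lborel f) {x} = 0"
    by (simp add: emeasure_density nn_integral_0_iff_AE)
  then show ?thesis by (simp add: measure_def)
qed

lemma lifetime_law_scaled:
  assumes F1: "lifetime_cdf_density F1 f1" and F2: "lifetime_cdf_density F2 f2" and "r > 0"
    and eq: "\<And>t. t \<ge> 0 \<Longrightarrow> F2 t = F1 (r * t)"
  shows "density lborel f1 = distr (density lborel f2) borel (\<lambda>x. r * x)"
proof -
  interpret N1: real_distribution "density lborel f1" by (rule lifetime_real_distribution[OF F1])
  interpret N2: real_distribution "density lborel f2" by (rule lifetime_real_distribution[OF F2])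
  have neg: "cdf (density lborel f) t = 0" if F: "lifetime_cdf_density F f" and "t < 0" for F f t
  proof -
    interpret D: real_distribution "density lborel f" by (rule lifetime_real_distribution[OF F])
    have "AE x in density lborel f. x \<notin> {..t}"
      using lifetime_pos[OF F] by eventually_elim (use \<open>t < 0\<close> in auto)
    then have "D.prob {..t} = 0"
      by (subst D.prob_eq_0) auto
    then show ?thesis by (simp add: cdf_def)
  qed
  have "cdf (distr (density lborel f2) borel (\<lambda>x. r * x)) t = cdf (density lborel f1) t" for t
  proof -
    have "cdf (distr (density lborel f2) borel (\<lambda>x. r * x)) t = cdf (density lborel f2) (t / r)"
      unfolding cdf_def using \<open>r > 0\<close>
      by (subst measure_distr) (auto intro!: arg_cong[where f = "measure _"] simp: field_simps)
    also have "\<dots> = cdf (density lborel f1) t"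
    proof (cases "t < 0")
      case True
      then show ?thesis using neg[OF F1] neg[OF F2] \<open>r > 0\<close> by (simp add: divide_neg_pos)
    next
      case False
      then show ?thesis
        using eq[of "t / r"] F1 F2 \<open>r > 0\<close> by (simp add: lifetime_cdf_density_def)
    qed
    finally show ?thesis .
  qed
  then show ?thesis
    by (intro cdf_unique N1.real_distribution_axioms N2.real_distribution_distr) auto
qed

text \<open>A stand-by unit that survives the switching time \<open>y\<close> behaves from then on like a hot unit that has
  reached the age \<open>r * y\<close>. Since \<open>F2 y = F1 (r * y)\<close>, the probability of not surviving \<open>y\<close> is that of
  \<open>w \<le> r * y\<close> for a hot lifetime \<open>w\<close>, so the additional life of the system after \<open>y\<close> is distributed like
  \<open>max 0 (w - r * y)\<close>.\<close>

lemma law_of_system: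
  assumes "prob_space M" and F1: "lifetime_cdf_density F1 f1" and F2: "lifetime_cdf_density F2 f2" and "r > 0"
    and H0: "H0_star M F1 F2 f1 f2 r Y Z"
  defines "N \<equiv> density lborel f1"
  shows "distr M borel (\<lambda>\<omega>. max (Y \<omega>) (Z \<omega>)) = distr (N \<Otimes>\<^sub>M N) borel (\<lambda>(y, w). y + max 0 (w - r * y))"
proof -
  interpret M: prob_space M by fact
  interpret N: real_distribution N unfolding N_def by (rule lifetime_real_distribution[OF F1])
  interpret N2: real_distribution "density lborel f2" by (rule lifetime_real_distribution[OF F2])
  interpret NN: pair_sigma_finite N N ..
  note [measurable] = lifetime_density_measurable[OF F1] lifetime_density_measurable[OF F2]
  define s where "s = standby_cond_density f1 f2 r"
  have s_meas [measurable]: "case_prod s \<in> borel_measurable (borel \<Otimes>\<^sub>M borel)"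
    unfolding s_def standby_cond_density_def by measurable
  have D: "distributed M (lborel \<Otimes>\<^sub>M lborel) (\<lambda>\<omega>. (Y \<omega>, Z \<omega>)) (\<lambda>(y, t). ennreal (f1 y * s y t))"
    using H0 by (simp add: H0_star_def s_def)
  have YZ: "(\<lambda>\<omega>. (Y \<omega>, Z \<omega>)) \<in> measurable M (lborel \<Otimes>\<^sub>M lborel)"
    using D by (rule distributed_measurable)
  have "Y \<in> borel_measurable M" "Z \<in> borel_measurable M"
    using measurable_compose[OF YZ measurable_fst] measurable_compose[OF YZ measurable_snd] by simp_all
  note [measurable] = this
  have inner: "(\<integral>\<^sup>+t. ennreal (s y t) * indicator A (max y t) \<partial>lborel)
      = (\<integral>\<^sup>+w. ennreal (f1 w) * indicator A (y + max 0 (w - r * y)) \<partial>lborel)"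
    if "y > 0" and [measurable]: "A \<in> sets borel" for y A
  proof -
    have mass: "(\<integral>\<^sup>+t. ennreal (f2 t) * indicator {..y} t \<partial>lborel) = (\<integral>\<^sup>+w. ennreal (f1 w) * indicator {..r * y} w \<partial>lborel)"
    proof -
      have "emeasure (density lborel f2) {..y} = ennreal (F2 y)"
        using F2 by (simp add: lifetime_cdf_density_def cdf_def N2.emeasure_eq_measure)
      also have "F2 y = F1 (r * y)"
        using H0 \<open>y > 0\<close> by (simp add: H0_star_def)
      also have "ennreal (F1 (r * y)) = emeasure N {..r * y}"
      proof -
        have "F1 = cdf N" using F1 by (simp add: lifetime_cdf_density_def N_def)
        then show ?thesis by (simp add: cdf_def N.emeasure_eq_measure)
      qed
      finally show ?thesis by (simp add: emeasure_density N_def)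
    qed
    \<comment> \<open>split at \<open>t = y\<close>; beyond \<open>y\<close> substitute \<open>w = t + r * y - y\<close>\<close>
    have "(\<integral>\<^sup>+t. ennreal (s y t) * indicator A (max y t) \<partial>lborel)
      = (\<integral>\<^sup>+t. (ennreal (f2 t) * indicator {..y} t) * indicator A y
           + ennreal (f1 (t + r * y - y)) * (indicator {y<..} t * indicator A t) \<partial>lborel)"
      by (intro nn_integral_cong) (auto simp: s_def standby_cond_density_def split: split_indicator)
    also have "\<dots> = (\<integral>\<^sup>+t. (ennreal (f2 t) * indicator {..y} t) * indicator A y \<partial>lborel)
           + (\<integral>\<^sup>+t. ennreal (f1 (t + r * y - y)) * (indicator {y<..} t * indicator A t) \<partial>lborel)"
      by (intro nn_integral_add) measurable
    also have "(\<integral>\<^sup>+t. (ennreal (f2 t) * indicator {..y} t) * indicator A y \<partial>lborel)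
        = (\<integral>\<^sup>+w. ennreal (f1 w) * indicator {..r * y} w * indicator A y \<partial>lborel)"
      by (simp add: nn_integral_multc mass)
    also have "(\<integral>\<^sup>+t. ennreal (f1 (t + r * y - y)) * (indicator {y<..} t * indicator A t) \<partial>lborel)
        = (\<integral>\<^sup>+w. ennreal (f1 w) * (indicator {r * y<..} w * indicator A (y + w - r * y)) \<partial>lborel)"
      by (subst nn_integral_real_affine[where c = 1 and t = "y - r * y"])
         (auto simp: algebra_simps intro!: nn_integral_cong split: split_indicator)
    also have "(\<integral>\<^sup>+w. ennreal (f1 w) * indicator {..r * y} w * indicator A y \<partial>lborel)
        + (\<integral>\<^sup>+w. ennreal (f1 w) * (indicator {r * y<..} w * indicator A (y + w - r * y)) \<partial>lborel)
        = (\<integral>\<^sup>+w. ennreal (f1 w) * indicator {..r * y} w * indicator A y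
            + ennreal (f1 w) * (indicator {r * y<..} w * indicator A (y + w - r * y)) \<partial>lborel)"
      by (intro nn_integral_add[symmetric]) measurable
    also have "\<dots> = (\<integral>\<^sup>+w. ennreal (f1 w) * indicator A (y + max 0 (w - r * y)) \<partial>lborel)"
      by (intro nn_integral_cong) (auto simp: max_def add_diff_eq split: split_indicator)
    finally show ?thesis .
  qed
  show ?thesis
  proof (rule measure_eqI)
    fix A assume "A \<in> sets (distr M borel (\<lambda>\<omega>. max (Y \<omega>) (Z \<omega>)))"
    then have A [measurable]: "A \<in> sets borel" by simp
    have "emeasure (distr M borel (\<lambda>\<omega>. max (Y \<omega>) (Z \<omega>))) A = (\<integral>\<^sup>+\<omega>. indicator A (max (Y \<omega>) (Z \<omega>)) \<partial>M)"
      by (subst nn_integral_indicator[symmetric], simp, subst nn_integral_distr) auto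
    also have "\<dots> = (\<integral>\<^sup>+p. (case p of (y, t) \<Rightarrow> ennreal (f1 y * s y t)) * (case p of (y, t) \<Rightarrow> indicator A (max y t))
        \<partial>(lborel \<Otimes>\<^sub>M lborel))"
      by (subst distributed_nn_integral[OF D]) auto
    also have "\<dots> = (\<integral>\<^sup>+y. (\<integral>\<^sup>+t. ennreal (f1 y * s y t) * indicator A (max y t) \<partial>lborel) \<partial>lborel)"
      by (subst lborel.nn_integral_fst[symmetric]) auto
    also have "\<dots> = (\<integral>\<^sup>+y. ennreal (f1 y) * (\<integral>\<^sup>+w. ennreal (f1 w) * indicator A (y + max 0 (w - r * y)) \<partial>lborel) \<partial>lborel)"
    proof (rule nn_integral_cong_AE, rule AE_mp[OF AE_lborel_singleton[of 0]], rule AE_I2, rule impI)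
      fix y :: real assume "y \<noteq> 0"
      show "(\<integral>\<^sup>+t. ennreal (f1 y * s y t) * indicator A (max y t) \<partial>lborel)
          = ennreal (f1 y) * (\<integral>\<^sup>+w. ennreal (f1 w) * indicator A (y + max 0 (w - r * y)) \<partial>lborel)"
      proof (cases "y > 0")
        case True
        then have "0 \<le> f1 y" using F1 by (auto simp: lifetime_cdf_density_def less_imp_le)
        then show ?thesis
          by (simp add: ennreal_mult' inner[OF True A, symmetric] nn_integral_cmult[symmetric] mult.assoc)
      next
        case False
        with \<open>y \<noteq> 0\<close> have "f1 y = 0" using F1 by (auto simp: lifetime_cdf_density_def)
        then show ?thesis by simp
      qed
    qed
    also have "\<dots> = (\<integral>\<^sup>+y. (\<integral>\<^sup>+w. indicator A (y + max 0 (w - r * y)) \<partial>N) \<partial>N)"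
      unfolding N_def by (simp add: nn_integral_density)
    also have "\<dots> = emeasure (distr (N \<Otimes>\<^sub>M N) borel (\<lambda>(y, w). y + max 0 (w - r * y))) A"
      by (subst nn_integral_indicator[symmetric], simp, subst nn_integral_distr)
         (auto simp: N.nn_integral_fst[symmetric])
    finally show "emeasure (distr M borel (\<lambda>\<omega>. max (Y \<omega>) (Z \<omega>))) A
        = emeasure (distr (N \<Otimes>\<^sub>M N) borel (\<lambda>(y, w). y + max 0 (w - r * y))) A" .
  qed simp
qed

context iid_sample
begin

text \<open>Two members of the sample are used as the independent pair \<open>(y, w)\<close>. The variance is positive since
  for every \<open>y \<noteq> c\<close> at most one \<open>w\<close> gives \<open>y + max 0 (w - r * y) = c\<close>, and neither \<open>y = c\<close> nor
  this value of \<open>w\<close> has positive probability, so that the law has no atoms.\<close>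

lemma system_law_moments:
  fixes r :: real
  assumes sq: "integrable N (\<lambda>x. x\<^sup>2)" and no_atoms: "\<And>x. measure N {x} = 0"
    and nonneg: "AE x in N. 0 \<le> x"
  defines "NT \<equiv> distr (N \<Otimes>\<^sub>M N) borel (\<lambda>(y, w). y + max 0 (w - r * y))"
  shows "integrable NT (\<lambda>x. x\<^sup>2)"
    and "(LINT x|NT. x) = (LINT x|N. x) + N.mean_excess (\<lambda>x. x) (\<lambda>y. r * y)"
    and "AE x in NT. 0 \<le> x"
    and "0 < (LINT x|NT. (x - (LINT x|NT. x))\<^sup>2)"
proof -
  interpret NN: pair_prob_space N N ..
  have [measurable]: "(\<lambda>(y, w). y + max 0 (w - r * y)) \<in> borel_measurable (N \<Otimes>\<^sub>M N)"
    by measurable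
  define S where "S \<omega> = X 0 \<omega> + max 0 (X 1 \<omega> - r * X 0 \<omega>)" for \<omega>
  have [measurable]: "random_variable borel S" unfolding S_def by measurable
  have NT: "NT = distr M borel S"
  proof -
    have "N \<Otimes>\<^sub>M N = distr M (borel \<Otimes>\<^sub>M borel) (\<lambda>\<omega>. (X 0 \<omega>, X 1 \<omega>))"
      by (rule pair_law[symmetric]) simp
    then have "NT = distr (distr M (borel \<Otimes>\<^sub>M borel) (\<lambda>\<omega>. (X 0 \<omega>, X 1 \<omega>))) borel (\<lambda>(y, w). y + max 0 (w - r * y))"
      unfolding NT_def by (rule arg_cong)
    also have "\<dots> = distr M borel ((\<lambda>(y, w). y + max 0 (w - r * y)) \<circ> (\<lambda>\<omega>. (X 0 \<omega>, X 1 \<omega>)))"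
      by (rule distr_distr) measurable
    also have "(\<lambda>(y, w). y + max 0 (w - r * y)) \<circ> (\<lambda>\<omega>. (X 0 \<omega>, X 1 \<omega>)) = S"
      by (simp add: fun_eq_iff S_def)
    finally show ?thesis .
  qed
  interpret NT: real_distribution NT unfolding NT by simp
  have int: "integrable N (\<lambda>x. x)"
    using sq by (auto intro!: N.square_integrable_imp_integrable)
  have X_int: "integrable M (X k)" "integrable M (\<lambda>\<omega>. (X k \<omega>)\<^sup>2)" for k
    by (rule integrable_sample[THEN iffD2, of "\<lambda>x. x"], simp, rule int)
       (rule integrable_sample[THEN iffD2, of "\<lambda>x. x\<^sup>2"], simp, rule sq)
  have "integrable M (\<lambda>\<omega>. (S \<omega>)\<^sup>2)"
  proof (rule Bochner_Integration.integrable_bound)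
    show "integrable M (\<lambda>\<omega>. 3 * ((X 0 \<omega>)\<^sup>2 + (X 1 \<omega>)\<^sup>2 + r\<^sup>2 * (X 0 \<omega>)\<^sup>2))"
      using X_int by auto
    show "AE \<omega> in M. norm ((S \<omega>)\<^sup>2) \<le> norm (3 * ((X 0 \<omega>)\<^sup>2 + (X 1 \<omega>)\<^sup>2 + r\<^sup>2 * (X 0 \<omega>)\<^sup>2))"
    proof (rule AE_I2)
      fix \<omega>
      have "\<bar>S \<omega>\<bar> \<le> \<bar>\<bar>X 0 \<omega>\<bar> + \<bar>X 1 \<omega>\<bar> + \<bar>r * X 0 \<omega>\<bar>\<bar>" unfolding S_def by linarith
      then have "(S \<omega>)\<^sup>2 \<le> (\<bar>X 0 \<omega>\<bar> + \<bar>X 1 \<omega>\<bar> + \<bar>r * X 0 \<omega>\<bar>)\<^sup>2" by (simp only: abs_le_square_iff)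
      also have "\<dots> \<le> 3 * (\<bar>X 0 \<omega>\<bar>\<^sup>2 + \<bar>X 1 \<omega>\<bar>\<^sup>2 + \<bar>r * X 0 \<omega>\<bar>\<^sup>2)"
        by (rule square_sum_three_le)
      finally show "norm ((S \<omega>)\<^sup>2) \<le> norm (3 * ((X 0 \<omega>)\<^sup>2 + (X 1 \<omega>)\<^sup>2 + r\<^sup>2 * (X 0 \<omega>)\<^sup>2))"
        by (simp add: power_mult_distrib)
    qed
  qed measurable
  then show NT_sq: "integrable NT (\<lambda>x. x\<^sup>2)"
    unfolding NT by (simp add: integrable_distr_eq)
  have "expectation S = expectation (X 0) + expectation (\<lambda>\<omega>. max 0 (X 1 \<omega> - r * X 0 \<omega>))"
    unfolding S_def
    by (intro Bochner_Integration.integral_add X_int integrable_max integrable_zero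
        Bochner_Integration.integrable_diff integrable_mult_right)
  also have "expectation (\<lambda>\<omega>. max 0 (X 1 \<omega> - r * X 0 \<omega>)) = N.mean_excess (\<lambda>x. x) (\<lambda>y. r * y)"
    by (rule expectation_excess_pair[where p = "\<lambda>x. x" and q = "\<lambda>y. r * y"])
      (simp_all add: int integrable_mult_right)
  also have "expectation (X 0) = (LINT x|N. x)"
    by (rule expectation_sample) simp
  finally show "(LINT x|NT. x) = (LINT x|N. x) + N.mean_excess (\<lambda>x. x) (\<lambda>y. r * y)"
    unfolding NT by (simp add: integral_distr)
  have "AE \<omega> in M. 0 \<le> X 0 \<omega>"
    by (rule AE_sample[THEN iffD2, of "\<lambda>x. 0 \<le> x"]) (simp_all add: nonneg)
  then have "AE \<omega> in M. 0 \<le> S \<omega>"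
    by eventually_elim (simp add: S_def)
  then show "AE x in NT. 0 \<le> x"
    unfolding NT by (simp add: AE_distr_iff)
  have atoms: "AE y in N. y \<noteq> c" for c
    using no_atoms[of c] by (intro AE_I[of _ _ "{c}"]) (auto simp: N.emeasure_eq_measure)
  have NT_atoms: "AE x in NT. x \<noteq> c" for c
  proof -
    have "AE y in N. AE w in N. y + max 0 (w - r * y) \<noteq> c"
      using atoms[of c]
    proof eventually_elim
      fix y assume "y \<noteq> c"
      show "AE w in N. y + max 0 (w - r * y) \<noteq> c"
        using atoms[of "c - y + r * y"]
      proof eventually_elim
        fix w assume "w \<noteq> c - y + r * y"
        then show "y + max 0 (w - r * y) \<noteq> c" using \<open>y \<noteq> c\<close> by linarith
      qed
    qed
    moreover have "{p \<in> space (N \<Otimes>\<^sub>M N). (case p of (y, w) \<Rightarrow> y + max 0 (w - r * y)) \<noteq> c} \<in> sets (N \<Otimes>\<^sub>M N)"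
      by measurable
    ultimately have "AE p in N \<Otimes>\<^sub>M N. (case p of (y, w) \<Rightarrow> y + max 0 (w - r * y)) \<noteq> c"
      by (intro NN.AE_pair_measure) (simp_all only: prod.case)
    then show ?thesis
      unfolding NT_def by (simp add: AE_distr_iff)
  qed
  let ?v = "LINT x|NT. (x - (LINT x|NT. x))\<^sup>2"
  have "integrable NT (\<lambda>x. (x - (LINT x|NT. x))\<^sup>2)"
    unfolding power2_diff using NT_sq NT.square_integrable_imp_integrable[OF _ NT_sq] by auto
  from integral_nonneg_eq_0_iff_AE[OF this] have "?v = 0 \<Longrightarrow> (AE x in NT. x = (LINT x|NT. x))"
    by (simp only: zero_le_power2 AE_I2 power2_eq_iff zero_eq_power2 right_minus_eq simp_thms)
  moreover have "\<not> (AE x in NT. x = (LINT x|NT. x))"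
  proof
    assume "AE x in NT. x = (LINT x|NT. x)"
    then have "AE x in NT. False" using NT_atoms[of "LINT x|NT. x"] by eventually_elim simp
    then show False by simp
  qed
  moreover have "0 \<le> ?v" by (rule integral_nonneg_AE) simp
  ultimately show "0 < ?v" by (metis less_le)
qed

end

section \<open>The constant \<open>c\<close> and the influence function \<open>H\<close>\<close>

text \<open>For \<open>y \<ge> 0\<close> the factor \<open>1 - F2 y\<close> is the tail probability of \<open>F1\<close> at \<open>r * y\<close>. This makes
  \<open>- c * E X2\<close> the derivative of the mean excess at \<open>r\<close>.\<close>

lemma c_const_eq:
  assumes F1: "lifetime_cdf_density F1 f1" and F2: "F2 \<in> borel_measurable borel"
    and F2_eq: "\<And>t. t \<ge> 0 \<Longrightarrow> F2 t = F1 (r * t)"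
  defines "N \<equiv> density lborel f1"
  shows "c_const M F1 F2 X2
    = (LINT y|N. y * real_distribution.tail_prob N (\<lambda>x. x) (r * y)) / (LINT \<omega>|M. X2 \<omega>)"
proof -
  interpret N: real_distribution N unfolding N_def by (rule lifetime_real_distribution[OF F1])
  note [measurable] = F2
  have cdf: "F1 = cdf N" using F1 by (simp add: lifetime_cdf_density_def N_def)
  have "(LINT y:{0..}|interval_measure F1. y * (1 - F2 y)) = (LINT y|N. y * N.tail_prob (\<lambda>x. x) (r * y))"
    unfolding cdf interval_measure_cdf[OF N.real_distribution_axioms] set_lebesgue_integral_def N.tail_prob_id
  proof (rule integral_cong_AE)
    have [measurable]: "cdf N \<in> borel_measurable borel"
      using borel_measurable_mono[of "cdf N"] N.cdf_nondecreasing by (simp add: mono_def)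
    show "(\<lambda>y. indicator {0..} y *\<^sub>R (y * (1 - F2 y))) \<in> borel_measurable N" by measurable
    show "(\<lambda>y. y * (1 - cdf N (r * y))) \<in> borel_measurable N" by measurable
    show "AE y in N. indicator {0..} y *\<^sub>R (y * (1 - F2 y)) = y * (1 - cdf N (r * y))"
      using lifetime_pos[OF F1, folded N_def] by eventually_elim (simp add: F2_eq cdf)
  qed
  then show ?thesis
    by (simp add: c_const_def)
qed

text \<open>Writing \<open>max 0 (x - r * y)\<close> and \<open>max 0 (y - r * x)\<close> with indicators expresses both conditional
  expectations through the c.d.f. and truncated first moments; a hot lifetime has the law of \<open>r\<close> times a
  warm one, which brings in the truncated moment of \<open>X2\<close>.\<close>

lemma H_fun_eq_excess_proj:
  fixes X1 X2 :: "'w \<Rightarrow> real"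
  assumes M: "prob_space M" and [measurable]: "X1 \<in> borel_measurable M" "X2 \<in> borel_measurable M"
    and N1: "distr M borel X1 = N" and scaled: "N = distr (distr M borel X2) borel (\<lambda>x. r * x)"
    and F1: "F1 = cdf N" and F2: "\<And>t. t \<ge> 0 \<Longrightarrow> F2 t = F1 (r * t)"
    and int: "integrable N (\<lambda>x. x)" and "r > 0" "x \<ge> 0"
  shows "H_fun M F1 F2 r X1 X2 x = (LINT x|N. x)
    - ((1 - c_const M F1 F2 X2) * x + real_distribution.excess_proj N (\<lambda>x. x) (\<lambda>y. r * y) x)"
proof -
  interpret M: prob_space M by fact
  interpret N: real_distribution N unfolding N1[symmetric] by simp
  have ind_le: "N.prob {..a} = F1 a" for a
    by (simp add: F1 cdf_def)
  have int': "integrable N (\<lambda>y. indicator {..a} y * y)" "integrable N (indicator {..a} :: real \<Rightarrow> real)" for a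
    using integrable_real_mult_indicator[OF _ int, of "{..a}"] by (auto simp: mult.commute N.emeasure_eq_measure)
  have E1: "M.expectation (\<lambda>\<omega>. indicator {..a} (X1 \<omega>) * X1 \<omega>) = N.expectation (\<lambda>y. indicator {..a} y * y)" for a
    unfolding N1[symmetric] by (simp add: integral_distr)
  have E2: "N.expectation (\<lambda>y. indicator {..r * a} y * y) = r * M.expectation (\<lambda>\<omega>. indicator {..a} (X2 \<omega>) * X2 \<omega>)" for a
  proof -
    have "N.expectation (\<lambda>y. indicator {..r * a} y * y)
        = M.expectation (\<lambda>\<omega>. indicator {..r * a} (r * X2 \<omega>) * (r * X2 \<omega>))"
      unfolding scaled by (simp add: integral_distr)
    also have "\<dots> = M.expectation (\<lambda>\<omega>. r * (indicator {..a} (X2 \<omega>) * X2 \<omega>))"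
      using \<open>r > 0\<close> by (intro Bochner_Integration.integral_cong) (auto split: split_indicator)
    finally show ?thesis by simp
  qed
  have snd: "N.expectation (\<lambda>y. max 0 (x - r * y)) = x * F1 (x / r) - r * N.expectation (\<lambda>y. indicator {..x / r} y * y)"
  proof -
    have "N.expectation (\<lambda>y. max 0 (x - r * y))
      = N.expectation (\<lambda>y. x * indicator {..x / r} y - r * (indicator {..x / r} y * y))"
      using \<open>r > 0\<close> by (intro Bochner_Integration.integral_cong) (auto simp: field_simps split: split_indicator)
    then show ?thesis using int'[of "x / r"] by (simp add: ind_le)
  qed
  have fst: "N.expectation (\<lambda>y. max 0 (y - r * x))
      = (LINT y|N. y) - r * x - N.expectation (\<lambda>y. indicator {..r * x} y * y) + r * x * F1 (r * x)"
  proof -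
    have "N.expectation (\<lambda>y. max 0 (y - r * x))
      = N.expectation (\<lambda>y. y - r * x - indicator {..r * x} y * y + r * x * indicator {..r * x} y)"
      by (intro Bochner_Integration.integral_cong) (auto split: split_indicator)
    then show ?thesis using int'[of "r * x"] int N.prob_space by (simp add: ind_le)
  qed
  show ?thesis
    unfolding H_fun_def N.excess_proj_def fst snd E1 E2 F2[OF \<open>x \<ge> 0\<close>]
    by (simp add: algebra_simps)
qed

lemma variance_H_fun:
  fixes X1 X2 :: "'w \<Rightarrow> real"
  assumes M: "prob_space M" and [measurable]: "X1 \<in> borel_measurable M" "X2 \<in> borel_measurable M" "F2 \<in> borel_measurable borel"
    and N: "distr M borel X1 = N" and scaled: "N = distr (distr M borel X2) borel (\<lambda>x. r * x)"
    and F1: "F1 = cdf N" and F2: "\<And>t. t \<ge> 0 \<Longrightarrow> F2 t = F1 (r * t)"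
    and sq: "integrable N (\<lambda>x. x\<^sup>2)" and nonneg: "AE x in N. 0 \<le> x" and "r > 0"
  defines "G \<equiv> \<lambda>x. (1 - c_const M F1 F2 X2) * x + real_distribution.excess_proj N (\<lambda>x. x) (\<lambda>y. r * y) x"
  shows "prob_space.variance M (\<lambda>\<omega>. H_fun M F1 F2 r X1 X2 (X1 \<omega>)) = prob_space.variance N G"
proof -
  interpret M: prob_space M by fact
  interpret N: real_distribution N unfolding N[symmetric] by simp
  have int: "integrable N (\<lambda>x. x)"
    by (rule N.square_integrable_imp_integrable[OF _ sq]) measurable
  have rsq: "integrable N (\<lambda>x. (r * x)\<^sup>2)"
    unfolding power_mult_distrib by (intro integrable_mult_right sq)
  have [measurable]: "G \<in> borel_measurable borel" unfolding G_def by measurable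
  have "integrable N (\<lambda>x. (G x)\<^sup>2)"
    unfolding G_def by (rule N.affine_excess_proj_square_integrable[OF _ _ int sq rsq]) measurable
  then have "integrable N G" by (rule N.square_integrable_imp_integrable[rotated]) measurable
  then have G_int: "integrable M (\<lambda>\<omega>. G (X1 \<omega>))"
    unfolding N[symmetric] by (subst (asm) integrable_distr_eq) measurable
  have expectation: "M.expectation (\<lambda>\<omega>. g (X1 \<omega>)) = N.expectation g"
    if [measurable]: "g \<in> borel_measurable borel" for g :: "real \<Rightarrow> real"
    unfolding N[symmetric] by (subst integral_distr) measurable
  let ?H = "\<lambda>\<omega>. H_fun M F1 F2 r X1 X2 (X1 \<omega>)"
  let ?H' = "\<lambda>\<omega>. (LINT x|N. x) - G (X1 \<omega>)"
  have "AE x in distr M borel X1. 0 \<le> x" using nonneg by (simp only: N)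
  then have "AE \<omega> in M. 0 \<le> X1 \<omega>" by (simp add: AE_distr_iff)
  then have ae: "AE \<omega> in M. ?H \<omega> = ?H' \<omega>"
  proof eventually_elim
    case (elim \<omega>)
    show ?case
      unfolding G_def by (rule H_fun_eq_excess_proj[OF M _ _ N scaled F1 F2 int \<open>r > 0\<close> elim]) simp_all
  qed
  have [measurable]: "?H \<in> borel_measurable M"
  proof -
    have [measurable]: "F1 \<in> borel_measurable borel"
      using borel_measurable_mono[of "cdf N"] N.cdf_nondecreasing by (simp add: mono_def F1)
    show ?thesis
      unfolding H_fun_def indicator_eq_if by measurable
  qed
  have "M.expectation ?H = M.expectation ?H'"
    by (rule integral_cong_AE[OF _ _ ae]) measurable
  also have "\<dots> = M.expectation (\<lambda>\<omega>. LINT x|N. x) - M.expectation (\<lambda>\<omega>. G (X1 \<omega>))"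
    using G_int by (intro Bochner_Integration.integral_diff M.integrable_const)
  finally have mean: "M.expectation ?H = (LINT x|N. x) - N.expectation G"
    by (simp add: expectation M.prob_space)
  have "M.variance ?H = M.expectation (\<lambda>\<omega>. (G (X1 \<omega>) - N.expectation G)\<^sup>2)"
  proof (rule integral_cong_AE)
    show "AE \<omega> in M. (?H \<omega> - M.expectation ?H)\<^sup>2 = (G (X1 \<omega>) - N.expectation G)\<^sup>2"
      unfolding mean using ae by eventually_elim (simp add: power2_commute)
  qed measurable
  also have "\<dots> = N.variance G"
    by (rule expectation) measurable
  finally show ?thesis .
qed

section \<open>Asymptotic normality of the test statistic\<close>

theorem theorem3p1:
  fixes M :: "'w measure"
    and F1 F2 f1 f2 :: "real \<Rightarrow> real"
    and r l1 l2 \<sigma>2 :: real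
    and T1 T2 T Y Z :: "nat \<Rightarrow> 'w \<Rightarrow> real"
    and n1 n2 :: "nat \<Rightarrow> nat"
    and i :: nat
  assumes "prob_space M"
    and "lifetime_cdf_density F1 f1"
    and "lifetime_cdf_density F2 f2"
    and "r > 0"
    and "\<And>k. H0_star M F1 F2 f1 f2 r (Y k) (Z k)"
    and "\<And>k \<omega>. T k \<omega> = max (Y k \<omega>) (Z k \<omega>)"
    and "\<And>k. cdf (distr M borel (T1 k)) = F1"
    and "\<And>k. cdf (distr M borel (T2 k)) = F2"
    and "prob_space.indep_vars M (\<lambda>_. borel)
           (\<lambda>s. case s of Inl k \<Rightarrow> T1 k | Inr (Inl k) \<Rightarrow> T2 k | Inr (Inr k) \<Rightarrow> T k)
           (UNIV :: (nat + nat + nat) set)"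
    and "integrable M (\<lambda>\<omega>. (T2 i \<omega>)\<^sup>2)"
    and "l1 \<in> {0<..<1}" and "l2 \<in> {0<..<1}"
    and "(\<lambda>n. real (n1 n) / real n) \<longlonglongrightarrow> l1"
    and "(\<lambda>n. real (n2 n) / real n) \<longlonglongrightarrow> l2"
    and "\<sigma>2 = prob_space.variance M (T i)
           + 1 / l1 * prob_space.variance M (\<lambda>\<omega>. H_fun M F1 F2 r (T1 i) (T2 i) (T1 i \<omega>))
           + (c_const M F1 F2 (T2 i))\<^sup>2 * r\<^sup>2 / l2 * prob_space.variance M (T2 i)"
  shows "weak_conv_m (\<lambda>n. distr M borel (test_stat T1 T2 T (n1 n) (n2 n) n))
           (density lborel (normal_density 0 (sqrt \<sigma>2)))"
proof -
  note F1 = assms(2) and F2 = assms(3) and \<sigma>2 = assms(15)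
  interpret prob_space M by fact
  define N1 where "N1 = density lborel f1"
  define N2 where "N2 = density lborel f2"
  define NT where "NT = distr (N1 \<Otimes>\<^sub>M N1) borel (\<lambda>(y, w). y + max 0 (w - r * y))"

  let ?W = "\<lambda>s. case s of Inl k \<Rightarrow> T1 k | Inr (Inl k) \<Rightarrow> T2 k | Inr (Inr k) \<Rightarrow> T k"
  note indep = assms(9)
  have "indep_vars (\<lambda>_. borel) (\<lambda>k. ?W (Inl k)) (UNIV :: nat set)"
    "indep_vars (\<lambda>_. borel) (\<lambda>k. ?W (Inr (Inl k))) (UNIV :: nat set)"
    "indep_vars (\<lambda>_. borel) (\<lambda>k. ?W (Inr (Inr k))) (UNIV :: nat set)"
    by (intro indep_vars_reindex_inj[where f = Inl] indep_vars_reindex_inj[where f = "\<lambda>k. Inr (Inl k)"]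
        indep_vars_reindex_inj[where f = "\<lambda>k. Inr (Inr k)"] indep_vars_subset[OF indep]; simp add: inj_on_def)+
  then have ind: "indep_vars (\<lambda>_. borel) T1 UNIV" "indep_vars (\<lambda>_. borel) T2 UNIV" "indep_vars (\<lambda>_. borel) T UNIV"
    by simp_all
  then have [measurable]: "random_variable borel (T1 k)" "random_variable borel (T2 k)" "random_variable borel (T k)" for k
    by (simp_all add: indep_vars_def2)
  have law1: "distr M borel (T1 k) = N1" for k
    using assms(7)[of k] F1 lifetime_real_distribution[OF F1]
    by (intro cdf_unique) (auto simp: N1_def lifetime_cdf_density_def)
  have law2: "distr M borel (T2 k) = N2" for k
    using assms(8)[of k] F2 lifetime_real_distribution[OF F2]
    by (intro cdf_unique) (auto simp: N2_def lifetime_cdf_density_def)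
  have lawT: "distr M borel (T k) = NT" for k
    using law_of_system[OF assms(1-5), of k] assms(6) unfolding NT_def N1_def by presburger
  interpret A: iid_sample M T1 N1 by unfold_locales (fact ind law1)+
  interpret B: iid_sample M T2 N2 by unfold_locales (fact ind law2)+
  interpret C: iid_sample M T NT by unfold_locales (fact ind lawT)+

  have F2_eq: "F2 t = F1 (r * t)" if "t \<ge> 0" for t
    using assms(5)[of 0] that by (simp add: H0_star_def)
  have cdf1: "F1 = cdf N1" using F1 by (simp add: lifetime_cdf_density_def N1_def)
  have scaled: "N1 = distr N2 borel (\<lambda>x. r * x)"
    unfolding N1_def N2_def by (rule lifetime_law_scaled[OF F1 F2 assms(4) F2_eq])
  have pos1: "AE x in N1. 0 < x" and pos2: "AE x in N2. 0 < x"
    unfolding N1_def N2_def using lifetime_pos F1 F2 by blast+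
  have nonneg1: "AE x in N1. 0 \<le> x" using pos1 by eventually_elim simp
  have no_atoms: "measure N1 {x} = 0" for x
    unfolding N1_def by (rule lifetime_no_atoms[OF F1])
  have sq2: "integrable N2 (\<lambda>x. x\<^sup>2)"
    using assms(10) B.integrable_sample[of "\<lambda>x. x\<^sup>2" i] by simp
  have sq1: "integrable N1 (\<lambda>x. x\<^sup>2)"
    unfolding scaled using sq2 by (simp add: integrable_distr_eq power_mult_distrib)
  have int1: "integrable N1 (\<lambda>x. x)"
    using sq1 by (auto intro!: A.N.square_integrable_imp_integrable)
  have mean1: "(LINT x|N1. x) = r * (LINT x|N2. x)"
    unfolding scaled by (simp add: integral_distr)
  note system = A.system_law_moments[OF sq1 no_atoms nonneg1, of r, folded NT_def]

  define c where "c = c_const M F1 F2 (T2 i)"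
  define q where "q y = r * y" for y :: real
  have [measurable]: "q \<in> borel_measurable borel" unfolding q_def[abs_def] by measurable
  have q_int: "integrable N1 q" "integrable N1 (\<lambda>x. (q x)\<^sup>2)"
    using int1 sq1 by (auto simp: q_def[abs_def] power_mult_distrib)
  \<comment> \<open>the influence of an observation of the first sample: \<open>x\<close> from its mean, the projection of the
    average over pairs, and \<open>- c * x\<close> from the estimated ratio\<close>
  define G where "G x = (1 - c) * x + A.N.excess_proj (\<lambda>x. x) q x" for x
  have [measurable]: "G \<in> borel_measurable borel" unfolding G_def[abs_def] by measurable
  have F2_meas: "F2 \<in> borel_measurable borel"
    using borel_measurable_mono[of "cdf N2"] B.N.cdf_nondecreasing F2
    by (simp add: mono_def lifetime_cdf_density_def N2_def)
  have "expectation (T2 i) = (LINT x|N2. x)"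
    by (rule B.expectation_sample) measurable
  with c_const_eq[OF F1 F2_meas F2_eq, of M "T2 i"]
  have c_eq: "c = (LINT y|N1. y * A.N.tail_prob (\<lambda>x. x) (r * y)) / (LINT x|N2. x)"
    by (simp only: c_def N1_def)
  have G_sq: "integrable N1 (\<lambda>x. (G x)\<^sup>2)"
    unfolding G_def by (rule A.N.affine_excess_proj_square_integrable[OF _ _ int1 sq1 q_int(2)]) measurable
  have G_mean: "A.N.expectation G = (1 - c) * (LINT x|N1. x) + 2 * A.N.mean_excess (\<lambda>x. x) q"
    unfolding G_def by (rule A.N.expectation_affine_excess_proj[OF _ _ int1 sq1 q_int(2)]) measurable
  have var_H: "variance (\<lambda>\<omega>. H_fun M F1 F2 r (T1 i) (T2 i) (T1 i \<omega>)) = A.N.variance G"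
    unfolding G_def c_def q_def
    by (rule variance_H_fun[OF assms(1) _ _ F2_meas law1 _ cdf1 F2_eq sq1 nonneg1 assms(4)])
      (simp_all add: law2 scaled[symmetric])
  have var_T: "variance (T i) = C.N.variance (\<lambda>x. x)" "variance (T2 i) = B.N.variance (\<lambda>x. x)"
    using C.expectation_sample[of "\<lambda>x. x" i] C.expectation_sample[of "\<lambda>x. (x - (LINT x|NT. x))\<^sup>2" i]
      B.expectation_sample[of "\<lambda>x. x" i] B.expectation_sample[of "\<lambda>x. (x - (LINT x|N2. x))\<^sup>2" i]
    by simp_all
  have l: "l1 > 0" "l2 > 0" using assms(11,12) by auto
  define a1 a2 where "a1 = 1 / sqrt l1" and "a2 = c * r / sqrt l2"
  have \<sigma>2_eq: "\<sigma>2 = C.N.variance (\<lambda>x. x) + a1\<^sup>2 * A.N.variance G + a2\<^sup>2 * B.N.variance (\<lambda>x. x)"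
    unfolding \<sigma>2 var_H var_T c_def[symmetric] using l by (simp add: a1_def a2_def power_divide power_mult_distrib)
  \<comment> \<open>a law without atoms has positive variance; \<open>normal_density 0 0\<close> is constantly \<open>0\<close>, not a density\<close>
  have "\<sigma>2 > 0"
    unfolding \<sigma>2_eq using system(4) A.N.variance_positive[of G] B.N.variance_positive[of "\<lambda>x. x"]
    by (intro add_pos_nonneg mult_nonneg_nonneg) auto

  \<comment> \<open>the linear part of the statistic, with the limits of \<open>sqrt (n / n1 n)\<close> and \<open>sqrt (n / n2 n)\<close> as weights\<close>
  define L where "L n \<omega> = a1 * A.fluctuation G (n1 n) \<omega> + (a2 * B.fluctuation (\<lambda>x. x) (n2 n) \<omega>
      + (- 1) * C.fluctuation (\<lambda>x. x) n \<omega>)" for n \<omega>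
  note lim1 = sample_size_limits[OF assms(13) l(1)] and lim2 = sample_size_limits[OF assms(14) l(2)]
  have char_L: "(\<lambda>n. char (distr M borel (L n)) t) \<longlonglongrightarrow> complex_of_real (exp (- (\<sigma>2 * t\<^sup>2) / 2))" for t
    unfolding L_def[abs_def]
    by (rule char_three_fluctuations_tendsto[OF A.iid_sample_axioms B.iid_sample_axioms C.iid_sample_axioms indep
          _ _ _ G_sq sq2 system(1) lim1(1) lim2(1) filterlim_ident])
      (simp_all add: \<sigma>2_eq)

  define X where "X n = test_stat T1 T2 T (n1 n) (n2 n) n" for n
  have [measurable]: "random_variable borel (X n)" for n
    unfolding X_def by (rule test_stat_measurable) measurable
  have [measurable]: "random_variable borel (L n)" for n
    unfolding L_def by measurable
  define b1 where "b1 n = sqrt (real n) / sqrt (real (n1 n))" for n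
  define b2 where "b2 n = sqrt (real n) / sqrt (real (n2 n))" for n
  define E where "E n \<omega> = sqrt (real n) *
      (A.excess_avg (\<lambda>x. x) (\<lambda>y. r_hat T1 T2 (n1 n) (n2 n) \<omega> * y) (n1 n) \<omega> - A.excess_avg (\<lambda>x. x) q (n1 n) \<omega>)
      + c * (sqrt (real n) * (emp_mean T1 (n1 n) \<omega> - r * emp_mean T2 (n2 n) \<omega>))" for n \<omega>
  \<comment> \<open>the remainder: wrong weights, the residual of the average over pairs, and the linearisation
    error \<open>E\<close> of the estimated ratio\<close>
  let ?R = "\<lambda>n \<omega>. ((b1 n - a1) * A.fluctuation G (n1 n) \<omega> + c * r * ((b2 n - 1 / sqrt l2) * B.fluctuation (\<lambda>x. x) (n2 n) \<omega>))
      + (sqrt (real n) * A.excess_residual (\<lambda>x. x) q (n1 n) \<omega> + E n \<omega>)"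
  have "vanishes_in_prob ?R"
  proof (intro vanishes_in_prob_add vanishes_in_prob_cmult)
    show "vanishes_in_prob (\<lambda>n \<omega>. (b1 n - a1) * A.fluctuation G (n1 n) \<omega>)"
      by (rule bounded_in_prob_null_seq_mult[OF LIM_zero[OF lim1(2)[folded b1_def a1_def]] A.bounded_fluctuation[OF _ G_sq]]) measurable
    show "vanishes_in_prob (\<lambda>n \<omega>. (b2 n - 1 / sqrt l2) * B.fluctuation (\<lambda>x. x) (n2 n) \<omega>)"
      by (rule bounded_in_prob_null_seq_mult[OF LIM_zero[OF lim2(2)[folded b2_def]] B.bounded_fluctuation[OF _ sq2]]) measurable
    show "vanishes_in_prob (\<lambda>n \<omega>. sqrt (real n) * A.excess_residual (\<lambda>x. x) q (n1 n) \<omega>)"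
      by (rule A.excess_residual_vanishes[OF _ _ int1 q_int(1) lim1(1,3)]) measurable
    show "vanishes_in_prob E"
      unfolding E_def[abs_def] c_eq q_def[abs_def]
      by (rule excess_at_ratio_of_means[OF A.iid_sample_axioms B.iid_sample_axioms sq1 sq2 no_atoms pos2 mean1
          assms(13) l(1) assms(14) l(2)])
  qed
  then have "vanishes_in_prob (\<lambda>n \<omega>. X n \<omega> - L n \<omega>)"
  proof (rule vanishes_in_prob_le)
    have "AE \<omega> in M. \<forall>k. 0 \<le> T1 k \<omega>" "AE \<omega> in M. \<forall>k. 0 \<le> T k \<omega>"
      unfolding AE_all_countable
      using nonneg1 system(3) A.AE_sample[of "\<lambda>x. 0 \<le> x"] C.AE_sample[of "\<lambda>x. 0 \<le> x"] by simp_all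
    note nonneg = this
    show "\<forall>\<^sub>F n in sequentially. AE \<omega> in M. \<bar>X n \<omega> - L n \<omega>\<bar> \<le> \<bar>?R n \<omega>\<bar>"
      using lim1(4) lim2(4) eventually_gt_at_top[of 0]
    proof eventually_elim
      case (elim n)
      show ?case
        using nonneg
      proof eventually_elim
        fix \<omega> assume pos: "\<forall>k. 0 \<le> T1 k \<omega>" "\<forall>k. 0 \<le> T k \<omega>"
        define s where "s = sqrt (real n)"
        define V where "V = A.excess_avg (\<lambda>x. x) (\<lambda>y. r_hat T1 T2 (n1 n) (n2 n) \<omega> * y) (n1 n) \<omega>"
        define V0 where "V0 = A.excess_avg (\<lambda>x. x) q (n1 n) \<omega>"
        define \<mu>1 \<mu>2 U where "\<mu>1 = (LINT x|N1. x)" and "\<mu>2 = (LINT x|N2. x)" and "U = A.N.mean_excess (\<lambda>x. x) q"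
        define e1 e2 eT p where "e1 = emp_mean T1 (n1 n) \<omega>" and "e2 = emp_mean T2 (n2 n) \<omega>"
          and "eT = (\<Sum>k<n. T k \<omega>) / real n"
          and "p = (\<Sum>k<n1 n. A.N.excess_proj (\<lambda>x. x) q (T1 k \<omega>)) / real (n1 n)"
        have X: "X n \<omega> = s * (e1 + V - eT)"
          unfolding X_def s_def V_def e1_def eT_def A.excess_avg_def
          by (subst test_stat_eq) (use pos elim in \<open>simp_all add: emp_mean_def\<close>)
        have G: "b1 n * A.fluctuation G (n1 n) \<omega> = s * ((1 - c) * e1 + p - ((1 - c) * \<mu>1 + 2 * U))"
        proof -
          have "(\<Sum>k<n1 n. G (T1 k \<omega>)) / real (n1 n) = (1 - c) * e1 + p"
            by (simp add: G_def sum.distrib sum_distrib_left[symmetric] add_divide_distrib e1_def p_def emp_mean_def)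
          then have "1 / sqrt (real (n1 n)) * A.fluctuation G (n1 n) \<omega> = (1 - c) * e1 + p - ((1 - c) * \<mu>1 + 2 * U)"
            using A.mean_minus_expectation[OF elim(1), of G \<omega>] by (simp add: G_mean \<mu>1_def U_def)
          moreover have "b1 n * A.fluctuation G (n1 n) \<omega> = s * (1 / sqrt (real (n1 n)) * A.fluctuation G (n1 n) \<omega>)"
            by (simp add: b1_def s_def)
          ultimately show ?thesis by (simp only:)
        qed
        have T2: "b2 n * B.fluctuation (\<lambda>x. x) (n2 n) \<omega> = s * (e2 - \<mu>2)"
        proof -
          have "1 / sqrt (real (n2 n)) * B.fluctuation (\<lambda>x. x) (n2 n) \<omega> = e2 - \<mu>2"
            using B.mean_minus_expectation[OF elim(2), of "\<lambda>x. x" \<omega>] by (simp add: e2_def \<mu>2_def emp_mean_def)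
          moreover have "b2 n * B.fluctuation (\<lambda>x. x) (n2 n) \<omega> = s * (1 / sqrt (real (n2 n)) * B.fluctuation (\<lambda>x. x) (n2 n) \<omega>)"
            by (simp add: b2_def s_def)
          ultimately show ?thesis by (simp only:)
        qed
        have T: "C.fluctuation (\<lambda>x. x) n \<omega> = s * (eT - (\<mu>1 + U))"
          using C.mean_minus_expectation[OF elim(3), of "\<lambda>x. x" \<omega>] elim(3) system(2)
          by (simp add: s_def eT_def \<mu>1_def U_def q_def[abs_def] field_simps)
        have res: "A.excess_residual (\<lambda>x. x) q (n1 n) \<omega> = V0 - p + U"
          by (simp add: A.excess_residual_def V0_def p_def U_def)
        have E: "E n \<omega> = s * (V - V0) + c * (s * (e1 - r * e2))"
          by (simp add: E_def s_def V_def V0_def e1_def e2_def)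
        have L: "L n \<omega> = a1 * A.fluctuation G (n1 n) \<omega> + (c * r * (1 / sqrt l2 * B.fluctuation (\<lambda>x. x) (n2 n) \<omega>)
            - s * (eT - (\<mu>1 + U)))"
          by (simp add: L_def a2_def T)
        \<comment> \<open>the centring constants cancel because \<open>E T = \<mu>1 + U\<close> and \<open>\<mu>1 = r * \<mu>2\<close>\<close>
        have "?R n \<omega> + L n \<omega> = b1 n * A.fluctuation G (n1 n) \<omega> + c * r * (b2 n * B.fluctuation (\<lambda>x. x) (n2 n) \<omega>)
            + (s * (V0 - p + U) + E n \<omega>) - s * (eT - (\<mu>1 + U))"
          unfolding L res s_def[symmetric] by (simp add: algebra_simps)
        also have "\<dots> = s * (e1 + V - eT) + s * c * (\<mu>1 - r * \<mu>2)"
          unfolding G T2 E by (simp add: algebra_simps)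
        also have "\<mu>1 - r * \<mu>2 = 0" using mean1 by (simp add: \<mu>1_def \<mu>2_def)
        finally have "X n \<omega> - L n \<omega> = ?R n \<omega>" using X by simp
        then show "\<bar>X n \<omega> - L n \<omega>\<bar> \<le> \<bar>?R n \<omega>\<bar>" by simp
      qed
    qed
  qed measurable
  from char_add_vanishing[OF _ this char_L]
  have char_X: "(\<lambda>n. char (distr M borel (X n)) t) \<longlonglongrightarrow> complex_of_real (exp (- (\<sigma>2 * t\<^sup>2) / 2))" for t
    by simp
  show ?thesis
    unfolding X_def[symmetric]
  proof (rule levy_continuity)
    show "real_distribution (distr M borel (X n))" for n by simp
    show "real_distribution (density lborel (normal_density 0 (sqrt \<sigma>2)))"
      by (rule real_distribution_normal) (use \<open>\<sigma>2 > 0\<close> in simp)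
    show "(\<lambda>n. char (distr M borel (X n)) t) \<longlonglongrightarrow> char (density lborel (normal_density 0 (sqrt \<sigma>2))) t" for t
      using char_X[of t] char_normal[of "sqrt \<sigma>2" t] \<open>\<sigma>2 > 0\<close> by simp
  qed
qed

end
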